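(* Let $\mathbb{F}_q$ be a finite field of characteristic different from $2$ and $3$, with $q>4$. Let $L$ be a generic line of $PG(V_3)=PG(3,q)$ with coordinates $(z_0,\dots,z_5)$, let $\varphi_L=z_0Y^4-4z_1Y^3X+6z_2Y^2X^2-4z_3YX^3+z_4X^4$ be the associated quartic form, and let $\mathcal{S}$ be the set of the $q+1$ points (over $\mathbb{F}_q$) of $L$. Write $\sqrt{I_\varphi}:=z_5$, $I_\varphi=I(\varphi_L)$, $J_\varphi=J(\varphi_L)$, and let $E_L$ be the elliptic curve $$E_L:\quad T^2=4S^3-g_2(L)\,S-g_3(L),$$ $$g_2(L)=3\sqrt{I_\varphi}\,J_\varphi+\tfrac{15}{4}I_\varphi^2,\qquad g_3(L)=-\tfrac18\left(11I_\varphi^3+2J_\varphi^2+14\sqrt{I_\varphi}^{\,3}J_\varphi\right).$$ Let $\#E_L(\mathbb{F}_q)$ be its number of $\mathbb{F}_q$-points including the point at infinity. Let $\eta_L=i$ if $\varphi_L\in\mathcal{F}_i$ for $i\in\{1,2,4\}$, and $\eta_L=0$ if $\varphi_L\in\mathcal{F}_2'\cup\mathcal{F}_4'$. Then 1. $|\mathcal{S}\cap O_1|=0$; 2. $|\mathcal{S}\cap O_2|=\eta_L$; 3. $|\mathcal{S}\cap O_3|=\dfrac{\#E_L(\mathbb{F}_q)-3\eta_L}{6}$; 4. $|\mathcal{S}\cap O_4|=q+1-\dfrac{\#E_L(\mathbb{F}_q)+\eta_L}{2}$; 5. $|\mathcal{S}\cap O_5|=\dfrac{\#E_L(\mathbb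{F}_q)}{3}$.
   Context: $V_m$ is the $(m+1)$-dimensional $\mathbb{F}_q$-vector space of homogeneous degree-$m$ polynomials in $X,Y$. $GL_2(q)$ acts on $V_m$ by $(g\cdot f)(X,Y)=\det(g)^{-m}f(dX-bY,aY-cX)$ for $g=\begin{pmatrix} a & b \\ c & d \end{pmatrix}$, inducing an action of $G=PGL_2(q)$ on $PG(V_m)$. Points of $PG(3,q)$ are identified with $PG(V_3)$. The five $G$-orbits on $PG(V_3)$ are: $O_1=G\cdot X^3$; $O_2=G\cdot X^2Y$; $O_3=G\cdot XY(X-Y)$; $O_4=G\cdot X(X^2-\epsilon Y^2)$ with $\epsilon$ a nonsquare in $\mathbb{F}_q$; $O_5=$ the orbit of irreducible cubic forms. The twisted cubic $C$ is the set of points $(Xt-Ys)^3$; the osculating plane to $C$ at $(Xt-Ys)^3$ is the set of cubic forms divisible by $Xt-Ys$. A line $L$ of $PG(V_3)$ (a pencil of cubic forms) is non-generic if it meets $C$ or is contained in an osculating plane of $C$ (i.e. all its forms have a common linear factor), where points and osculating planes of $C$ over an algebraic closure $\overline{\mathbb{F}_q}$ are allowed; otherwise it is generic. Coordinates of a line: if $L$ is spanned by $u=u_0Y^3-3u_1Y^2X+3u_2YX^2-u_3X^3$ and $v=v_0Y^3-3v_1Y^2X+3v_2YX^2-v_3X^3$, let $p_{ij}=u_iv_j-u_jv_i$. The coordinates $(z_0,\dots,z_5)$ of $L$ (defined up to a common nonzero scalar) are determined by $(p_{01},p_{02},p_{03},p_{12},p_{13},p_{23})=(z_0,2z_1,3(z_2+z_5),z_2-z_5,2z_3,z_4)$.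 For a quartic form $\varphi=z_0Y^4-4z_1Y^3X+6z_2Y^2X^2-4z_3YX^3+z_4X^4$ put $$I(\varphi)=(z_0z_4-4z_1z_3+3z_2^2)/3,\qquad J(\varphi)=\det\begin{pmatrix} z_0 & z_1 & z_2 \\ z_1 & z_2 & z_3 \\ z_2 & z_3 & z_4 \end{pmatrix}.$$ The coordinates of a line satisfy $z_5^2=I(\varphi_L)$. The quartic forms over $\mathbb{F}_q$ with nonzero discriminant are partitioned according to their (pairwise non-proportional) irreducible factors over $\mathbb{F}_q$: $\mathcal{F}_4$: four linear forms; $\mathcal{F}_2$: two linear forms and one quadratic form; $\mathcal{F}_1$: one linear form and one cubic form; $\mathcal{F}_4'$: two quadratic forms; $\mathcal{F}_2'$: irreducible quartic. For generic $L$, $\varphi_L$ has nonzero discriminant. *)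

theory Defs
  imports
    "HOL-Analysis.Determinants"
    "HOL-Algebra.Algebraic_Closure_Type"
begin

section \<open>Binary forms\<close>

text \<open>The polynomial ring \<open>k[X, Y]\<close> is \<^typ>\<open>'k poly poly\<close>: the outer variable is \<open>Y\<close>,
  and the coefficients are polynomials in \<open>X\<close>.\<close>

definition var_X :: "'k::field poly poly" where
  "var_X = [:[:0, 1:]:]"

definition var_Y :: "'k::field poly poly" where
  "var_Y = [:0, 1:]"

definition form_scale :: "'k::field \<Rightarrow> 'k poly poly \<Rightarrow> 'k poly poly" where
  "form_scale c f = smult [:c:] f"

global_interpretation form: vector_space form_scale
  by unfold_locales
    (simp_all add: form_scale_def smult_add_right smult_add_left [symmetric] mult.commute
      flip: one_pCons)

definition forms :: "nat \<Rightarrow> 'k::field poly poly set" where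
  "forms m = {f. \<forall>i j. coeff (coeff f j) i \<noteq> 0 \<longrightarrow> i + j = m}"

definition form_subst :: "'k::field poly poly \<Rightarrow> 'k poly poly \<Rightarrow> 'k poly poly \<Rightarrow> 'k poly poly"
  \<comment> \<open>\<open>form_subst P Q f = f(P, Q)\<close>\<close>
  where "form_subst P Q f = poly (map_poly (\<lambda>p. poly (map_poly (\<lambda>c. [:[:c:]:]) p) P) f) Q"

definition GL2_act :: "nat \<Rightarrow> 'k::field ^ 2 ^ 2 \<Rightarrow> 'k poly poly \<Rightarrow> 'k poly poly" where
  "GL2_act m g f =
     form_scale (inverse (det g ^ m))
       (form_subst (form_scale (g $ 2 $ 2) var_X - form_scale (g $ 1 $ 2) var_Y)
                   (form_scale (g $ 1 $ 1) var_Y - form_scale (g $ 2 $ 1) var_X) f)"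


section \<open>Projective points and lines\<close>

definition pg_point :: "'k::field poly poly \<Rightarrow> 'k poly poly set" where
  "pg_point f = form.span {f}"

definition PG :: "'k::field poly poly set \<Rightarrow> 'k poly poly set set" where
  "PG W = pg_point ` (W - {0})"

definition pg_line :: "'k::field poly poly set \<Rightarrow> bool" where
  "pg_line L \<longleftrightarrow> L \<subseteq> forms 3 \<and> form.subspace L \<and> form.dim L = 2"

text \<open>Scalar matrices act trivially on points, so the orbits of \<open>GL\<^sub>2\<close> on the points of
  \<open>PG(V\<^sub>3)\<close> are those of \<open>PGL\<^sub>2\<close>.\<close>

definition cubic_orbit :: "'k::field poly poly \<Rightarrow> 'k poly poly set set" where
  "cubic_orbit f = {pg_point (GL2_act 3 g f) | g. invertible g}"

definition O1 :: "'k::field poly poly set set" where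
  "O1 = cubic_orbit (var_X ^ 3)"

definition O2 :: "'k::field poly poly set set" where
  "O2 = cubic_orbit (var_X ^ 2 * var_Y)"

definition O3 :: "'k::field poly poly set set" where
  "O3 = cubic_orbit (var_X * var_Y * (var_X - var_Y))"

definition O4 :: "'k::field \<Rightarrow> 'k poly poly set set" where
  "O4 \<epsilon> = cubic_orbit (var_X * (var_X ^ 2 - form_scale \<epsilon> (var_Y ^ 2)))"

definition O5 :: "'k::field poly poly set set" where
  "O5 = {pg_point f | f. f \<in> forms 3 \<and> irreducible f}"


section \<open>The twisted cubic and generic lines\<close>

definition lin_form :: "'k::field \<Rightarrow> 'k \<Rightarrow> 'k poly poly" where
  "lin_form s t = form_scale t var_X - form_scale s var_Y"

definition twisted_cubic :: "'k::field poly poly set set" where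
  "twisted_cubic = {pg_point (lin_form s t ^ 3) | s t. (s, t) \<noteq> (0, 0)}"

definition osculating_plane :: "'k::field \<Rightarrow> 'k \<Rightarrow> 'k poly poly set" where
  "osculating_plane s t = {f \<in> forms 3. lin_form s t dvd f}"

definition extend_scalars :: "'k::field poly poly set \<Rightarrow> 'k alg_closure poly poly set" where
  "extend_scalars L = form.span (map_poly (map_poly to_ac) ` L)"

definition generic_line :: "'k::field poly poly set \<Rightarrow> bool" where
  "generic_line L \<longleftrightarrow>
     PG (extend_scalars L) \<inter> twisted_cubic = {} \<and>
     \<not> (\<exists>s t. (s, t) \<noteq> (0, 0) \<and> extend_scalars L \<subseteq> osculating_plane s t)"


section \<open>Coordinates of a line and the associated quartic form\<close>

definition cubic_form :: "(nat \<Rightarrow> 'k::field) \<Rightarrow> 'k poly poly" where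
  "cubic_form u =
     form_scale (u 0) (var_Y ^ 3) - form_scale (3 * u 1) (var_Y ^ 2 * var_X)
     + form_scale (3 * u 2) (var_Y * var_X ^ 2) - form_scale (u 3) (var_X ^ 3)"

text \<open>Only the values \<open>z 0, \<dots>, z 5\<close> matter. Changing the basis multiplies all \<open>p i j\<close> by the
  determinant of the base change, so the tuples satisfying \<open>line_coords L\<close> are exactly the nonzero
  multiples of one of them.\<close>

definition line_coords :: "'k::field poly poly set \<Rightarrow> (nat \<Rightarrow> 'k) \<Rightarrow> bool" where
  "line_coords L z \<longleftrightarrow>
     (\<exists>u v. L = form.span {cubic_form u, cubic_form v} \<and>
        (let p = (\<lambda>i j. u i * v j - u j * v i) in
           p 0 1 = z 0 \<and> p 0 2 = 2 * z 1 \<and> p 0 3 = 3 * (z 2 + z 5) \<and>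
           p 1 2 = z 2 - z 5 \<and> p 1 3 = 2 * z 3 \<and> p 2 3 = z 4))"

definition quartic_form :: "(nat \<Rightarrow> 'k::field) \<Rightarrow> 'k poly poly" where
  "quartic_form z =
     form_scale (z 0) (var_Y ^ 4) - form_scale (4 * z 1) (var_Y ^ 3 * var_X)
     + form_scale (6 * z 2) (var_Y ^ 2 * var_X ^ 2)
     - form_scale (4 * z 3) (var_Y * var_X ^ 3) + form_scale (z 4) (var_X ^ 4)"

definition quartic_I :: "(nat \<Rightarrow> 'k::field) \<Rightarrow> 'k" where
  "quartic_I z = (z 0 * z 4 - 4 * z 1 * z 3 + 3 * z 2 ^ 2) / 3"

definition quartic_J :: "(nat \<Rightarrow> 'k::field) \<Rightarrow> 'k" where
  "quartic_J z = det (vector [vector [z 0, z 1, z 2],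
                              vector [z 1, z 2, z 3],
                              vector [z 2, z 3, z 4]] :: 'k ^ 3 ^ 3)"


section \<open>Factorization types of quartic forms\<close>

definition proportional :: "'k::field poly poly \<Rightarrow> 'k poly poly \<Rightarrow> bool" where
  "proportional f g \<longleftrightarrow> (\<exists>c. c \<noteq> 0 \<and> f = form_scale c g)"

text \<open>The products of pairwise non-proportional irreducible forms of the prescribed degrees. As
  finite fields are perfect, such a product automatically has nonzero discriminant.\<close>

definition factor_type :: "nat list \<Rightarrow> 'k::field poly poly set" where
  "factor_type ds =
     {prod_list fs | fs. list_all2 (\<lambda>f d. f \<in> forms d \<and> irreducible f) fs ds \<and>
                         sorted_wrt (\<lambda>f g. \<not> proportional f g) fs}"

definition F4 :: "'k::field poly poly set" where "F4 = factor_type [1, 1, 1, 1]"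
definition F2 :: "'k::field poly poly set" where "F2 = factor_type [1, 1, 2]"
definition F1 :: "'k::field poly poly set" where "F1 = factor_type [1, 3]"
definition F4' :: "'k::field poly poly set" where "F4' = factor_type [2, 2]"
definition F2' :: "'k::field poly poly set" where "F2' = factor_type [4]"

definition eta :: "'k::field poly poly \<Rightarrow> nat" where
  "eta \<phi> = (if \<phi> \<in> F4 then 4 else if \<phi> \<in> F2 then 2 else if \<phi> \<in> F1 then 1
            else if \<phi> \<in> F2' \<union> F4' then 0 else undefined)"


section \<open>The elliptic curve\<close>

definition elliptic :: "'k::field \<Rightarrow> 'k \<Rightarrow> bool"
  \<comment> \<open>in characteristic \<open>\<noteq> 2\<close>: smoothness of \<open>T\<^sup>2 = 4 S\<^sup>3 - g2 S - g3\<close>\<close>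
  where "elliptic g2 g3 \<longleftrightarrow> g2 ^ 3 - 27 * g3 ^ 2 \<noteq> 0"

definition curve_points :: "'k::field \<Rightarrow> 'k \<Rightarrow> ('k \<times> 'k) option set"
  \<comment> \<open>\<^term>\<open>None\<close> is the point at infinity\<close>
  where "curve_points g2 g3 =
    insert None (Some ` {(S, T). T ^ 2 = 4 * S ^ 3 - g2 * S - g3})"

end

theory Submission
  imports Defs
begin

text \<open>Let \<open>L\<close> be spanned by the cubic forms \<open>u, v\<close>. As \<open>L\<close> is generic, every point \<open>y\<close> of the
  projective line over \<open>GF(q)\<close> is a zero of exactly one form \<open>f\<^sub>y = v(y) u - u(y) v\<close> of \<open>L\<close>, and
  the orbit of a form is determined by its number of rational zeros. So counting the \<open>q + 1\<close>
  points \<open>y\<close> and the \<open>q + 1\<close> points of \<open>L\<close> gives two linear equations between the orbit sizes. A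
  third one comes from \<open>\<phi>\<close>, whose zeros are the \<open>y\<close> that are double zeros of \<open>f\<^sub>y\<close>. The last one
  comes from the quotient of \<open>f\<^sub>y\<close> by the linear form vanishing at \<open>y\<close>: its discriminant is, up to
  squares, a quartic form \<open>\<Delta>\<close> in \<open>y\<close>, and the number of rational zeros of this quotient,
  summed over \<open>y\<close>, is the number of points of the genus one curve \<open>T\<^sup>2 = \<Delta>\<close>.

  The curve \<open>E\<^sub>L\<close> is the Jacobian of that curve, since \<open>g\<^sub>2\<close> and \<open>g\<^sub>3\<close> are the invariants of
  \<open>\<Delta>\<close>. Both have equally many points: a quartic form with square leading coefficient is in
  explicit birational correspondence with its Jacobian, and a nonsquare leading coefficient becomes
  a square on multiplying the form by it, which replaces both curves by their quadratic twists.
  Finally \<open>L\<close> has a common zero over the algebraic closure if \<open>z\<^sub>5\<^sup>3 = J\<close>, and it contains a cube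
  if \<open>z\<^sub>5\<^sup>3 = - J\<close>; so a generic line satisfies \<open>I\<^sup>3 \<noteq> J\<^sup>2\<close>.\<close>

section \<open>Quadratic character and quartic curves\<close>

text \<open>A zero P of a form contributes 1 + \<open>qchar\<close> of the discriminant of the
  cofactor of \<open>lin P\<close>. A form with a single zero thus contributes 0, one of type P P Q
  contributes 2 + 1 = 3, and one with three distinct zeros 2 + 2 + 2 = 6. If n2 and n3 count the
  forms of the last two kinds, the elliptic curve has 3 n2 + 6 n3 points; this is where the
  denominators of the final formulas come from.

  The obstacle is that genericity refers to the algebraic closure, while everything counted is
  rational. Resultants bridge the gap: written in the 2 by 2 minors of the two spanning forms, they
  are polynomials in \<open>z\<close> over the ground field. The two factors obtained serve twice.
  Since I is the square of \<open>z 5\<close>, I^3 - J^2 is the product of z5^3 - J and z5^3 + J,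
  and it is the discriminant of the quartic up to a constant; the discriminant of the elliptic curve
  is, up to a constant, (z5^3 - J)^3 (z5^3 + J). So the same two inequalities make the quartic
  squarefree and the curve smooth.\<close>

definition qchar :: "'a::field \<Rightarrow> int" where
  "qchar x = (if x = 0 then 0 else if \<exists>y. x = y ^ 2 then 1 else -1)"

lemma qchar_0 [simp]: "qchar 0 = 0"
  by (simp add: qchar_def)

lemma qchar_cases: "qchar x = 0 \<or> qchar x = 1 \<or> qchar x = -1"
  by (auto simp: qchar_def)

lemma qchar_mult_square:
  fixes x :: "'a::field"
  assumes "r \<noteq> 0"
  shows "qchar (r ^ 2 * x) = qchar x"
proof -
  have "(\<exists>y. r ^ 2 * x = y ^ 2) \<longleftrightarrow> (\<exists>y. x = y ^ 2)"
  proof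
    assume "\<exists>y. r ^ 2 * x = y ^ 2"
    then obtain y where "r ^ 2 * x = y ^ 2" by blast
    then have "x = (y / r) ^ 2" using assms by (simp add: field_simps)
    then show "\<exists>y. x = y ^ 2" by blast
  next
    assume "\<exists>y. x = y ^ 2"
    then show "\<exists>y. r ^ 2 * x = y ^ 2" by (metis power_mult_distrib)
  qed
  then show ?thesis using assms by (simp add: qchar_def)
qed

lemma qchar_square: "r \<noteq> 0 \<Longrightarrow> qchar (r ^ 2) = 1"
  by (auto simp: qchar_def)

lemma card_square_roots:
  fixes d :: "'a::{field,finite}"
  assumes "(2::'a) \<noteq> 0"
  shows "int (card {y. y ^ 2 = d}) = 1 + qchar d"
proof (cases "\<exists>y. d = y ^ 2")
  case True
  then obtain y where d: "d = y ^ 2" by blast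
  have "{x. x ^ 2 = d} = {y, -y}"
    by (auto simp: d power2_eq_iff)
  moreover have "y = -y \<longleftrightarrow> y = 0"
    using assms by (metis add.inverse_neutral add_eq_0_iff mult_2 mult_eq_0_iff)
  ultimately show ?thesis using True by (auto simp: qchar_def d card_insert_if)
next
  case False
  then have "{y. y ^ 2 = d} = {}" by auto
  moreover have "d \<noteq> 0" using False by (metis zero_power2)
  ultimately show ?thesis using False by (simp add: qchar_def)
qed

lemma sum_card_swap:
  fixes P :: "'a::finite \<Rightarrow> 'b::finite \<Rightarrow> bool"
  shows "(\<Sum>x\<in>UNIV. int (card {y. P x y})) = (\<Sum>y\<in>UNIV. int (card {x. P x y}))"
proof -
  have "int (card {y. P x y}) = (\<Sum>y\<in>UNIV. if P x y then 1 else 0)" for x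
    by (simp add: sum.If_cases)
  moreover have "int (card {x. P x y}) = (\<Sum>x\<in>UNIV. if P x y then 1 else 0)" for y
    by (simp add: sum.If_cases)
  ultimately show ?thesis by (simp only:) (rule sum.swap)
qed

text \<open>The pairs (y, d) with y^2 = d, counted by y, number as many as the field elements;
  counted by d they give the sum of 1 + \<open>qchar d\<close>.\<close>

lemma sum_qchar:
  assumes "(2::'a::{field,finite}) \<noteq> 0"
  shows "(\<Sum>d\<in>(UNIV::'a set). qchar d) = 0"
proof -
  have "(\<Sum>d\<in>(UNIV::'a set). 1 + qchar d) = (\<Sum>d\<in>(UNIV::'a set). int (card {y. y ^ 2 = d}))"
    by (simp add: card_square_roots assms)
  also have "\<dots> = (\<Sum>y\<in>(UNIV::'a set). int (card {d. y ^ 2 = d}))"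
    by (rule sum_card_swap)
  also have "\<dots> = int CARD('a)" by simp
  finally show ?thesis by (simp add: sum.distrib)
qed

lemma sum_shift:
  fixes f :: "'a::{field,finite} \<Rightarrow> int"
  assumes "r \<noteq> 0"
  shows "(\<Sum>x\<in>UNIV. f (r * x + e)) = (\<Sum>x\<in>UNIV. f x)"
proof (rule sum.reindex_bij_witness[of _ "\<lambda>y. (y - e) / r" "\<lambda>x. r * x + e"])
qed (use assms in auto)

text \<open>Multiplication by \<open>n\<close> permutes the field, so the values
  \<open>qchar (n * x) + qchar x\<close> sum to zero; none of them is positive, hence all of them
  vanish.\<close>

lemma qchar_mult_nonsquare:
  fixes n x :: "'a::{field,finite}"
  assumes 2: "(2::'a) \<noteq> 0" and n: "qchar n = -1"
  shows "qchar (n * x) = - qchar x"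
proof -
  have n0: "n \<noteq> 0" using n by auto
  have le: "qchar (n * x) + qchar x \<le> 0" for x
  proof (cases "qchar x = 1")
    case True
    then obtain y where y: "x = y ^ 2" "x \<noteq> 0" by (auto simp: qchar_def split: if_splits)
    then have "qchar (n * x) = qchar n"
      using qchar_mult_square[of y n] by (auto simp: mult.commute)
    then show ?thesis using True n by simp
  next
    case False
    then show ?thesis
      using n0 qchar_cases[of "n * x"] qchar_cases[of x] by (auto simp: qchar_def split: if_splits)
  qed
  have "(\<Sum>x\<in>UNIV. qchar (n * x)) = (\<Sum>x\<in>(UNIV :: 'a set). qchar x)"
    using sum_shift[of n qchar 0] n0 by simp
  then have "(\<Sum>x\<in>UNIV. - (qchar (n * x) + qchar x)) = 0"
    by (simp add: sum_negf sum.distrib sum_subtractf sum_qchar[OF 2])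
  moreover have "0 \<le> - (qchar (n * x) + qchar x)" for x using le[of x] by linarith
  ultimately have "- (qchar (n * x) + qchar x) = 0"
    by (subst (asm) sum_nonneg_eq_0_iff) auto
  then show ?thesis by simp
qed

lemma card_quadratic_roots:
  fixes a b c :: "'a::{field,finite}"
  assumes 2: "(2::'a) \<noteq> 0" and a: "a \<noteq> 0"
  shows "int (card {x. a * x ^ 2 + b * x + c = 0}) = 1 + qchar (b ^ 2 - 4 * a * c)"
proof -
  have 4: "(4::'a) \<noteq> 0" using 2 by (metis mult_2 mult_eq_0_iff numeral_Bit0)
  have eq: "(2 * a * x + b) ^ 2 - (b ^ 2 - 4 * a * c) = 4 * a * (a * x ^ 2 + b * x + c)" for x
    by Groebner_Basis.algebra
  have "bij_betw (\<lambda>x. 2 * a * x + b) {x. a * x ^ 2 + b * x + c = 0} {y. y ^ 2 = b ^ 2 - 4 * a * c}"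
  proof (rule bij_betw_byWitness[where f' = "\<lambda>y. (y - b) / (2 * a)"])
    show "(\<lambda>x. 2 * a * x + b) ` {x. a * x ^ 2 + b * x + c = 0} \<subseteq> {y. y ^ 2 = b ^ 2 - 4 * a * c}"
    proof safe
      fix x assume "a * x ^ 2 + b * x + c = 0"
      then have "(2 * a * x + b) ^ 2 - (b ^ 2 - 4 * a * c) = 0" by (simp add: eq)
      then show "(2 * a * x + b) ^ 2 = b ^ 2 - 4 * a * c" by (simp only: right_minus_eq)
    qed
    show "(\<lambda>y. (y - b) / (2 * a)) ` {y. y ^ 2 = b ^ 2 - 4 * a * c} \<subseteq> {x. a * x ^ 2 + b * x + c = 0}"
    proof safe
      fix y assume y: "y ^ 2 = b ^ 2 - 4 * a * c"
      have "2 * a * ((y - b) / (2 * a)) + b = y" using 2 a by simp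
      then show "a * ((y - b) / (2 * a)) ^ 2 + b * ((y - b) / (2 * a)) + c = 0"
        using eq[of "(y - b) / (2 * a)"] y 4 a by simp
    qed
  qed (use 2 a in auto)
  then have "card {x. a * x ^ 2 + b * x + c = 0} = card {y. y ^ 2 = b ^ 2 - 4 * a * c}"
    by (rule bij_betw_same_card)
  then show ?thesis using card_square_roots[OF 2] by simp
qed

section \<open>Point counts of a quartic curve and of its Jacobian\<close>

definition biquartic :: "'a::field \<Rightarrow> 'a \<Rightarrow> 'a \<Rightarrow> 'a \<Rightarrow> 'a \<Rightarrow> 'a \<Rightarrow> 'a \<Rightarrow> 'a" where
  "biquartic q0 q1 q2 q3 q4 x y =
     q0 * x ^ 4 + 4 * q1 * x ^ 3 * y + 6 * q2 * x ^ 2 * y ^ 2 + 4 * q3 * x * y ^ 3 + q4 * y ^ 4"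

lemma biquartic_1:
  "biquartic q0 q1 q2 q3 q4 x 1 = q0 * x ^ 4 + 4 * q1 * x ^ 3 + 6 * q2 * x ^ 2 + 4 * q3 * x + q4"
  by (simp add: biquartic_def)

text \<open>With \<open>inv_j\<close>, the classical invariants of a binary quartic written with
  binomial coefficients; the discriminant is i^3 - 27 j^2 up to a constant.\<close>

definition inv_i :: "'a::field \<Rightarrow> 'a \<Rightarrow> 'a \<Rightarrow> 'a \<Rightarrow> 'a \<Rightarrow> 'a" where
  "inv_i q0 q1 q2 q3 q4 = q0 * q4 - 4 * q1 * q3 + 3 * q2 ^ 2"

definition inv_j :: "'a::field \<Rightarrow> 'a \<Rightarrow> 'a \<Rightarrow> 'a \<Rightarrow> 'a \<Rightarrow> 'a" where
  "inv_j q0 q1 q2 q3 q4 =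
     q0 * q2 * q4 + 2 * q1 * q2 * q3 - q2 ^ 3 - q0 * q3 ^ 2 - q1 ^ 2 * q4"

text \<open>As the leading coefficient is r^2, putting y = r x^2 + 2 m x + k cancels the terms x^4
  and x^3 of y^2 minus the quartic, and leaves an equation of degree at most 2 in x for each k.
  Counting the pairs (x, k) by k replaces the quartic by the discriminant of this equation, a cubic
  in k. The summand 1 on the left is \<open>qchar q0\<close>.\<close>

lemma quartic_sum_monic:
  fixes q0 q1 q2 q3 q4 r :: "'a::{field,finite}"
  assumes 2: "(2::'a) \<noteq> 0"
    and disc: "inv_i q0 q1 q2 q3 q4 ^ 3 \<noteq> 27 * inv_j q0 q1 q2 q3 q4 ^ 2"
    and r: "q0 = r ^ 2" "r \<noteq> 0"
  shows "(\<Sum>x\<in>UNIV. qchar (biquartic q0 q1 q2 q3 q4 x 1)) + 1 =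
    (\<Sum>x\<in>UNIV. qchar (4 * x ^ 3 - inv_i q0 q1 q2 q3 q4 * x - inv_j q0 q1 q2 q3 q4))"
proof -
  define m where "m = q1 / r"
  have q1: "q1 = r * m" using r by (simp add: m_def)
  define a where "a k = 4 * m ^ 2 + 2 * r * k - 6 * q2" for k
  define b where "b k = 4 * m * k - 4 * q3" for k
  define c where "c k = k ^ 2 - q4" for k
  \<comment> \<open>The only value of \<open>k\<close> at which the equation in x loses its square
    term.\<close>
  define k0 where "k0 = (3 * q2 - 2 * m ^ 2) / r"
  have 4: "(4::'a) \<noteq> 0" using 2 by (metis mult_2 mult_eq_0_iff numeral_Bit0)
  have a0: "a k = 0 \<longleftrightarrow> k = k0" for k
  proof -
    have "a k = 2 * r * (k - k0)" using r by (simp add: a_def k0_def field_simps)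
    then show ?thesis using 2 r by simp
  qed
  have x: "int (card {y. y ^ 2 = biquartic q0 q1 q2 q3 q4 x 1}) =
    int (card {k. a k * x ^ 2 + b k * x + c k = 0})" for x
  proof -
    have "(r * x ^ 2 + 2 * m * x + k) ^ 2 - biquartic q0 q1 q2 q3 q4 x 1
      = a k * x ^ 2 + b k * x + c k" for k
      unfolding biquartic_1 unfolding biquartic_def a_def b_def c_def q1 r(1) by
          Groebner_Basis.algebra
    then have eq: "(r * x ^ 2 + 2 * m * x + k) ^ 2 = biquartic q0 q1 q2 q3 q4 x 1 \<longleftrightarrow>
      a k * x ^ 2 + b k * x + c k = 0" for k
      by (metis eq_iff_diff_eq_0)
    have "bij_betw (\<lambda>k. r * x ^ 2 + 2 * m * x + k) {k. a k * x ^ 2 + b k * x + c k = 0}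
      {y. y ^ 2 = biquartic q0 q1 q2 q3 q4 x 1}"
      unfolding eq[symmetric]
      by (rule bij_betw_byWitness[where f' = "\<lambda>y. y - (r * x ^ 2 + 2 * m * x)"]) auto
    then have "card {k. a k * x ^ 2 + b k * x + c k = 0} = card {y. y ^ 2 = biquartic q0 q1 q2 q3
        q4 x 1}"
      by (rule bij_betw_same_card)
    then show ?thesis by simp
  qed
  have k: "int (card {x. a k * x ^ 2 + b k * x + c k = 0}) =
    1 + qchar (b k ^ 2 - 4 * a k * c k) - (if k = k0 then 1 else 0)" for k
  proof (cases "k = k0")
    case False
    then show ?thesis using card_quadratic_roots[OF 2, of "a k"] a0 by simp
  next
    case True
    then have a: "a k = 0" using a0 by simp
    show ?thesis
    proof (cases "b k = 0")
      case False
      \<comment> \<open>A linear equation has one root, in agreement with 1 +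
        \<open>qchar (b k ^ 2)\<close> - 1 = 1.\<close>
      then have "{x. a k * x ^ 2 + b k * x + c k = 0} = {- c k / b k}"
        using a by (auto simp: field_simps eq_neg_iff_add_eq_0)
      then show ?thesis using True a False by (simp add: qchar_square)
    next
      case b: True
      \<comment> \<open>Otherwise every x would be a solution. Then the invariants become 12 w^2 and
        8 w^3 with w = q2 - m^2, so i^3 = 27 j^2, against the assumption on the
        discriminant.\<close>
      have "c k \<noteq> 0"
      proof
        assume c: "c k = 0"
        have "4 * (m * k - q3) = 0" using b by (simp add: b_def algebra_simps)
        then have "m * k - q3 = 0" using 4 by (simp only: mult_eq_0_iff) simp
        then have q: "q4 = k ^ 2" "q3 = m * k" "r * k = 3 * q2 - 2 * m ^ 2"
          using c True r by (simp_all add: c_def k0_def)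
        have "inv_i q0 q1 q2 q3 q4 = 12 * (q2 - m ^ 2) ^ 2"
        proof -
          have "inv_i q0 q1 q2 q3 q4 = (r * k) ^ 2 - 4 * m ^ 2 * (r * k) + 3 * q2 ^ 2"
            unfolding inv_i_def r(1) q1 q(1,2) by Groebner_Basis.algebra
          then show ?thesis unfolding q(3) by Groebner_Basis.algebra
        qed
        moreover have "inv_j q0 q1 q2 q3 q4 = 8 * (q2 - m ^ 2) ^ 3"
        proof -
          have "inv_j q0 q1 q2 q3 q4 = q2 * (r * k) ^ 2 + 2 * m ^ 2 * q2 * (r * k) - q2 ^ 3 - 2 *
              m ^ 2 * (r * k) ^ 2"
            unfolding inv_j_def r(1) q1 q(1,2) by Groebner_Basis.algebra
          then show ?thesis unfolding q(3) by Groebner_Basis.algebra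
        qed
        ultimately show False using disc by (simp add: power_mult_distrib flip: power_mult)
      qed
      then show ?thesis using True a b by simp
    qed
  qed
  have "(\<Sum>x\<in>UNIV. 1 + qchar (biquartic q0 q1 q2 q3 q4 x 1)) =
    (\<Sum>k\<in>UNIV. 1 + qchar (b k ^ 2 - 4 * a k * c k) - (if k = k0 then 1 else 0))"
    unfolding k[symmetric] unfolding card_square_roots[OF 2, symmetric] x by (rule sum_card_swap)
  then have "(\<Sum>x\<in>UNIV. qchar (biquartic q0 q1 q2 q3 q4 x 1)) + 1 =
    (\<Sum>k\<in>UNIV. qchar (b k ^ 2 - 4 * a k * c k))"
    by (simp add: sum.distrib sum_subtractf)
  \<comment> \<open>This affine change of variable brings the cubic in k to the form 4 x^3 - i x -
    j, up to the square factor 16 / r^2.\<close>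
  also have "\<dots> = (\<Sum>x\<in>UNIV. qchar (b ((-2/r) * x + q2/r) ^ 2 -
      4 * a ((-2/r) * x + q2/r) * c ((-2/r) * x + q2/r)))"
    using 2 r by (intro sum_shift[symmetric]) auto
  also have "\<dots> = (\<Sum>x\<in>UNIV. qchar (4 * x ^ 3 - inv_i q0 q1 q2 q3 q4 * x - inv_j q0 q1 q2 q3 q4))"
  proof (rule sum.cong[OF refl])
    fix x
    define k where "k = (-2/r) * x + q2/r"
    have q2: "q2 = r * k + 2 * x" using r by (simp add: k_def field_simps)
    have "r ^ 2 * (b k ^ 2 - 4 * a k * c k) =
      4 ^ 2 * (4 * x ^ 3 - inv_i q0 q1 q2 q3 q4 * x - inv_j q0 q1 q2 q3 q4)"
      unfolding a_def b_def c_def inv_i_def inv_j_def r(1) q1 q2 by Groebner_Basis.algebra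
    then show "qchar (b k ^ 2 - 4 * a k * c k) =
      qchar (4 * x ^ 3 - inv_i q0 q1 q2 q3 q4 * x - inv_j q0 q1 q2 q3 q4)"
      by (simp flip: qchar_mult_square[OF r(2), of "b k ^ 2 - 4 * a k * c k"]
          qchar_mult_square[OF 4, of "4 * x ^ 3 - inv_i q0 q1 q2 q3 q4 * x - inv_j q0 q1 q2 q3 q4"])
  qed
  finally show ?thesis .
qed

text \<open>For leading coefficient 0 the right side is already a cubic: an affine substitution and
  multiplication by q1^2 suffice. Here q1 is nonzero, since otherwise i = 3 q2^2 and j = - q2^3 give
  discriminant zero.\<close>

lemma quartic_sum_root:
  fixes q1 q2 q3 q4 :: "'a::{field,finite}"
  assumes 2: "(2::'a) \<noteq> 0"
    and disc: "inv_i 0 q1 q2 q3 q4 ^ 3 \<noteq> 27 * inv_j 0 q1 q2 q3 q4 ^ 2"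
  shows "(\<Sum>x\<in>UNIV. qchar (biquartic 0 q1 q2 q3 q4 x 1)) =
    (\<Sum>x\<in>UNIV. qchar (4 * x ^ 3 - inv_i 0 q1 q2 q3 q4 * x - inv_j 0 q1 q2 q3 q4))"
proof -
  have q1: "q1 \<noteq> 0"
    using disc by (auto simp: inv_i_def inv_j_def power_mult_distrib simp flip: power_mult)
  have "(\<Sum>x\<in>UNIV. qchar (biquartic 0 q1 q2 q3 q4 x 1)) =
    (\<Sum>x\<in>UNIV. qchar (biquartic 0 q1 q2 q3 q4 ((1/q1) * x + (-q2/(2*q1))) 1))"
    using q1 by (intro sum_shift[symmetric]) auto
  also have "\<dots> = (\<Sum>x\<in>UNIV. qchar (4 * x ^ 3 - inv_i 0 q1 q2 q3 q4 * x - inv_j 0 q1 q2 q3 q4))"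
  proof (rule sum.cong[OF refl])
    fix x
    define k where "k = (1/q1) * x + (-q2/(2*q1))"
    have k: "2 * q1 * k = 2 * x - q2" using q1 2 by (simp add: k_def field_simps)
    have q2: "q2 = 2 * x - 2 * q1 * k" using k by simp
    have "q1 ^ 2 * biquartic 0 q1 q2 q3 q4 k 1 =
        4 * x ^ 3 - inv_i 0 q1 q2 q3 q4 * x - inv_j 0 q1 q2 q3 q4"
      unfolding biquartic_1 unfolding biquartic_def inv_i_def inv_j_def q2 by Groebner_Basis.algebra
    then show "qchar (biquartic 0 q1 q2 q3 q4 k 1) =
        qchar (4 * x ^ 3 - inv_i 0 q1 q2 q3 q4 * x - inv_j 0 q1 q2 q3 q4)"
      by (simp flip: qchar_mult_square[OF q1, of "biquartic 0 q1 q2 q3 q4 k 1"])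
  qed
  finally show ?thesis .
qed

lemma quartic_sum_value:
  fixes q0 q1 q2 q3 q4 :: "'a::{field,finite}"
  assumes 2: "(2::'a) \<noteq> 0"
    and disc: "inv_i q0 q1 q2 q3 q4 ^ 3 \<noteq> 27 * inv_j q0 q1 q2 q3 q4 ^ 2"
    and q0: "qchar q0 \<noteq> -1"
  shows "(\<Sum>x\<in>UNIV. qchar (biquartic q0 q1 q2 q3 q4 x 1)) + qchar q0 =
    (\<Sum>x\<in>UNIV. qchar (4 * x ^ 3 - inv_i q0 q1 q2 q3 q4 * x - inv_j q0 q1 q2 q3 q4))"
proof (cases "q0 = 0")
  case True
  then show ?thesis using quartic_sum_root[OF 2] disc by simp
next
  case False
  then obtain r where r: "q0 = r ^ 2" using q0 by (auto simp: qchar_def split: if_splits)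
  with False have r0: "r \<noteq> 0" by auto
  then have "qchar q0 = 1" unfolding r by (rule qchar_square)
  then show ?thesis using quartic_sum_monic[OF 2 disc r r0] by simp
qed

lemma quartic_sum:
  fixes q0 q1 q2 q3 q4 :: "'a::{field,finite}"
  assumes 2: "(2::'a) \<noteq> 0"
    and disc: "inv_i q0 q1 q2 q3 q4 ^ 3 \<noteq> 27 * inv_j q0 q1 q2 q3 q4 ^ 2"
  shows "(\<Sum>x\<in>UNIV. qchar (biquartic q0 q1 q2 q3 q4 x 1)) + qchar q0 =
    (\<Sum>x\<in>UNIV. qchar (4 * x ^ 3 - inv_i q0 q1 q2 q3 q4 * x - inv_j q0 q1 q2 q3 q4))"
proof (cases "qchar q0 = -1")
  case n: True
  have n0: "q0 \<noteq> 0" using n by auto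
  let ?i = "inv_i q0 q1 q2 q3 q4" and ?j = "inv_j q0 q1 q2 q3 q4"
  let ?n = "\<lambda>q. q0 * q"
  have i: "inv_i (?n q0) (?n q1) (?n q2) (?n q3) (?n q4) = q0 ^ 2 * ?i"
    unfolding inv_i_def by Groebner_Basis.algebra
  have j: "inv_j (?n q0) (?n q1) (?n q2) (?n q3) (?n q4) = q0 ^ 3 * ?j"
    unfolding inv_j_def by Groebner_Basis.algebra
  have Q: "biquartic (?n q0) (?n q1) (?n q2) (?n q3) (?n q4) x y = q0 * biquartic q0 q1 q2 q3 q4 x
      y" for x y
    unfolding biquartic_1 unfolding biquartic_def by Groebner_Basis.algebra
  have "(q0 ^ 2 * ?i) ^ 3 - 27 * (q0 ^ 3 * ?j) ^ 2 = q0 ^ 6 * (?i ^ 3 - 27 * ?j ^ 2)"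
    by Groebner_Basis.algebra
  then have d: "(q0 ^ 2 * ?i) ^ 3 \<noteq> 27 * (q0 ^ 3 * ?j) ^ 2"
    using disc n0 by (metis eq_iff_diff_eq_0 mult_eq_0_iff power_eq_0_iff)
  have "(\<Sum>x\<in>UNIV. qchar (q0 * biquartic q0 q1 q2 q3 q4 x 1)) + qchar (q0 * q0) =
    (\<Sum>x\<in>UNIV. qchar (4 * x ^ 3 - q0 ^ 2 * ?i * x - q0 ^ 3 * ?j))"
    using quartic_sum_value[OF 2, of "?n q0" "?n q1" "?n q2" "?n q3" "?n q4"] d n0
    unfolding i j Q by (simp add: qchar_square flip: power2_eq_square)
  \<comment> \<open>Replacing x by q0 x pulls out q0^3 = q0^2 * q0. Both sides then carry one
    nonsquare factor \<open>q0\<close>, which changes the sign of every summand.\<close>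
  also have "\<dots> = (\<Sum>x\<in>UNIV. qchar (4 * (q0 * x + 0) ^ 3 - q0 ^ 2 * ?i * (q0 * x + 0) - q0 ^ 3 * ?j))"
    using n0 by (intro sum_shift[symmetric]) auto
  also have "\<dots> = (\<Sum>x\<in>UNIV. qchar (q0 ^ 2 * (q0 * (4 * x ^ 3 - ?i * x - ?j))))"
    by (rule sum.cong[OF refl], rule arg_cong[where f = qchar]) Groebner_Basis.algebra
  also have "\<dots> = (\<Sum>x\<in>UNIV. qchar (q0 * (4 * x ^ 3 - ?i * x - ?j)))"
    by (simp add: qchar_mult_square[OF n0])
  finally show ?thesis
    by (simp add: qchar_mult_nonsquare[OF 2 n] sum_negf)
next
  case False
  then show ?thesis by (rule quartic_sum_value[OF 2 disc])
qed

lemma card_curve_points: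
  fixes g2 g3 :: "'a::{field,finite}"
  assumes 2: "(2::'a) \<noteq> 0"
  shows "int (card (curve_points g2 g3)) =
    int CARD('a) + 1 + (\<Sum>x\<in>UNIV. qchar (4 * x ^ 3 - g2 * x - g3))"
proof -
  let ?c = "\<lambda>s. 4 * s ^ 3 - g2 * s - g3"
  have "{(s, t). t ^ 2 = ?c s} = (SIGMA s:UNIV. {t. t ^ 2 = ?c s})" by auto
  then have "int (card {(s, t). t ^ 2 = ?c s}) = (\<Sum>s\<in>UNIV. 1 + qchar (?c s))"
    by (simp add: card_square_roots[OF 2])
  then show ?thesis
    unfolding curve_points_def by (simp add: card_image sum.distrib)
qed

section \<open>Binary forms\<close>

lemma form_scale_eq_mult: "form_scale c f = [:[:c:]:] * f"
  by (simp add: form_scale_def)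

lemma form_scale_0_left [simp]: "form_scale 0 f = 0"
  by (simp add: form_scale_def)

lemma form_scale_0_right [simp]: "form_scale c 0 = 0"
  by (simp add: form_scale_def)

lemma form_scale_1 [simp]: "form_scale 1 f = f"
  by (simp add: form_scale_def flip: one_pCons)

lemma form_scale_scale [simp]: "form_scale a (form_scale b f) = form_scale (a * b) f"
  by (simp add: form_scale_def mult.commute)

lemma form_scale_eq_0_iff [simp]: "form_scale c f = 0 \<longleftrightarrow> c = 0 \<or> f = 0"
  by (simp add: form_scale_def)

lemma form_scale_mult_left: "form_scale c f * g = form_scale c (f * g)"
  by (simp add: form_scale_def)

lemma form_scale_mult_right: "f * form_scale c g = form_scale c (f * g)"
  by (simp add: form_scale_def)

section \<open>Evaluation, homogeneity and the factor theorem\<close>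

definition form_eval :: "'k::field poly poly \<Rightarrow> 'k \<Rightarrow> 'k \<Rightarrow> 'k" where
  "form_eval f a b = poly (poly f [:b:]) a"

lemma form_eval_simps [simp]:
  "form_eval 0 a b = 0"
  "form_eval 1 a b = 1"
  "form_eval (f + g) a b = form_eval f a b + form_eval g a b"
  "form_eval (f - g) a b = form_eval f a b - form_eval g a b"
  "form_eval (- f) a b = - form_eval f a b"
  "form_eval (f * g) a b = form_eval f a b * form_eval g a b"
  "form_eval (f ^ n) a b = form_eval f a b ^ n"
  "form_eval (form_scale c f) a b = c * form_eval f a b"
  "form_eval [:[:c:]:] a b = c"
  "form_eval var_X a b = a"
  "form_eval var_Y a b = b"
  "form_eval (lin_form s t) a b = t * a - s * b"
  by (simp_all add: form_eval_def form_scale_def var_X_def var_Y_def lin_form_def)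

lemma lin_form_pCons: "lin_form s t = [:[:0, t:], [:- s:]:]"
  by (simp add: lin_form_def form_scale_def var_X_def var_Y_def)

lemma lin_form_eq_0_iff [simp]: "lin_form s t = 0 \<longleftrightarrow> s = 0 \<and> t = 0"
  by (auto simp: lin_form_pCons)

lemma lin_form_scale: "lin_form (c * s) (c * t) = form_scale c (lin_form s t)"
  by (simp add: lin_form_pCons form_scale_def)

lemma forms_0 [simp]: "0 \<in> forms m"
  by (simp add: forms_def)

lemma forms_add: "f \<in> forms m \<Longrightarrow> g \<in> forms m \<Longrightarrow> f + g \<in> forms m"
  unfolding forms_def by (auto, metis add.right_neutral)

lemma forms_scale: "f \<in> forms m \<Longrightarrow> form_scale c f \<in> forms m"
  unfolding forms_def form_scale_def by auto

lemma forms_diff: "f \<in> forms m \<Longrightarrow> g \<in> forms m \<Longrightarrow> f - g \<in> forms m"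
  using forms_add[of f m "form_scale (-1) g"] forms_scale[of g m "-1"]
    form.scale_minus_left[of 1 g] by simp

lemma forms_mult:
  assumes "f \<in> forms m" "g \<in> forms n"
  shows "f * g \<in> forms (m + n)"
  unfolding forms_def
proof safe
  fix i j
  assume "coeff (coeff (f * g) j) i \<noteq> 0"
  then have "(\<Sum>k\<le>j. \<Sum>l\<le>i. coeff (coeff f k) l * coeff (coeff g (j - k)) (i - l)) \<noteq> 0"
    by (simp add: coeff_mult coeff_sum)
  then obtain k where k: "k \<in> {..j}"
      "(\<Sum>l\<le>i. coeff (coeff f k) l * coeff (coeff g (j - k)) (i - l)) \<noteq> 0"
    by (rule sum.not_neutral_contains_not_neutral)
  from k(2) obtain l where l: "l \<in> {..i}" "coeff (coeff f k) l * coeff (coeff g (j - k)) (i - l) \<noteq>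
      0"
    by (rule sum.not_neutral_contains_not_neutral)
  then have "coeff (coeff f k) l \<noteq> 0" "coeff (coeff g (j - k)) (i - l) \<noteq> 0" by auto
  then have "l + k = m" "(i - l) + (j - k) = n" using assms unfolding forms_def by blast+
  then show "i + j = m + n" using k(1) l(1) by simp
qed

lemma forms_1 [simp]: "1 \<in> forms 0"
  by (simp add: forms_def coeff_1)

lemma lin_form_in_forms [simp]: "lin_form s t \<in> forms 1"
  unfolding forms_def lin_form_pCons by (auto simp: coeff_pCons split: nat.splits)

lemma forms_unique_degree: "f \<in> forms m \<Longrightarrow> f \<in> forms n \<Longrightarrow> f \<noteq> 0 \<Longrightarrow> m = n"
  unfolding forms_def by (metis (mono_tags, lifting) leading_coeff_0_iff mem_Collect_eq)

lemma coeff_form_0: "f \<in> forms m \<Longrightarrow> i + j \<noteq> m \<Longrightarrow> coeff (coeff f j) i = 0"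
  unfolding forms_def by blast

lemma coeff_form:
  "f \<in> forms m \<Longrightarrow> coeff f j = (if j \<le> m then monom (coeff (coeff f j) (m - j)) (m - j) else 0)"
  by (rule poly_eqI) (auto simp: coeff_form_0)

lemma degree_form: "f \<in> forms m \<Longrightarrow> degree f \<le> m"
  by (rule degree_le) (simp add: coeff_form)

lemma poly_form:
  assumes "f \<in> forms m"
  shows "poly f q = (\<Sum>j\<le>m. monom (coeff (coeff f j) (m - j)) (m - j) * q ^ j)"
proof -
  have "poly f q = (\<Sum>j\<le>degree f. coeff f j * q ^ j)"
    by (rule poly_altdef)
  also have "\<dots> = (\<Sum>j\<le>m. coeff f j * q ^ j)"
    using degree_form[OF assms] by (intro sum.mono_neutral_left) (auto simp: coeff_eq_0)
  also have "\<dots> = (\<Sum>j\<le>m. monom (coeff (coeff f j) (m - j)) (m - j) * q ^ j)"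
    by (rule sum.cong[OF refl], subst coeff_form[OF assms]) auto
  finally show ?thesis .
qed

lemma form_eval_form:
  assumes "f \<in> forms m"
  shows "form_eval f a b = (\<Sum>j\<le>m. coeff (coeff f j) (m - j) * a ^ (m - j) * b ^ j)"
  unfolding form_eval_def poly_form[OF assms]
  by (simp add: poly_sum poly_monom)

lemma forms_0E:
  assumes "f \<in> forms 0"
  obtains c where "f = [:[:c:]:]"
proof -
  have "f = [:[:coeff (coeff f 0) 0:]:]"
    by (rule poly_eqI, subst coeff_form[OF assms]) (simp add: coeff_pCons monom_0 split: nat.splits)
  then show ?thesis by (rule that)
qed

text \<open>Factor theorem in the outer variable: with r = t / s, substituting Y = r X turns
  \<open>f\<close> into f(1, r) X^m, and \<open>lin_form s t\<close> is Y - r X times the unit - s.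
  For s = 0 the coefficient of Y^m vanishes, so X divides every coefficient.\<close>

lemma lin_form_dvd:
  assumes f: "f \<in> forms m" and root: "form_eval f s t = 0" and st: "(s, t) \<noteq> (0, 0)"
  shows "lin_form s t dvd f"
proof (cases "s = 0")
  case True
  then have t: "t \<noteq> 0" using st by simp
  have "form_eval f 0 t = coeff (coeff f m) 0 * t ^ m"
    unfolding form_eval_form[OF f] by (subst sum.remove[of _ m]) (auto simp: power_0_left)
  then have 0: "coeff (coeff f m) 0 = 0" using root True t by simp
  have "poly (coeff f j) 0 = 0" for j
    using 0 by (subst coeff_form[OF f]) (auto simp: poly_monom power_0_left)
  then have "[:0, t:] dvd coeff f j" for j
    using smult_dvd[of "[:0, 1:]" "coeff f j" t] t by (simp add: poly_eq_0_iff_dvd)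
  then show ?thesis using True by (simp add: lin_form_pCons const_poly_dvd_iff)
next
  case False
  define r where "r = t / s"
  have t: "t = s * r" using False by (simp add: r_def)
  have "form_eval f s t = s ^ m * form_eval f 1 r"
    unfolding form_eval_form[OF f] t sum_distrib_left
    by (rule sum.cong[OF refl]) (auto simp: power_mult_distrib simp flip: power_add)
  then have "form_eval f 1 r = 0" using root False by simp
  moreover have "poly f [:0, r:] = monom (form_eval f 1 r) m"
  proof -
    have "[:0, r:] = monom r 1" by (simp add: monom_Suc monom_0)
    then have "poly f [:0, r:] = (\<Sum>j\<le>m. monom (coeff (coeff f j) (m - j) * r ^ j) m)"
      unfolding poly_form[OF f] by (simp add: monom_power mult_monom)
    then show ?thesis unfolding form_eval_form[OF f] by (simp add: monom_sum)
  qed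
  ultimately have "[:- [:0, r:], 1:] dvd f" by (simp add: poly_eq_0_iff_dvd del: minus_pCons)
  moreover have "lin_form s t = [:[:- s:]:] * [:- [:0, r:], 1:]"
    by (simp add: lin_form_pCons t)
  moreover have "[:[:- s:]:] dvd 1" using False by (simp add: is_unit_const_poly_iff dvd_field_iff)
  ultimately show ?thesis by (simp only: mult_unit_dvd_iff')
qed

section \<open>Substitution into forms and homogeneity of divisors\<close>

lemma form_subst_0 [simp]: "form_subst P Q 0 = 0"
  by (simp add: form_subst_def)

lemma form_subst_pCons:
  "form_subst P Q (pCons p f) = poly (map_poly (\<lambda>c. [:[:c:]:]) p) P + Q * form_subst P Q f"
  by (simp add: form_subst_def map_poly_pCons)

lemma map_poly_const_add:
  "map_poly (\<lambda>c::'k::field. [:[:c:]:]) (p + q) = map_poly (\<lambda>c. [:[:c:]:]) p + map_poly (\<lambda>c.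
      [:[:c:]:]) q"
  by (rule poly_eqI) (simp add: coeff_map_poly)

lemma map_poly_const_smult:
  "map_poly (\<lambda>c::'k::field. [:[:c:]:]) (smult c p) = smult [:[:c:]:] (map_poly (\<lambda>c. [:[:c:]:]) p)"
  by (rule poly_eqI) (simp add: coeff_map_poly)

lemma poly_map_poly_const_mult:
  "poly (map_poly (\<lambda>c::'k::field. [:[:c:]:]) (p * q)) P =
    poly (map_poly (\<lambda>c. [:[:c:]:]) p) P * poly (map_poly (\<lambda>c. [:[:c:]:]) q) P"
  by (induction p) (simp_all add: map_poly_pCons map_poly_const_add map_poly_const_smult
      algebra_simps)

lemma form_subst_add: "form_subst P Q (f + g) = form_subst P Q f + form_subst P Q g"
proof (induction f arbitrary: g)
  case (pCons p f)
  show ?case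
    by (cases g) (simp add: form_subst_pCons pCons.IH map_poly_const_add, simp add: algebra_simps)
qed simp

lemma form_subst_smult:
  "form_subst P Q (smult p g) = poly (map_poly (\<lambda>c. [:[:c:]:]) p) P * form_subst P Q g"
  by (induction g) (simp_all add: form_subst_pCons poly_map_poly_const_mult algebra_simps)

lemma form_subst_mult: "form_subst P Q (f * g) = form_subst P Q f * form_subst P Q g"
  by (induction f) (simp_all add: form_subst_pCons form_subst_add form_subst_smult algebra_simps)

lemma form_subst_scale: "form_subst P Q (form_scale c f) = form_scale c (form_subst P Q f)"
  by (simp add: form_scale_def form_subst_smult map_poly_pCons)

lemma form_subst_diff: "form_subst P Q (f - g) = form_subst P Q f - form_subst P Q g"
  using form_subst_add[of P Q "f - g" g] by (simp add: algebra_simps)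

lemma form_subst_1 [simp]: "form_subst P Q 1 = 1"
  using form_subst_pCons[of P Q 1 0] by (simp add: map_poly_1 flip: one_pCons)

lemma form_subst_var [simp]: "form_subst P Q var_X = P" "form_subst P Q var_Y = Q"
  by (simp_all add: var_X_def var_Y_def form_subst_pCons map_poly_pCons map_poly_1 flip: one_pCons)

lemma form_subst_power: "form_subst P Q (f ^ n) = form_subst P Q f ^ n"
  by (induction n) (simp_all add: form_subst_mult)

text \<open>Under the substitution \<open>X \<mapsto> X T, Y \<mapsto> T\<close> the exponent of \<open>T\<close> records the total degree. The
  ring \<open>k[X][T]\<close> is again represented by \<^typ>\<open>'k poly poly\<close>, so that \<open>T\<close> is \<open>var_Y\<close>.\<close>

definition weighted :: "'k::field poly poly \<Rightarrow> 'k poly poly" where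
  "weighted = form_subst (var_X * var_Y) var_Y"

lemma coeff_coeff_poly_const:
  "coeff (coeff (poly (map_poly (\<lambda>c::'k::field. [:[:c:]:]) p) (var_X * var_Y)) n) i =
    (if i = n then coeff p n else 0)"
proof (induction p arbitrary: n i)
  case (pCons c p)
  have "(var_X * var_Y) * q = pCons 0 (smult [:0, 1:] q)" for q :: "'k poly poly"
    by (simp add: var_X_def var_Y_def)
  then show ?case
    using pCons by (auto simp: map_poly_pCons coeff_pCons split: nat.splits)
qed simp

lemma coeff_coeff_weighted:
  "coeff (coeff (weighted f) n) i = (if i \<le> n then coeff (coeff f (n - i)) i else 0)"
proof (induction f arbitrary: n i)
  case 0
  then show ?case by (simp add: weighted_def)
next
  case (pCons p f)
  have "weighted (pCons p f) =
      poly (map_poly (\<lambda>c::'a. [:[:c:]:]) p) (var_X * var_Y) + pCons 0 (weighted f)"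
    by (simp add: weighted_def form_subst_pCons var_Y_def)
  then show ?case
    using pCons by (auto simp: coeff_coeff_poly_const coeff_pCons Suc_diff_le split: nat.splits)
qed

lemma weighted_form:
  assumes "f \<in> forms m" shows "weighted f = monom (coeff (weighted f) m) m"
proof (rule poly_eqI, rule poly_eqI)
  fix n i
  show "coeff (coeff (weighted f) n) i = coeff (coeff (monom (coeff (weighted f) m) m) n) i"
  proof (cases "n = m")
    case False
    have "coeff (coeff (weighted f) n) i = 0"
    proof (cases "i \<le> n")
      case True
      then show ?thesis using False by (simp add: coeff_coeff_weighted coeff_form_0[OF assms])
    qed (simp add: coeff_coeff_weighted)
    then show ?thesis using False by simp
  qed simp
qed

lemma weighted_eq_0_iff: "weighted f = 0 \<longleftrightarrow> f = 0"
proof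
  assume 0: "weighted f = 0"
  have "coeff (coeff f j) i = 0" for i j
    using coeff_coeff_weighted[of f "i + j" i] 0 by simp
  then show "f = 0" by (simp add: poly_eq_iff)
qed (simp add: weighted_def)

text \<open>The order at 0 never exceeds the degree. Both are additive and agree for a monomial, so
  they agree for each factor.\<close>

lemma monom_factor:
  fixes p q :: "'a::idom poly"
  assumes "p * q = monom c m" "c \<noteq> 0"
  obtains a b where "p = monom a (degree p)" "q = monom b (degree q)"
proof -
  have nz: "p * q \<noteq> 0" using assms by simp
  then have "p \<noteq> 0" "q \<noteq> 0" by auto
  have "degree p + degree q = m" "order 0 p + order 0 q = m"
    using degree_mult_eq[OF \<open>p \<noteq> 0\<close> \<open>q \<noteq> 0\<close>] order_mult[OF nz, of 0] assms
    by (simp_all add: degree_monom_eq)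
  moreover have "order 0 p \<le> degree p" "order 0 q \<le> degree q"
    using \<open>p \<noteq> 0\<close> \<open>q \<noteq> 0\<close> by (simp_all add: order_degree)
  ultimately have o: "order 0 p = degree p" "order 0 q = degree q" by linarith+
  have mono: "r = monom (lead_coeff r) (degree r)" if "r \<noteq> 0" "order 0 r = degree r" for r :: "'a
      poly"
  proof (rule poly_eqI)
    fix n
    have "monom 1 (degree r) dvd r" using that by (simp add: monom_1_dvd_iff)
    then have "n < degree r \<Longrightarrow> coeff r n = 0" by (simp add: monom_1_dvd_iff')
    then show "coeff r n = coeff (monom (lead_coeff r) (degree r)) n"
      by (cases n "degree r" rule: linorder_cases) (auto simp: coeff_eq_0)
  qed
  show ?thesis using that mono[OF \<open>p \<noteq> 0\<close> o(1)] mono[OF \<open>q \<noteq> 0\<close> o(2)] by blast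
qed

text \<open>For a form, \<open>weighted f\<close> is a single monomial in T. So are the images of
  its divisors, and being a monomial in T means being homogeneous.\<close>

lemma forms_factor:
  fixes f g h :: "'k::field poly poly"
  assumes f: "f \<in> forms m" "f \<noteq> 0" and fgh: "f = g * h"
  obtains a b where "a + b = m" "g \<in> forms a" "h \<in> forms b"
proof -
  have w: "weighted g * weighted h = monom (coeff (weighted f) m) m"
    using weighted_form[OF f(1)] by (simp add: fgh weighted_def form_subst_mult)
  moreover have "coeff (weighted f) m \<noteq> 0"
    using weighted_form[OF f(1)] f(2) by (metis monom_eq_0 weighted_eq_0_iff)
  ultimately obtain a b where ab: "weighted g = monom a (degree (weighted g))"
      "weighted h = monom b (degree (weighted h))"
    by (rule monom_factor)
  have form: "k \<in> forms (degree (weighted k))" if "weighted k = monom c (degree (weighted k))"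
    for k :: "'k poly poly" and c
    unfolding forms_def
  proof safe
    fix i j assume "coeff (coeff k j) i \<noteq> 0"
    then have "coeff (coeff (weighted k) (i + j)) i \<noteq> 0" by (simp add: coeff_coeff_weighted)
    then show "i + j = degree (weighted k)"
      using that by (metis coeff_0 coeff_monom)
  qed
  have gh: "g \<in> forms (degree (weighted g))" "h \<in> forms (degree (weighted h))"
    using form ab by blast+
  then have "f \<in> forms (degree (weighted g) + degree (weighted h))"
    using fgh forms_mult by blast
  then show ?thesis using that gh forms_unique_degree[OF _ f(1) f(2)] by blast
qed

section \<open>Orbits on cubic forms\<close>

text \<open>One representative for each point of the projective line, so that equality of points is
  equality of pairs and sums split into (1, 0) and the affine line.\<close>

definition P1 :: "('k::field \<times> 'k) set" where
  "P1 = insert (1, 0) (range (\<lambda>x. (x, 1)))"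

lemma P1_cases: "P \<in> P1 \<longleftrightarrow> P = (1, 0) \<or> (\<exists>x. P = (x, 1))"
  by (auto simp: P1_def)

lemma sum_P1:
  fixes f :: "'k::{field,finite} \<times> 'k \<Rightarrow> 'b::comm_monoid_add"
  shows "sum f P1 = f (1, 0) + (\<Sum>x\<in>UNIV. f (x, 1))"
  unfolding P1_def by (subst sum.insert) (auto simp: sum.reindex inj_on_def)

lemma card_P1: "card (P1 :: ('k::{field,finite} \<times> 'k) set) = CARD('k) + 1"
  using sum_P1[of "\<lambda>_ :: 'k \<times> 'k. 1 :: nat"] by simp

abbreviation lin :: "'k::field \<times> 'k \<Rightarrow> 'k poly poly" where
  "lin P \<equiv> lin_form (fst P) (snd P)"

abbreviation ev :: "'k::field poly poly \<Rightarrow> 'k \<times> 'k \<Rightarrow> 'k" where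
  "ev f P \<equiv> form_eval f (fst P) (snd P)"

lemma P1_nonzero: "P \<in> P1 \<Longrightarrow> P \<noteq> (0, 0)"
  by (auto simp: P1_def)

lemma lin_nonzero [simp]: "P \<in> P1 \<Longrightarrow> lin P \<noteq> 0"
  by (auto simp: P1_def)

lemma ev_lin_eq_0_iff: "P \<in> P1 \<Longrightarrow> Q \<in> P1 \<Longrightarrow> ev (lin P) Q = 0 \<longleftrightarrow> Q = P"
  by (auto simp: P1_def)

lemma P1_normalise:
  assumes "(s, t) \<noteq> (0, 0)"
  obtains c P where "c \<noteq> 0" "P \<in> P1" "s = c * fst P" "t = c * snd P"
proof (cases "t = 0")
  case True
  then show ?thesis using assms that[of s "(1, 0)"] by (simp add: P1_def)
next
  case False
  then show ?thesis using that[of t "(s / t, 1)"] by (simp add: P1_def)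
qed

section \<open>Projective zeros and factorisation of forms of low degree\<close>

definition zeros :: "'k::field poly poly \<Rightarrow> ('k \<times> 'k) set" where
  "zeros f = {P \<in> P1. ev f P = 0}"

lemma zeros_subset: "zeros f \<subseteq> P1"
  by (auto simp: zeros_def)

lemma zeros_mult [simp]: "zeros (f * g) = zeros f \<union> zeros g"
  by (auto simp: zeros_def)

lemma zeros_scale [simp]: "c \<noteq> 0 \<Longrightarrow> zeros (form_scale c f) = zeros f"
  by (auto simp: zeros_def)

lemma zeros_power [simp]: "n \<noteq> 0 \<Longrightarrow> zeros (f ^ n) = zeros f"
  by (auto simp: zeros_def)

lemma zeros_lin [simp]: "P \<in> P1 \<Longrightarrow> zeros (lin P) = {P}"
  using ev_lin_eq_0_iff unfolding zeros_def by blast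

lemma form_root_factor:
  assumes f: "f \<in> forms (Suc m)" "f \<noteq> 0" and P: "P \<in> zeros f"
  obtains g where "g \<in> forms m" "g \<noteq> 0" "f = lin P * g"
proof -
  have P': "P \<in> P1" "ev f P = 0" using P by (auto simp: zeros_def)
  have "lin P dvd f"
    using lin_form_dvd[OF f(1) P'(2)] P1_nonzero[OF P'(1)] by simp
  then obtain g where g: "f = lin P * g" by (elim dvdE)
  obtain a b where ab: "a + b = Suc m" "lin P \<in> forms a" "g \<in> forms b"
    using forms_factor[OF f g] by blast
  have "a = 1" by (rule forms_unique_degree[OF ab(2) lin_form_in_forms lin_nonzero[OF P'(1)]])
  then show ?thesis using that ab g f(2) by auto
qed

lemma form_0_eq_scale:
  assumes "f \<in> forms 0" "f \<noteq> 0"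
  obtains c where "c \<noteq> 0" "f = form_scale c 1" "f dvd 1"
proof -
  obtain c where c: "f = [:[:c:]:]" using assms(1) by (rule forms_0E)
  then show ?thesis
    using that[of c] assms(2) by (auto simp: form_scale_def is_unit_const_poly_iff dvd_field_iff)
qed

lemma form_1_eq_lin:
  assumes f: "f \<in> forms 1" "f \<noteq> 0"
  obtains c P where "c \<noteq> 0" "P \<in> P1" "f = form_scale c (lin P)"
proof -
  define a b where "a = coeff (coeff f 0) 1" "b = coeff (coeff f 1) 0"
  have ev: "form_eval f s t = a * s + b * t" for s t
    unfolding form_eval_form[OF f(1)] by (simp add: a_b_def)
  have "(- b, a) \<noteq> (0, 0)"
  proof
    assume "(- b, a) = (0, 0)"
    then have "coeff f j = 0" for j
      by (subst coeff_form[OF f(1)]) (auto simp: a_b_def le_Suc_eq)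
    then show False using f(2) by (simp add: poly_eq_iff)
  qed
  then obtain c P where P: "c \<noteq> 0" "P \<in> P1" "- b = c * fst P" "a = c * snd P"
    by (rule P1_normalise)
  have "c * ev f P = a * (c * fst P) + b * (c * snd P)" by (simp add: ev algebra_simps)
  also have "\<dots> = 0" unfolding P(3,4)[symmetric] by simp
  finally have "P \<in> zeros f" using P by (simp add: zeros_def)
  then obtain g where g: "g \<in> forms 0" "g \<noteq> 0" "f = lin P * g"
    using form_root_factor[of f 0 P] f by auto
  then show ?thesis using that P(2) form_0_eq_scale[OF g(1,2)]
    by (metis form_scale_mult_right mult.right_neutral)
qed

lemma form_not_unit:
  assumes "f \<in> forms m" "m \<noteq> 0"
  shows "\<not> f dvd 1"
proof
  assume "f dvd 1"
  then obtain g where "1 = f * g" by (elim dvdE)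
  then obtain a b where ab: "a + b = 0" "f \<in> forms a" "g \<in> forms b"
    using forms_factor[OF forms_1] by (metis one_neq_zero)
  moreover have "f \<noteq> 0" using \<open>1 = f * g\<close> by auto
  ultimately show False using forms_unique_degree[OF assms(1)] assms(2) by auto
qed

lemma form_reducible_cases:
  assumes f: "f \<in> forms m" "f \<noteq> 0" "m \<noteq> 0" and red: "\<not> irreducible f"
  obtains a b g h where "a + b = m" "a \<noteq> 0" "b \<noteq> 0" "g \<in> forms a" "h \<in> forms b"
    "g \<noteq> 0" "h \<noteq> 0" "f = g * h"
proof -
  obtain g h where gh: "f = g * h" "\<not> g dvd 1" "\<not> h dvd 1"
    using red f(2) form_not_unit[OF f(1,3)] by (auto simp: irreducible_def)
  then have nz: "g \<noteq> 0" "h \<noteq> 0" using f(2) by auto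
  obtain a b where ab: "a + b = m" "g \<in> forms a" "h \<in> forms b"
    using forms_factor[OF f(1,2) gh(1)] by blast
  have "a \<noteq> 0" using form_0_eq_scale[of g] ab(2) gh(2) nz(1) by metis
  moreover have "b \<noteq> 0" using form_0_eq_scale[of h] ab(3) gh(3) nz(2) by metis
  ultimately show ?thesis using that ab nz gh(1) by blast
qed

lemma form_1_zeros: "f \<in> forms 1 \<Longrightarrow> f \<noteq> 0 \<Longrightarrow> zeros f \<noteq> {}"
  by (erule form_1_eq_lin) auto

lemma irreducible_form_1: "f \<in> forms 1 \<Longrightarrow> f \<noteq> 0 \<Longrightarrow> irreducible f"
  by (rule ccontr, erule form_reducible_cases[of f 1]) auto

lemma irreducible_form_no_zeros:
  assumes f: "f \<in> forms m" "f \<noteq> 0" "m \<in> {2, 3}" and no: "zeros f = {}"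
  shows "irreducible f"
proof (rule ccontr)
  assume "\<not> irreducible f"
  then obtain a b g h where gh: "a + b = m" "a \<noteq> 0" "b \<noteq> 0" "g \<in> forms a" "h \<in> forms b"
    "g \<noteq> 0" "h \<noteq> 0" "f = g * h"
    using f by (elim form_reducible_cases[of f m]) auto
  then have "a = 1 \<or> b = 1" using f(3) by auto
  then show False using gh no form_1_zeros by auto
qed

lemma irreducible_form_zeros:
  assumes f: "f \<in> forms (Suc m)" "irreducible f" "m \<noteq> 0"
  shows "zeros f = {}"
proof (rule ccontr)
  assume "zeros f \<noteq> {}"
  then obtain P where P: "P \<in> zeros f" by blast
  have "f \<noteq> 0" using f(2) by auto
  then obtain g where g: "g \<in> forms m" "f = lin P * g"
    using form_root_factor[OF f(1) _ P] by metis
  have "\<not> lin P dvd 1" by (rule form_not_unit[OF lin_form_in_forms]) simp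
  then show False using irreducibleD[OF f(2) g(2)] form_not_unit[OF g(1) f(3)] by blast
qed

lemma quadratic_form_cases:
  assumes f: "f \<in> forms 2" "f \<noteq> 0"
  obtains "zeros f = {}"
  | c P Q where "c \<noteq> 0" "P \<in> P1" "Q \<in> P1" "f = form_scale c (lin P * lin Q)"
proof (cases "zeros f = {}")
  case False
  then obtain P where P: "P \<in> zeros f" by blast
  then obtain g where g: "g \<in> forms 1" "g \<noteq> 0" "f = lin P * g"
    using form_root_factor[of f 1 P] f by (auto simp: numeral_2_eq_2)
  then show ?thesis using that(2) form_1_eq_lin[OF g(1,2)] P zeros_subset
    by (metis form_scale_mult_right subsetD)
qed (use that in blast)

lemma cubic_form_cases:
  assumes f: "f \<in> forms 3" "f \<noteq> 0"
  obtains "zeros f = {}"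
  | P g where "P \<in> P1" "g \<in> forms 2" "g \<noteq> 0" "zeros g = {}" "f = lin P * g"
  | c P Q R where "c \<noteq> 0" "P \<in> P1" "Q \<in> P1" "R \<in> P1" "f = form_scale c (lin P * lin Q * lin R)"
proof (cases "zeros f = {}")
  case False
  then obtain P where P: "P \<in> zeros f" by blast
  then have P': "P \<in> P1" using zeros_subset by blast
  from P obtain g where g: "g \<in> forms 2" "g \<noteq> 0" "f = lin P * g"
    using form_root_factor[of f 2 P] f by (auto simp: numeral_3_eq_3 numeral_2_eq_2)
  from g(1,2) show ?thesis
  proof (cases rule: quadratic_form_cases)
    case 1
    then show ?thesis using that(2) g P' by blast
  next
    case (2 c Q R)
    then have "f = form_scale c (lin P * lin Q * lin R)"
      using g(3) by (simp add: form_scale_mult_right mult.assoc)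
    then show ?thesis using that(3) 2 P' by blast
  qed
qed (use that in blast)

section \<open>Orbits of cubic forms in terms of their zeros\<close>

lemma pg_point_scale: "c \<noteq> 0 \<Longrightarrow> pg_point (form_scale c f) = pg_point f"
proof -
  assume c: "c \<noteq> 0"
  have "form_scale k f = form_scale (k / c) (form_scale c f)" for k
    using c by simp
  then have "form_scale k f \<in> range (\<lambda>k. form_scale k (form_scale c f))" for k
    by (metis rangeI)
  moreover have "form_scale k (form_scale c f) \<in> range (\<lambda>k. form_scale k f)" for k
    by (metis rangeI form_scale_scale)
  ultimately show ?thesis
    unfolding pg_point_def form.span_singleton by (intro equalityI image_subsetI)
qed

lemma pg_point_self: "f \<in> pg_point f"
  unfolding pg_point_def by (simp add: form.span_base)

lemma pg_point_eqD:
  assumes "pg_point f = pg_point g" "f \<noteq> 0"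
  obtains c where "c \<noteq> 0" "f = form_scale c g"
proof -
  have "f \<in> range (\<lambda>k. form_scale k g)"
    using pg_point_self[of f] assms(1) unfolding pg_point_def form.span_singleton by auto
  then obtain c where "f = form_scale c g" by auto
  then show ?thesis using that assms(2) by (cases "c = 0") auto
qed

lemma GL2_act_eq:
  "GL2_act m g f = form_scale (inverse (det g ^ m))
     (form_subst (lin_form (g $ 1 $ 2) (g $ 2 $ 2)) (lin_form (- g $ 1 $ 1) (- g $ 2 $ 1)) f)"
proof -
  have "form_scale a var_Y - form_scale c var_X = lin_form (- a) (- c)" for a c :: 'a
    by (simp add: lin_form_pCons form_scale_def var_X_def var_Y_def)
  then show ?thesis unfolding GL2_act_def by (simp add: lin_form_def[of "g $ 1 $ 2"])
qed

text \<open>A matrix replaces X and Y by two linear forms, which are multiples of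
  \<open>lin P\<close> and \<open>lin Q\<close>; invertibility means \<open>P \<noteq> Q\<close>.
  The power of the determinant only rescales the form.\<close>

lemma cubic_orbit_eq:
  "cubic_orbit f = {pg_point (form_subst (form_scale \<alpha> (lin P)) (form_scale \<beta> (lin Q)) f) |
     \<alpha> \<beta> P Q. \<alpha> \<noteq> 0 \<and> \<beta> \<noteq> 0 \<and> P \<in> P1 \<and> Q \<in> P1 \<and> P \<noteq> Q}" (is "_ = ?R")
proof (intro equalityI subsetI)
  fix x assume "x \<in> cubic_orbit f"
  then obtain g :: "'a ^ 2 ^ 2" where g: "invertible g" "x = pg_point (GL2_act 3 g f)"
    by (auto simp: cubic_orbit_def)
  have det: "det g \<noteq> 0" using g(1) invertible_det_nz by blast
  obtain a b c d where abcd: "g $ 1 $ 1 = a" "g $ 1 $ 2 = b" "g $ 2 $ 1 = c" "g $ 2 $ 2 = d" by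
      blast
  have d: "a * d - b * c \<noteq> 0" using det by (simp add: det_2 abcd)
  then have "(b, d) \<noteq> (0, 0)" by auto
  then obtain \<alpha> P where P: "\<alpha> \<noteq> 0" "P \<in> P1" "b = \<alpha> * fst P" "d = \<alpha> * snd P"
    by (rule P1_normalise)
  have "(- a, - c) \<noteq> (0, 0)" using d by auto
  then obtain \<beta> Q where Q: "\<beta> \<noteq> 0" "Q \<in> P1" "- a = \<beta> * fst Q" "- c = \<beta> * snd Q"
    by (rule P1_normalise)
  have "P \<noteq> Q"
  proof
    assume "P = Q"
    have "a * d - b * c = - ((- a) * d) + b * (- c)" by simp
    also have "\<dots> = 0" unfolding P(3,4) Q(3,4) \<open>P = Q\<close> by simp
    finally show False using d by simp
  qed
  moreover have "x = pg_point (form_subst (form_scale \<alpha> (lin P)) (form_scale \<beta> (lin Q)) f)"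
    using det unfolding g(2) GL2_act_eq abcd P(3,4) Q(3,4) lin_form_scale by (simp add:
        pg_point_scale)
  ultimately show "x \<in> ?R" using P(1,2) Q(1,2) by blast
next
  fix x assume "x \<in> ?R"
  then obtain \<alpha> \<beta> P Q where x: "x = pg_point (form_subst (form_scale \<alpha> (lin P)) (form_scale \<beta> (lin
      Q)) f)"
    and *: "\<alpha> \<noteq> 0" "\<beta> \<noteq> 0" "P \<in> P1" "Q \<in> P1" "P \<noteq> Q" by blast
  \<comment> \<open>Read off from \<open>GL2_act_eq\<close>, where the entries of the first column
    enter with a minus sign.\<close>
  define g :: "'a ^ 2 ^ 2" where
    "g = vector [vector [- \<beta> * fst Q, \<alpha> * fst P], vector [- \<beta> * snd Q, \<alpha> * snd P]]"
  have comp: "g $ 1 $ 1 = - \<beta> * fst Q" "g $ 1 $ 2 = \<alpha> * fst P" "g $ 2 $ 1 = - \<beta> * snd Q"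
    "g $ 2 $ 2 = \<alpha> * snd P" by (simp_all add: g_def)
  have "det g = - \<alpha> * \<beta> * ev (lin P) Q" by (simp add: det_2 comp algebra_simps)
  then have det: "det g \<noteq> 0" using * ev_lin_eq_0_iff[of P Q] by auto
  then have "invertible g" using invertible_det_nz by blast
  moreover have "x = pg_point (GL2_act 3 g f)"
    using det unfolding x GL2_act_eq comp by (simp add: pg_point_scale lin_form_scale)
  ultimately show "x \<in> cubic_orbit f" unfolding cubic_orbit_def by blast
qed

lemma cubic_orbitI:
  assumes "\<alpha> \<noteq> 0" "\<beta> \<noteq> 0" "P \<in> P1" "Q \<in> P1" "P \<noteq> Q"
    and "form_subst (form_scale \<alpha> (lin P)) (form_scale \<beta> (lin Q)) f = form_scale k h" "k \<noteq> 0"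
  shows "pg_point h \<in> cubic_orbit f"
  unfolding cubic_orbit_eq pg_point_scale[OF assms(7), of h, symmetric] assms(6)[symmetric]
  using assms(1-5) by blast

lemma O1_zeros:
  assumes "pg_point f \<in> O1" "f \<noteq> 0"
  obtains c P where "c \<noteq> 0" "P \<in> P1" "f = form_scale c (lin P ^ 3)"
proof -
  obtain \<alpha> \<beta> P Q where "pg_point f = pg_point (form_scale \<alpha> (lin P) ^ 3)" "\<alpha> \<noteq> 0" "P \<in> P1"
    using assms(1) unfolding O1_def cubic_orbit_eq by (auto simp: form_subst_power)
  moreover have "form_scale \<alpha> (lin P) ^ 3 = form_scale (\<alpha> ^ 3) (lin P ^ 3)"
    by (simp add: power3_eq_cube form_scale_mult_left form_scale_mult_right mult.assoc)
  ultimately show ?thesis using that pg_point_eqD[OF _ assms(2)] pg_point_scale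
    by (metis power_not_zero)
qed

lemma zeros_eq_of_pg_point: "pg_point f = pg_point g \<Longrightarrow> f \<noteq> 0 \<Longrightarrow> zeros f = zeros g"
  by (erule pg_point_eqD) auto

lemma O2_zeros:
  assumes "pg_point f \<in> O2" "f \<noteq> 0"
  shows "card (zeros f) = 2"
proof -
  obtain \<alpha> \<beta> P Q where *: "pg_point f = pg_point (form_scale \<alpha> (lin P) ^ 2 * form_scale \<beta> (lin Q))"
      "\<alpha> \<noteq> 0" "\<beta> \<noteq> 0" "P \<in> P1" "Q \<in> P1" "P \<noteq> Q"
    using assms(1) unfolding O2_def cubic_orbit_eq by (auto simp: form_subst_power form_subst_mult)
  then show ?thesis using zeros_eq_of_pg_point[OF *(1) assms(2)] by simp
qed

lemma O2_intro:
  assumes "c \<noteq> 0" "P \<in> P1" "Q \<in> P1" "P \<noteq> Q"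
  shows "pg_point (form_scale c (lin P * lin P * lin Q)) \<in> O2"
proof -
  have "form_subst (form_scale 1 (lin P)) (form_scale 1 (lin Q)) (var_X ^ 2 * var_Y) =
      form_scale (1 / c) (form_scale c (lin P * lin P * lin Q))"
    using assms(1) by (simp add: form_subst_mult form_subst_power power2_eq_square)
  then show ?thesis unfolding O2_def using assms by (intro cubic_orbitI[of 1 1 P Q _ "1 / c"]) auto
qed

lemma O3_zeros:
  assumes "pg_point f \<in> O3" "f \<noteq> 0"
  shows "card (zeros f) = 3"
proof -
  obtain \<alpha> \<beta> P Q where *: "pg_point f = pg_point (form_scale \<alpha> (lin P) * form_scale \<beta> (lin Q) *
        (form_scale \<alpha> (lin P) - form_scale \<beta> (lin Q)))" (is "_ = pg_point (_ * ?r)")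
      "\<alpha> \<noteq> 0" "\<beta> \<noteq> 0" "P \<in> P1" "Q \<in> P1" "P \<noteq> Q"
    using assms(1) unfolding O3_def cubic_orbit_eq by (auto simp: form_subst_diff form_subst_mult)
  have PQ: "ev (lin Q) P \<noteq> 0" "ev (lin P) Q \<noteq> 0" using * ev_lin_eq_0_iff by metis+
  have "ev ?r P = - \<beta> * ev (lin Q) P" by (simp add: algebra_simps)
  then have rP: "ev ?r P \<noteq> 0" using PQ * by simp
  have "ev ?r Q = \<alpha> * ev (lin P) Q" by (simp add: algebra_simps)
  then have rQ: "ev ?r Q \<noteq> 0" using PQ * by simp
  have r: "?r \<in> forms 1" by (intro forms_diff forms_scale lin_form_in_forms)
  have "?r \<noteq> 0" using rP form_eval_simps(1) by metis
  then obtain c R where R: "c \<noteq> 0" "R \<in> P1" "?r = form_scale c (lin R)"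
    using form_1_eq_lin[OF r] by blast
  have "R \<noteq> P" "R \<noteq> Q" using rP rQ R by auto
  then show ?thesis using zeros_eq_of_pg_point[OF *(1) assms(2)] * R by simp
qed

text \<open>The scalars are chosen such that \<open>\<alpha>\<close> times \<open>lin P\<close>
  minus \<open>\<beta>\<close> times \<open>lin Q\<close> vanishes at \<open>R\<close>, hence is a
  multiple of \<open>lin R\<close>. This is the transitivity of the group on triples of distinct
  points.\<close>

lemma O3_intro:
  assumes c: "c \<noteq> 0" and P: "P \<in> P1" "Q \<in> P1" "R \<in> P1" and ne: "P \<noteq> Q" "R \<noteq> P" "R \<noteq> Q"
  shows "pg_point (form_scale c (lin P * lin Q * lin R)) \<in> O3"
proof -
  have nz: "ev (lin Q) P \<noteq> 0" "ev (lin Q) R \<noteq> 0" "ev (lin P) R \<noteq> 0" using P ne ev_lin_eq_0_iff by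
      metis+
  define \<alpha> \<beta> where "\<alpha> = ev (lin Q) R" "\<beta> = ev (lin P) R"
  have "form_scale \<alpha> (lin P) - form_scale \<beta> (lin Q) = form_scale (ev (lin Q) P) (lin R)"
    unfolding \<alpha>_\<beta>_def form_eval_simps by (simp add: lin_form_pCons form_scale_def algebra_simps)
  then have "form_subst (form_scale \<alpha> (lin P)) (form_scale \<beta> (lin Q)) (var_X * var_Y * (var_X -
      var_Y)) =
     form_scale (\<alpha> * \<beta> * ev (lin Q) P / c) (form_scale c (lin P * lin Q * lin R))"
    using c by (simp only: form_subst_mult form_subst_diff form_subst_var form_scale_mult_left
        form_scale_mult_right form_scale_scale) (simp add: mult_ac)
  moreover have "\<alpha> \<noteq> 0" "\<beta> \<noteq> 0" using nz by (simp_all only: \<alpha>_\<beta>_def not_False_eq_True)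
  ultimately show ?thesis
    unfolding O3_def using P ne nz c by (intro cubic_orbitI[of \<alpha> \<beta> P Q]) (assumption | simp only:
        divide_eq_0_iff mult_eq_0_iff simp_thms)+
qed

text \<open>A zero of the quadratic factor would exhibit \<epsilon> as the square of a quotient of
  two values. The denominator is nonzero there, because \<open>lin P\<close> and
  \<open>lin Q\<close> have no common zero.\<close>

lemma O4_zeros:
  assumes "pg_point f \<in> O4 \<epsilon>" "f \<noteq> 0" and ns: "\<not> (\<exists>x. \<epsilon> = x ^ 2)"
  shows "card (zeros f) = 1"
proof -
  obtain \<alpha> \<beta> P Q where *: "pg_point f = pg_point (form_scale \<alpha> (lin P) *
        (form_scale \<alpha> (lin P) ^ 2 - form_scale \<epsilon> (form_scale \<beta> (lin Q) ^ 2)))" (is "_ = pg_point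
            (_ * ?r)")
      "\<alpha> \<noteq> 0" "\<beta> \<noteq> 0" "P \<in> P1" "Q \<in> P1" "P \<noteq> Q"
    using assms(1) unfolding O4_def cubic_orbit_eq
    by (auto simp: form_subst_diff form_subst_mult form_subst_power form_subst_scale)
  have "ev ?r R \<noteq> 0" if R: "R \<in> P1" for R
  proof
    assume "ev ?r R = 0"
    then have r: "(\<alpha> * ev (lin P) R) ^ 2 = \<epsilon> * (\<beta> * ev (lin Q) R) ^ 2" by simp
    show False
    proof (cases "ev (lin Q) R = 0")
      case True
      then have "(\<alpha> * ev (lin P) R) ^ 2 = 0" unfolding r by (simp only:) simp
      then have "ev (lin P) R = 0" using *(2) by (simp only: power_eq_0_iff mult_eq_0_iff) simp
      then show False using True R * ev_lin_eq_0_iff by metis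
    next
      case False
      then have "(\<beta> * ev (lin Q) R) ^ 2 \<noteq> 0" using *(3) by (simp only: power_eq_0_iff
          mult_eq_0_iff) simp
      then have "\<epsilon> = (\<alpha> * ev (lin P) R / (\<beta> * ev (lin Q) R)) ^ 2"
        unfolding power_divide r by (simp only: nonzero_mult_div_cancel_right not_False_eq_True)
      then show False using ns by blast
    qed
  qed
  then have "zeros ?r = {}" unfolding zeros_def by blast
  then show ?thesis using zeros_eq_of_pg_point[OF *(1) assms(2)] * by simp
qed

text \<open>\<open>lin P\<close> vanishes at \<open>P\<close> and \<open>lin Q\<close> does not, so
  evaluating at \<open>P\<close> yields the coefficient of the square of \<open>lin Q\<close>. What
  remains is divisible by \<open>lin P\<close>, and the same argument applies to the linear
  quotient.\<close>

lemma forms_2_expand: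
  assumes g: "g \<in> forms 2" and P: "P \<in> P1" "Q \<in> P1" "P \<noteq> Q"
  obtains A B C where "g = form_scale A (lin P * lin P) + form_scale B (lin P * lin Q) +
      form_scale C (lin Q * lin Q)"
proof -
  have nz: "ev (lin Q) P \<noteq> 0" using P ev_lin_eq_0_iff by metis
  have lin: "\<exists>a b. h = form_scale a (lin P) + form_scale b (lin Q)" if h: "h \<in> forms 1" for h
  proof -
    define b where "b = ev h P / ev (lin Q) P"
    define k where "k = h - form_scale b (lin Q)"
    have k1: "k \<in> forms 1" unfolding k_def by (intro forms_diff forms_scale h lin_form_in_forms)
    have "ev k P = ev h P - b * ev (lin Q) P" by (simp add: k_def)
    also have "\<dots> = 0" using nz by (simp only: b_def nonzero_eq_divide_eq times_divide_eq_left) simp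
    finally have evk: "ev k P = 0" .
    have "\<exists>a. k = form_scale a (lin P)"
    proof (cases "k = 0")
      case True
      then show ?thesis by (intro exI[of _ 0]) simp
    next
      case False
      obtain c R where R: "c \<noteq> 0" "R \<in> P1" "k = form_scale c (lin R)"
        using form_1_eq_lin[OF k1 False] by blast
      then have "ev (lin R) P = 0" using evk by (simp only: form_eval_simps mult_eq_0_iff) simp
      then show ?thesis using R P ev_lin_eq_0_iff by blast
    qed
    then show ?thesis unfolding k_def by (metis diff_add_cancel)
  qed
  define C where "C = ev g P / (ev (lin Q) P) ^ 2"
  define k where "k = g - form_scale C (lin Q * lin Q)"
  have k2: "k \<in> forms 2"
    unfolding k_def using forms_mult[OF lin_form_in_forms lin_form_in_forms]
    by (intro forms_diff forms_scale g) (simp add: numeral_2_eq_2)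
  have "ev k P = ev g P - C * (ev (lin Q) P) ^ 2" by (simp add: k_def power2_eq_square)
  also have "\<dots> = 0" using nz by (simp only: C_def nonzero_eq_divide_eq times_divide_eq_left
      power_eq_0_iff) simp
  finally have evk: "ev k P = 0" .
  have "\<exists>a b. k = lin P * (form_scale a (lin P) + form_scale b (lin Q))"
  proof (cases "k = 0")
    case True
    then show ?thesis by (intro exI[of _ 0]) simp
  next
    case False
    have "P \<in> zeros k" using P evk by (simp add: zeros_def)
    then obtain h where "h \<in> forms 1" "k = lin P * h"
      using form_root_factor[of k 1 P] k2 False by (auto simp: numeral_2_eq_2)
    then show ?thesis using lin by blast
  qed
  then obtain a b where "g = lin P * (form_scale a (lin P) + form_scale b (lin Q)) + form_scale C
      (lin Q * lin Q)"
    unfolding k_def by (metis diff_add_cancel)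
  then show ?thesis by (intro that) (simp add: distrib_left form_scale_mult_right)
qed

lemma complete_square:
  "form_scale A (p * p) + form_scale (2 * C * b) (p * q) + form_scale C (q * q) =
   form_scale (A - C * b ^ 2) (p * p) + form_scale C ((q + form_scale b p) * (q + form_scale b p))"
proof -
  \<comment> \<open>Writing scalars as constant polynomials turns the claim into a commutative ring
    identity.\<close>
  define K :: "'a \<Rightarrow> 'a poly poly" where "K c = [:[:c:]:]" for c
  have K: "form_scale c f = K c * f" "K (c * d) = K c * K d" "K (c - d) = K c - K d" "K (c ^ 2) =
      K c ^ 2"
     "K 2 = 2" for c d f
    by (simp_all add: form_scale_eq_mult K_def power2_eq_square numeral_poly)
  show ?thesis unfolding K by Groebner_Basis.algebra
qed

text \<open>Completing the square turns \<open>g\<close> into D times (square of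
  \<open>lin P\<close> minus x times square of \<open>lin R\<close>). As \<open>g\<close> has no
  zeros, \<open>x\<close> is a nonsquare. The product of two nonsquares is a square, so x =
  \<epsilon> \<beta>^2, and \<beta> is absorbed into the linear form.\<close>

lemma O4_intro:
  fixes g :: "'k::{field,finite} poly poly"
  assumes 2: "(2::'k) \<noteq> 0" and ns: "\<not> (\<exists>x. \<epsilon> = x ^ 2)"
    and P: "P \<in> P1" and g: "g \<in> forms 2" "g \<noteq> 0" "zeros g = {}"
  shows "pg_point (lin P * g) \<in> O4 \<epsilon>"
proof -
  obtain Q :: "'k \<times> 'k" where Q: "Q \<in> P1" "P \<noteq> Q"
  proof (cases "P = (1, 0)")
    case True
    then show ?thesis using that[of "(0, 1)"] by (simp add: P1_def)
  qed (use that[of "(1, 0)"] in \<open>simp add: P1_def\<close>)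
  obtain A B C where ABC: "g = form_scale A (lin P * lin P) + form_scale B (lin P * lin Q) +
      form_scale C (lin Q * lin Q)"
    using forms_2_expand[OF g(1) P Q] by blast
  have PQ: "ev (lin Q) P \<noteq> 0" using P Q ev_lin_eq_0_iff by metis
  have PP: "ev (lin P) P = 0" by simp
  have "ev g P \<noteq> 0" using g(3) P unfolding zeros_def by blast
  moreover have "ev g P = C * ev (lin Q) P ^ 2"
    unfolding ABC by (simp only: form_eval_simps(3,6,8) PP power2_eq_square) simp
  ultimately have C: "C \<noteq> 0" by auto
  define b where "b = B / (2 * C)"
  have B: "B = 2 * C * b" using 2 C by (simp add: b_def)
  define D where "D = A - C * b ^ 2"
  define m where "m = lin Q + form_scale b (lin P)"
  have m1: "m \<in> forms 1" unfolding m_def by (intro forms_add forms_scale lin_form_in_forms)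
  have "ev m P = ev (lin Q) P" unfolding m_def by (simp only: form_eval_simps(3,8) PP) simp
  then have "ev m P \<noteq> 0" using PQ by simp
  then have "m \<noteq> 0" using form_eval_simps(1) by metis
  then obtain \<gamma> R where R: "\<gamma> \<noteq> 0" "R \<in> P1" "m = form_scale \<gamma> (lin R)"
    using form_1_eq_lin[OF m1] by blast
  have RP: "P \<noteq> R" using \<open>ev m P \<noteq> 0\<close> R(3) by auto
  have gR: "g = form_scale D (lin P * lin P) + form_scale (C * \<gamma> ^ 2) (lin R * lin R)"
    unfolding ABC B complete_square m_def[symmetric] D_def[symmetric] R(3)
    by (simp add: form_scale_mult_left form_scale_mult_right power2_eq_square mult.assoc)
  have evg: "ev g S \<noteq> 0" if "S \<in> P1" for S using g(3) that unfolding zeros_def by blast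
  have evR: "ev g S = D * ev (lin P) S ^ 2 + C * \<gamma> ^ 2 * ev (lin R) S ^ 2" for S
    unfolding gR by (simp only: form_eval_simps(3,6,8) power2_eq_square)
  have "ev (lin R) R = 0" by simp
  \<comment> \<open>For D = 0 the form \<open>g\<close> would vanish at \<open>R\<close>.\<close>
  then have D: "D \<noteq> 0" using evg[OF R(2)] evR[of R] by auto
  define x where "x = - (C * \<gamma> ^ 2) / D"
  have x: "C * \<gamma> ^ 2 = - D * x" using D by (simp add: x_def)
  have x0: "x \<noteq> 0" using C R D by (simp add: x_def)
  have "\<not> (\<exists>r. x = r ^ 2)"
  proof
    assume "\<exists>r. x = r ^ 2"
    then obtain r where r: "x = r ^ 2" by blast
    then have r0: "r \<noteq> 0" using x0 by auto
    \<comment> \<open>With x = r^2, \<open>n\<close> divides \<open>g\<close>, so the rational zero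
      of the linear form \<open>n\<close> would be a zero of \<open>g\<close>.\<close>
    define n where "n = lin P - form_scale r (lin R)"
    have n1: "n \<in> forms 1" unfolding n_def by (intro forms_diff forms_scale lin_form_in_forms)
    have "ev (lin R) P \<noteq> 0" using RP P R ev_lin_eq_0_iff by metis
    moreover have "ev n P = - r * ev (lin R) P" unfolding n_def by (simp only:
        form_eval_simps(4,8) PP) simp
    ultimately have "ev n P \<noteq> 0" using r0 by (simp only: mult_eq_0_iff neg_equal_0_iff_equal
        simp_thms)
    then have "n \<noteq> 0" using form_eval_simps(1) by metis
    then obtain S where S: "S \<in> P1" "ev n S = 0" using form_1_zeros[OF n1] by (auto simp: zeros_def)
    then have "ev (lin P) S = r * ev (lin R) S" unfolding n_def by (simp only:
        form_eval_simps(4,8) right_minus_eq)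
    then have "ev g S = 0" unfolding evR x r by (simp add: power_mult_distrib)
    then show False using evg S by blast
  qed
  then have "qchar x = -1" using x0 by (simp add: qchar_def)
  moreover have \<epsilon>0: "\<epsilon> \<noteq> 0" using ns by (metis zero_power2)
  then have "qchar \<epsilon> = -1" using ns by (simp add: qchar_def)
  ultimately have "qchar (\<epsilon> * x) = 1" using qchar_mult_nonsquare[OF 2] by simp
  then obtain w where w: "\<epsilon> * x = w ^ 2" by (auto simp: qchar_def split: if_splits)
  define \<beta> where "\<beta> = w / \<epsilon>"
  have xb: "x = \<epsilon> * \<beta> ^ 2" using w \<epsilon>0 by (simp add: \<beta>_def power2_eq_square field_simps)
  have b0: "\<beta> \<noteq> 0" using xb x0 by auto
  have "form_subst (form_scale 1 (lin P)) (form_scale \<beta> (lin R)) (var_X * (var_X ^ 2 - form_scale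
      \<epsilon> (var_Y ^ 2)))
     = lin P * (lin P * lin P - form_scale x (lin R * lin R))"
    by (simp add: form_subst_mult form_subst_diff form_subst_power form_subst_scale power2_eq_square
        form_scale_mult_left form_scale_mult_right xb mult_ac)
  also have "\<dots> = form_scale (1 / D) (lin P * g)"
    unfolding gR x using D
    by (simp add: form_scale_mult_right form.scale_right_diff_distrib form.scale_right_distrib
        distrib_left right_diff_distrib)
  finally show ?thesis
    unfolding O4_def using P R RP b0 D by (intro cubic_orbitI[of 1 \<beta> P R _ "1 / D"]) auto
qed

lemma O5_zeros:
  assumes "pg_point f \<in> O5" "f \<noteq> 0"
  shows "zeros f = {}"
proof -
  obtain h where h: "pg_point f = pg_point h" "h \<in> forms 3" "irreducible h"
    using assms(1) by (auto simp: O5_def)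
  then show ?thesis using zeros_eq_of_pg_point[OF h(1) assms(2)] irreducible_form_zeros[of h 2]
    by (simp add: numeral_3_eq_3 numeral_2_eq_2)
qed

lemma O5_intro: "f \<in> forms 3 \<Longrightarrow> f \<noteq> 0 \<Longrightarrow> zeros f = {} \<Longrightarrow> pg_point f \<in> O5"
  unfolding O5_def using irreducible_form_no_zeros[of f 3] by auto

section \<open>Factorisation types of quartic forms and their zeros\<close>

lemma not_proportional_zeros:
  assumes "f \<in> forms 1" "irreducible f" "g \<in> forms 1" "irreducible g" "\<not> proportional f g"
  shows "zeros f \<inter> zeros g = {}"
proof -
  have "f \<noteq> 0" "g \<noteq> 0" using assms by auto
  then obtain c P d Q where PQ: "c \<noteq> 0" "P \<in> P1" "f = form_scale c (lin P)"
      "d \<noteq> 0" "Q \<in> P1" "g = form_scale d (lin Q)"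
    using form_1_eq_lin assms(1,3) by metis
  have "P \<noteq> Q"
  proof
    assume "P = Q"
    then have "f = form_scale (c / d) g" using PQ by simp
    then show False using assms(5) PQ unfolding proportional_def by (metis divide_eq_0_iff)
  qed
  then show ?thesis using PQ by simp
qed

lemma card_zeros_linear:
  assumes "f \<in> forms 1" "irreducible f"
  shows "card (zeros f) = 1"
proof -
  have "f \<noteq> 0" using assms by auto
  then obtain c P where "c \<noteq> 0" "P \<in> P1" "f = form_scale c (lin P)"
    using form_1_eq_lin assms(1) by metis
  then show ?thesis by simp
qed

lemma card_zeros_F:
  fixes \<phi> :: "'k::{field,finite} poly poly"
  shows "\<phi> \<in> F4 \<Longrightarrow> card (zeros \<phi>) = 4" "\<phi> \<in> F2 \<Longrightarrow> card (zeros \<phi>) = 2"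
    "\<phi> \<in> F1 \<Longrightarrow> card (zeros \<phi>) = 1" "\<phi> \<in> F2' \<Longrightarrow> card (zeros \<phi>) = 0" "\<phi> \<in> F4' \<Longrightarrow> card (zeros \<phi>) = 0"
proof -
  note expand = factor_type_def list_all2_Cons2
  show "card (zeros \<phi>) = 4" if F: "\<phi> \<in> F4"
  proof -
    obtain a b c d where \<phi>: "\<phi> = a * (b * (c * d))"
      and f: "a \<in> forms 1" "irreducible a" "b \<in> forms 1" "irreducible b" "c \<in> forms 1"
          "irreducible c"
        "d \<in> forms 1" "irreducible d"
      and n: "\<not> proportional a b" "\<not> proportional a c" "\<not> proportional a d"
        "\<not> proportional b c" "\<not> proportional b d" "\<not> proportional c d"
      using F unfolding F4_def by (auto simp: expand simp del: One_nat_def)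
    show ?thesis
      using not_proportional_zeros[OF f(1-4) n(1)] not_proportional_zeros[OF f(1,2,5,6) n(2)]
        not_proportional_zeros[OF f(1,2,7,8) n(3)] not_proportional_zeros[OF f(3-6) n(4)]
        not_proportional_zeros[OF f(3,4,7,8) n(5)] not_proportional_zeros[OF f(5-8) n(6)]
      unfolding \<phi> zeros_mult
      by (subst card_Un_disjoint, simp, simp, blast)+
         (simp only: card_zeros_linear f)
  qed
  show "card (zeros \<phi>) = 2" if F: "\<phi> \<in> F2"
  proof -
    obtain a b c where \<phi>: "\<phi> = a * (b * c)"
      and f: "a \<in> forms 1" "irreducible a" "b \<in> forms 1" "irreducible b" "c \<in> forms 2"
          "irreducible c"
      and n: "\<not> proportional a b"
      using F unfolding F2_def by (auto simp: expand simp del: One_nat_def)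
    have "zeros c = {}" using irreducible_form_zeros[of c 1] f by (simp add: numeral_2_eq_2)
    then show ?thesis
      using not_proportional_zeros[OF f(1-4) n(1)]
      unfolding \<phi> zeros_mult by (simp add: card_Un_disjoint card_zeros_linear[OF f(1,2)]
          card_zeros_linear[OF f(3,4)])
  qed
  show "card (zeros \<phi>) = 1" if F: "\<phi> \<in> F1"
  proof -
    obtain a c where \<phi>: "\<phi> = a * c"
      and f: "a \<in> forms 1" "irreducible a" "c \<in> forms 3" "irreducible c"
      using F unfolding F1_def by (auto simp: expand simp del: One_nat_def)
    have "zeros c = {}" using irreducible_form_zeros[of c 2] f by (simp add: numeral_3_eq_3
        numeral_2_eq_2)
    then show ?thesis unfolding \<phi> zeros_mult by (simp add: card_zeros_linear[OF f(1,2)])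
  qed
  show "card (zeros \<phi>) = 0" if F: "\<phi> \<in> F2'"
  proof -
    have f: "\<phi> \<in> forms 4" "irreducible \<phi>"
      using F unfolding F2'_def by (auto simp: expand simp del: One_nat_def)
    have "zeros \<phi> = {}" using irreducible_form_zeros[of \<phi> 3] f by (simp add: eval_nat_numeral)
    then show ?thesis by simp
  qed
  show "card (zeros \<phi>) = 0" if F: "\<phi> \<in> F4'"
  proof -
    obtain a c where \<phi>: "\<phi> = a * c"
      and f: "a \<in> forms 2" "irreducible a" "c \<in> forms 2" "irreducible c"
      using F unfolding F4'_def by (auto simp: expand simp del: One_nat_def)
    have "zeros a = {}" "zeros c = {}"
      using irreducible_form_zeros[of _ 1] f by (simp_all add: numeral_2_eq_2)
    then show ?thesis unfolding \<phi> zeros_mult by simp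
  qed
qed

lemma not_proportional_lin: "P \<in> P1 \<Longrightarrow> Q \<in> P1 \<Longrightarrow> P \<noteq> Q \<Longrightarrow> c \<noteq> 0 \<Longrightarrow> \<not> proportional (lin P) (form_scale
    c (lin Q))"
  unfolding proportional_def
proof safe
  fix d assume *: "P \<in> P1" "Q \<in> P1" "P \<noteq> Q" "c \<noteq> 0" "d \<noteq> 0" "lin P = form_scale d (form_scale c
      (lin Q))"
  have "zeros (lin P) = zeros (form_scale d (form_scale c (lin Q)))" by (simp only: *(6))
  then show False using *(1-5) by simp
qed

lemma not_proportional_forms:
  "f \<in> forms m \<Longrightarrow> g \<in> forms n \<Longrightarrow> m \<noteq> n \<Longrightarrow> f \<noteq> 0 \<Longrightarrow> \<not> proportional f g"
  unfolding proportional_def using forms_unique_degree forms_scale by blast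

text \<open>A quartic with two proportional irreducible factors contains the square of a linear form
  or is a multiple of the square of a quadratic form; \<open>sq1\<close> and \<open>sq2\<close>
  exclude these.\<close>

lemma quartic_factor_types:
  fixes \<phi> :: "'k::{field,finite} poly poly"
  assumes \<phi>: "\<phi> \<in> forms 4" "\<phi> \<noteq> 0"
    and sq1: "\<And>P h. P \<in> P1 \<Longrightarrow> h \<in> forms 2 \<Longrightarrow> \<phi> \<noteq> lin P * lin P * h"
    and sq2: "\<And>c g. g \<in> forms 2 \<Longrightarrow> \<phi> \<noteq> form_scale c (g * g)"
  shows "\<phi> \<in> F4 \<union> F2 \<union> F1 \<union> F2' \<union> F4'"
proof (cases "zeros \<phi> = {}")
  case no: True
  show ?thesis
  proof (cases "irreducible \<phi>")
    case True
    then show ?thesis unfolding F2'_def factor_type_def using \<phi>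
      by (auto intro!: exI[of _ "[\<phi>]"])
  next
    case False
    then obtain a b g h where gh: "a + b = 4" "a \<noteq> 0" "b \<noteq> 0" "g \<in> forms a" "h \<in> forms b"
      "g \<noteq> 0" "h \<noteq> 0" "\<phi> = g * h"
      using \<phi> by (elim form_reducible_cases[of \<phi> 4]) auto
    then have z: "zeros g = {}" "zeros h = {}" using no by auto
    then have "a \<noteq> 1" "b \<noteq> 1" using form_1_zeros gh by blast+
    then have ab: "a = 2" "b = 2" using gh(1-3) by auto
    have irr: "irreducible g" "irreducible h"
      using irreducible_form_no_zeros[of _ 2] gh z unfolding ab by auto
    have "\<not> proportional g h"
    proof
      assume "proportional g h"
      then obtain c where "g = form_scale c h" unfolding proportional_def by blast
      then show False using sq2[of h c] gh(5,8) unfolding ab by (simp add: form_scale_mult_left)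
    qed
    then show ?thesis unfolding F4'_def factor_type_def using gh irr unfolding ab
      by (auto intro!: exI[of _ "[g, h]"])
  qed
next
  case False
  then obtain P where P: "P \<in> zeros \<phi>" by blast
  then have P1: "P \<in> P1" using zeros_subset by blast
  from P obtain g where g: "g \<in> forms 3" "g \<noteq> 0" "\<phi> = lin P * g"
    using form_root_factor[of \<phi> 3 P] \<phi> by (auto simp: eval_nat_numeral)
  have irrP: "irreducible (lin Q)" if "Q \<in> P1" for Q :: "'k \<times> 'k"
    by (rule irreducible_form_1[OF lin_form_in_forms lin_nonzero[OF that]])
  from g(1,2) show ?thesis
  proof (cases rule: cubic_form_cases)
    case 1
    then have "irreducible g" using irreducible_form_no_zeros[of g 3] g by simp
    then have "\<phi> \<in> F1" unfolding F1_def factor_type_def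
      using g P1 irrP[OF P1] not_proportional_forms[OF lin_form_in_forms g(1) _ lin_nonzero[OF P1]]
      by (intro CollectI exI[of _ "[lin P, g]"]) (auto simp del: One_nat_def)
    then show ?thesis by blast
  next
    case (2 Q h)
    have irr: "irreducible h" using irreducible_form_no_zeros[of h 2] 2 by simp
    have "P \<noteq> Q" using sq1[of P h] 2 P1 g(3) by (auto simp: mult.assoc)
    then have "\<not> proportional (lin P) (lin Q)" using not_proportional_lin[of P Q 1] P1 2 by simp
    then have "\<phi> \<in> F2" unfolding F2_def factor_type_def
      using g P1 2 irr irrP not_proportional_forms[OF lin_form_in_forms 2(2) _ lin_nonzero[OF P1]]
        not_proportional_forms[OF lin_form_in_forms 2(2) _ lin_nonzero[OF 2(1)]]
      by (intro CollectI exI[of _ "[lin P, lin Q, h]"]) (auto simp del: One_nat_def)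
    then show ?thesis by blast
  next
    case (3 c Q R S)
    have f2: "form_scale c (lin A * lin B) \<in> forms 2" for A B
      using forms_mult[OF lin_form_in_forms lin_form_in_forms]
      by (intro forms_scale) (simp add: numeral_2_eq_2)
    have \<phi>': "\<phi> = form_scale c (lin P * lin Q * lin R * lin S)"
      using g(3) 3(5) by (simp add: form_scale_mult_right mult_ac)
    have ne: "P \<noteq> Q" "P \<noteq> R" "P \<noteq> S" "Q \<noteq> R" "Q \<noteq> S" "R \<noteq> S"
      using sq1[OF P1 f2[of R S]] sq1[OF P1 f2[of Q S]] sq1[OF P1 f2[of Q R]]
        sq1[OF 3(2) f2[of P S]] sq1[OF 3(2) f2[of P R]] sq1[OF 3(3) f2[of P Q]]
      unfolding \<phi>' by (auto simp: form_scale_mult_right mult_ac)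
    have np: "\<not> proportional (lin A) (lin B)" if "A \<in> P1" "B \<in> P1" "A \<noteq> B" for A B :: "'k \<times> 'k"
      using not_proportional_lin[OF that, of 1] by simp
    have irrS: "irreducible (form_scale c (lin S))"
      by (rule irreducible_form_1[OF forms_scale[OF lin_form_in_forms]]) (use 3 in \<open>simp del:
          lin_form_eq_0_iff\<close>)
    have "\<phi> \<in> F4" unfolding F4_def factor_type_def
      using P1 3 irrP irrS ne np[OF P1] np[OF 3(2,3)] \<phi>' not_proportional_lin[OF P1 3(4) ne(3) 3(1)]
        not_proportional_lin[OF 3(2,4) ne(5) 3(1)] not_proportional_lin[OF 3(3,4) ne(6) 3(1)]
            forms_scale[OF lin_form_in_forms]
      \<comment> \<open>The constant is put into the last factor, because \<open>factor_type\<close>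
        consists of products without a leading scalar.\<close>
      by (intro CollectI exI[of _ "[lin P, lin Q, lin R, form_scale c (lin S)]"])
         (auto simp: form_scale_mult_right mult.assoc simp del: One_nat_def)
    then show ?thesis by blast
  qed
qed

text \<open>The numbers of zeros 4, 2, 1 and 0 separate the cases of \<open>eta\<close>, so their
  order does not matter, and by \<open>quartic_factor_types\<close> the value
  \<open>undefined\<close> does not occur.\<close>

lemma eta_eq_card_zeros:
  fixes \<phi> :: "'k::{field,finite} poly poly"
  assumes "\<phi> \<in> forms 4" "\<phi> \<noteq> 0"
    and "\<And>P h. P \<in> P1 \<Longrightarrow> h \<in> forms 2 \<Longrightarrow> \<phi> \<noteq> lin P * lin P * h"
    and "\<And>c g. g \<in> forms 2 \<Longrightarrow> \<phi> \<noteq> form_scale c (g * g)"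
  shows "eta \<phi> = card (zeros \<phi>)"
  using quartic_factor_types[OF assms] card_zeros_F[of \<phi>] unfolding eta_def by auto

section \<open>Pencils over the algebraic closure\<close>

text \<open>If \<open>f\<close> does not vanish at (1, 0), then f(X, 1) has a nonzero coefficient at
  X^m, hence positive degree and a root.\<close>

lemma zeros_nonempty:
  fixes f :: "'k::alg_closed_field poly poly"
  assumes f: "f \<in> forms m" and m: "m \<noteq> 0"
  shows "zeros f \<noteq> {}"
proof (cases "form_eval f 1 0 = 0")
  case True
  then show ?thesis by (auto simp: zeros_def P1_def)
next
  case False
  let ?p = "poly f [:1:]"
  have "coeff ?p m = (\<Sum>j\<le>m. if j = 0 then coeff (coeff f j) (m - j) else 0)"
    unfolding poly_form[OF f] coeff_sum using m by (intro sum.cong refl) (auto simp: pCons_one)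
  also have "\<dots> = form_eval f 1 0"
    unfolding form_eval_form[OF f] by (intro sum.cong refl) (auto simp: power_0_left)
  finally have "coeff ?p m \<noteq> 0" using False by simp
  then have "degree ?p > 0" using le_degree[of ?p m] m by simp
  then obtain x where "poly ?p x = 0" using alg_closed_imp_poly_has_root by blast
  then have "(x, 1) \<in> zeros f" by (simp add: zeros_def P1_def form_eval_def)
  then show ?thesis by blast
qed

section \<open>Cubic forms by coefficients and their Bezout determinant\<close>

definition cubic4 :: "'k::field \<Rightarrow> 'k \<Rightarrow> 'k \<Rightarrow> 'k \<Rightarrow> 'k poly poly" where
  "cubic4 c0 c1 c2 c3 = [:[:0, 0, 0, c3:], [:0, 0, c2:], [:0, c1:], [:c0:]:]"

lemma cubic4_forms [simp]: "cubic4 c0 c1 c2 c3 \<in> forms 3"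
  unfolding cubic4_def forms_def by (auto simp: coeff_pCons split: nat.splits)

lemma form_eval_cubic4 [simp]:
  "form_eval (cubic4 c0 c1 c2 c3) a b = c0 * b ^ 3 + c1 * a * b ^ 2 + c2 * a ^ 2 * b + c3 * a ^ 3"
  by (simp add: cubic4_def form_eval_def algebra_simps power2_eq_square power3_eq_cube)

lemma cubic4_eq_iff [simp]:
  "cubic4 c0 c1 c2 c3 = cubic4 d0 d1 d2 d3 \<longleftrightarrow> c0 = d0 \<and> c1 = d1 \<and> c2 = d2 \<and> c3 = d3"
  by (auto simp: cubic4_def)

lemma lin_form_product:
  "form_scale e (lin_form s t * lin_form s' t' * lin_form s'' t'') =
    cubic4 (- e * s * s' * s'') (e * (t * s' * s'' + s * t' * s'' + s * s' * t''))
      (- e * (s * t' * t'' + t * s' * t'' + t * t' * s'')) (e * t * t' * t'')"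
  by (simp add: cubic4_def lin_form_pCons form_scale_def algebra_simps)

lemma cubic_form_eq: "cubic_form u = cubic4 (u 0) (- 3 * u 1) (3 * u 2) (- u 3)"
  by (simp add: cubic_form_def cubic4_def form_scale_def var_X_def var_Y_def eval_nat_numeral)

definition bezout :: "'k::field \<Rightarrow> 'k \<Rightarrow> 'k \<Rightarrow> 'k \<Rightarrow> 'k \<Rightarrow> 'k \<Rightarrow> 'k"
  \<comment> \<open>the Bezout determinant of two binary cubics as a function of the \<open>2 \<times> 2\<close> minors of their
    coefficients\<close>
  where "bezout p01 p02 p03 p12 p13 p23 =
     p01 * ((p03 + p12) * p23 - p13 * p13) - p02 * (p02 * p23 - p13 * p03)
     + p03 * (p02 * p13 - (p03 + p12) * p03)"

text \<open>Over the closure the first cubic is \<open>e\<close> times three linear forms, and the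
  determinant is e^3 times the product of the values of the second cubic at the three zeros. If the
  first cubic is 0, any zero of the second one serves.\<close>

lemma bezout_zero_imp_common_zero:
  fixes c0 c1 c2 c3 d0 d1 d2 d3 :: "'k::alg_closed_field"
  assumes "bezout (c0 * d1 - c1 * d0) (c0 * d2 - c2 * d0) (c0 * d3 - c3 * d0)
    (c1 * d2 - c2 * d1) (c1 * d3 - c3 * d1) (c2 * d3 - c3 * d2) = 0"
  obtains P where "P \<in> P1" "ev (cubic4 c0 c1 c2 c3) P = 0" "ev (cubic4 d0 d1 d2 d3) P = 0"
proof (cases "cubic4 c0 c1 c2 c3 = 0")
  case True
  then show ?thesis using zeros_nonempty[of "cubic4 d0 d1 d2 d3" 3] that
    by (auto simp: zeros_def simp del: form_eval_cubic4)
next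
  case False
  from cubic4_forms False show ?thesis
  proof (cases rule: cubic_form_cases)
    case 1
    then show ?thesis using zeros_nonempty[of "cubic4 c0 c1 c2 c3" 3] by simp
  next
    case (2 P g)
    then show ?thesis using zeros_nonempty[of g 2] by simp
  next
    case (3 e P Q R)
    obtain s t s' t' s'' t'' where st: "P = (s, t)" "Q = (s', t')" "R = (s'', t'')"
      by (metis surj_pair)
    have c: "c0 = - e * s * s' * s''" "c1 = e * (t * s' * s'' + s * t' * s'' + s * s' * t'')"
      "c2 = - e * (s * t' * t'' + t * s' * t'' + t * t' * s'')" "c3 = e * t * t' * t''"
      using 3(5) by (simp_all add: st lin_form_product)
    let ?g = "cubic4 d0 d1 d2 d3"
    have "bezout (c0 * d1 - c1 * d0) (c0 * d2 - c2 * d0) (c0 * d3 - c3 * d0)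
        (c1 * d2 - c2 * d1) (c1 * d3 - c3 * d1) (c2 * d3 - c3 * d2) =
      e ^ 3 * (form_eval ?g s t * form_eval ?g s' t' * form_eval ?g s'' t'')"
      unfolding bezout_def c form_eval_cubic4 by Groebner_Basis.algebra
    then have "form_eval ?g s t = 0 \<or> form_eval ?g s' t' = 0 \<or> form_eval ?g s'' t'' = 0"
      using assms 3(1) by (simp del: form_eval_cubic4)
    then obtain S where S: "S \<in> {P, Q, R}" "ev ?g S = 0"
    proof -
      assume "form_eval ?g s t = 0 \<or> form_eval ?g s' t' = 0 \<or> form_eval ?g s'' t'' = 0"
      then have "ev ?g P = 0 \<or> ev ?g Q = 0 \<or> ev ?g R = 0" by (simp add: st del: form_eval_cubic4)
      then show ?thesis using that by blast
    qed
    have "S \<in> zeros (cubic4 c0 c1 c2 c3)" using S(1) 3 by auto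
    then show ?thesis using that[of S] S(2) by (simp add: zeros_def del: form_eval_cubic4)
  qed
qed

lemma quartic_J_eq:
  "quartic_J z = z 0 * z 2 * z 4 + 2 * z 1 * z 2 * z 3 - z 2 ^ 3 - z 0 * z 3 ^ 2 - z 1 ^ 2 * z 4"
  unfolding quartic_J_def det_3 by (simp add: algebra_simps power2_eq_square power3_eq_cube)

lemma cubic_form_cube: "cubic4 (s ^ 3) (- 3 * (s ^ 2 * t)) (3 * (s * t ^ 2)) (- (t ^ 3)) =
    form_scale (-1) (lin_form s t ^ 3)"
  unfolding power3_eq_cube[of "lin_form s t"] lin_form_product
  by (simp add: power2_eq_square power3_eq_cube algebra_simps)

text \<open>The hypotheses say that the minors of \<open>(u, v, \<nu>)\<close> in the columns \<open>i, j, k\<close> and \<open>i, j, l\<close>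
  vanish; by Cramer's rule \<open>\<nu>\<close> is then a combination of \<open>u\<close> and \<open>v\<close>.\<close>

lemma cramer:
  fixes u v w :: "nat \<Rightarrow> 'k::field"
  assumes p: "u i * v j - u j * v i \<noteq> 0"
    and k: "(u i * v j - u j * v i) * w k - (u i * v k - u k * v i) * w j + (u j * v k - u k * v
        j) * w i = 0"
    and l: "(u i * v j - u j * v i) * w l - (u i * v l - u l * v i) * w j + (u j * v l - u l * v
        j) * w i = 0"
  obtains \<alpha> \<beta> where "\<And>n. n \<in> {i, j, k, l} \<Longrightarrow> w n = \<alpha> * u n + \<beta> * v n"
proof -
  define d where "d = u i * v j - u j * v i"
  define \<alpha> where "\<alpha> = (w i * v j - w j * v i) / d"
  define \<beta> where "\<beta> = (w j * u i - w i * u j) / d"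
  have d: "d \<noteq> 0" using p by (simp add: d_def)
  have *: "w n = \<alpha> * u n + \<beta> * v n"
    if "(u i * v j - u j * v i) * w n - (u i * v n - u n * v i) * w j + (u j * v n - u n * v j) *
        w i = 0" for n
  proof -
    have "d * w n = (w i * v j - w j * v i) * u n + (w j * u i - w i * u j) * v n"
      using that unfolding d_def by (simp add: algebra_simps)
    also have "\<dots> = d * (\<alpha> * u n + \<beta> * v n)"
      using d by (simp add: \<alpha>_def \<beta>_def distrib_left)
    finally show ?thesis using d by simp
  qed
  have "w i = \<alpha> * u i + \<beta> * v i" "w j = \<alpha> * u j + \<beta> * v j"
    by (rule *, simp add: algebra_simps)+
  moreover have "w k = \<alpha> * u k + \<beta> * v k" "w l = \<alpha> * u l + \<beta> * v l"
    by (rule *[OF k], rule *[OF l])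
  ultimately show ?thesis using that by blast
qed

section \<open>Pluecker coordinates: lines with a common zero and lines meeting the twisted
  cubic\<close>

definition plucker_coords :: "(nat \<Rightarrow> 'k::field) \<Rightarrow> (nat \<Rightarrow> 'k) \<Rightarrow> (nat \<Rightarrow> 'k) \<Rightarrow> bool" where
  "plucker_coords u v z \<longleftrightarrow>
     u 0 * v 1 - u 1 * v 0 = z 0 \<and> u 0 * v 2 - u 2 * v 0 = 2 * z 1 \<and>
     u 0 * v 3 - u 3 * v 0 = 3 * (z 2 + z 5) \<and> u 1 * v 2 - u 2 * v 1 = z 2 - z 5 \<and>
     u 1 * v 3 - u 3 * v 1 = 2 * z 3 \<and> u 2 * v 3 - u 3 * v 2 = z 4"

text \<open>The left side is p01 p23 - p02 p13 + p03 p12 rewritten in \<open>z\<close>, which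
  vanishes for the minors of any two vectors.\<close>

lemma plucker_relation:
  assumes "plucker_coords u v z"
  shows "z 0 * z 4 - 4 * z 1 * z 3 + 3 * z 2 ^ 2 - 3 * z 5 ^ 2 = 0"
proof -
  have "z 0 * z 4 - 4 * z 1 * z 3 + 3 * z 2 ^ 2 - 3 * z 5 ^ 2 =
    z 0 * z 4 - (2 * z 1) * (2 * z 3) + (3 * (z 2 + z 5)) * (z 2 - z 5)" by Groebner_Basis.algebra
  also have "\<dots> = (u 0 * v 1 - u 1 * v 0) * (u 2 * v 3 - u 3 * v 2)
    - (u 0 * v 2 - u 2 * v 0) * (u 1 * v 3 - u 3 * v 1)
    + (u 0 * v 3 - u 3 * v 0) * (u 1 * v 2 - u 2 * v 1)"
    using assms unfolding plucker_coords_def by simp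
  also have "\<dots> = 0" by Groebner_Basis.algebra
  finally show ?thesis .
qed

text \<open>The Bezout determinant of the two spanning forms is 108 (z5^3 - J) plus a multiple of
  the Pluecker relation. The factors 3 and the signs in the minors come from the normalisation of
  \<open>cubic_form\<close>.\<close>

lemma common_zero_of_J:
  fixes u v z :: "nat \<Rightarrow> 'k::alg_closed_field"
  assumes p: "plucker_coords u v z" and J: "quartic_J z = z 5 ^ 3"
  obtains P where "P \<in> P1" "ev (cubic_form u) P = 0" "ev (cubic_form v) P = 0"
proof -
  have rel: "z 0 * z 4 - 4 * z 1 * z 3 + 3 * z 2 ^ 2 - 3 * z 5 ^ 2 = 0"
    by (rule plucker_relation[OF p])
  have "bezout (u 0 * (- 3 * v 1) - (- 3 * u 1) * v 0) (u 0 * (3 * v 2) - (3 * u 2) * v 0)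
    (u 0 * (- v 3) - (- u 3) * v 0) ((- 3 * u 1) * (3 * v 2) - (3 * u 2) * (- 3 * v 1))
    ((- 3 * u 1) * (- v 3) - (- u 3) * (- 3 * v 1)) ((3 * u 2) * (- v 3) - (- u 3) * (3 * v 2)) =
    bezout (- 3 * z 0) (3 * (2 * z 1)) (- (3 * (z 2 + z 5))) (- 9 * (z 2 - z 5)) (3 * (2 * z 3))
        (- 3 * z 4)"
  proof -
    have eqs: "u 0 * (- 3 * v 1) - (- 3 * u 1) * v 0 = - 3 * (u 0 * v 1 - u 1 * v 0)"
      "u 0 * (3 * v 2) - (3 * u 2) * v 0 = 3 * (u 0 * v 2 - u 2 * v 0)"
      "u 0 * (- v 3) - (- u 3) * v 0 = - (u 0 * v 3 - u 3 * v 0)"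
      "(- 3 * u 1) * (3 * v 2) - (3 * u 2) * (- 3 * v 1) = - 9 * (u 1 * v 2 - u 2 * v 1)"
      "(- 3 * u 1) * (- v 3) - (- u 3) * (- 3 * v 1) = 3 * (u 1 * v 3 - u 3 * v 1)"
      "(3 * u 2) * (- v 3) - (- u 3) * (3 * v 2) = - 3 * (u 2 * v 3 - u 3 * v 2)"
      by Groebner_Basis.algebra+
    show ?thesis unfolding eqs using p unfolding plucker_coords_def by simp
  qed
  also have "\<dots> = 108 * (z 5 ^ 3 - quartic_J z) +
      (z 0 * z 4 - 4 * z 1 * z 3 + 3 * z 2 ^ 2 - 3 * z 5 ^ 2) * (54 * z 5)"
    unfolding bezout_def quartic_J_eq by Groebner_Basis.algebra
  also have "\<dots> = 0" unfolding rel J by simp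
  finally show ?thesis using that unfolding cubic_form_eq
    by (rule bezout_zero_imp_common_zero)
qed

text \<open>The coordinates of minus the cube of \<open>lin P\<close>: the binomial coefficients
  built into \<open>cubic_form\<close> leave pure monomials.\<close>

definition cube_coords :: "'k::field \<times> 'k \<Rightarrow> nat \<Rightarrow> 'k" where
  "cube_coords P n = fst P ^ (3 - n) * snd P ^ n"

lemma cube_coords_simps:
  "cube_coords P 0 = fst P ^ 3" "cube_coords P 1 = fst P ^ 2 * snd P"
  "cube_coords P 2 = fst P * snd P ^ 2" "cube_coords P 3 = snd P ^ 3"
  by (simp_all add: cube_coords_def)

text \<open>A point \<open>\<nu>\<close> of the twisted cubic lies on the line iff two of the minors of \<open>(u, v, \<nu>)\<close>, which
  are binary cubics in the parameters of \<open>\<nu>\<close>, have a common zero. Their Bezout determinant is a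
  multiple of \<open>z\<^sub>5\<^sup>3 + J\<close> modulo the Pluecker relation; which minors to take depends on which
  Pluecker coordinate is nonzero.\<close>

lemma cube_of_J:
  fixes u v z :: "nat \<Rightarrow> 'k::alg_closed_field"
  assumes p: "plucker_coords u v z" and J: "quartic_J z = - (z 5 ^ 3)"
    and 2: "(2::'k) \<noteq> 0" and 3: "(3::'k) \<noteq> 0" and nz: "\<exists>i\<le>5. z i \<noteq> 0"
  obtains P \<alpha> \<beta> where "P \<in> P1" "\<And>n. n < 4 \<Longrightarrow> cube_coords P n = \<alpha> * u n + \<beta> * v n"
proof -
  note found = that
  have lt4: "n = 0 \<or> n = 1 \<or> n = 2 \<or> n = 3" if "n < 4" for n :: nat
    using that by arith
  have rel: "z 0 * z 4 - 4 * z 1 * z 3 + 3 * z 2 ^ 2 - 3 * z 5 ^ 2 = 0"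
    by (rule plucker_relation[OF p])
  have pl: "u 0 * v 1 - u 1 * v 0 = z 0" "u 0 * v 2 - u 2 * v 0 = 2 * z 1"
    "u 0 * v 3 - u 3 * v 0 = 3 * (z 2 + z 5)" "u 1 * v 2 - u 2 * v 1 = z 2 - z 5"
    "u 1 * v 3 - u 3 * v 1 = 2 * z 3" "u 2 * v 3 - u 3 * v 2 = z 4"
    "u 1 * v 0 - u 0 * v 1 = - (z 0)" "u 2 * v 0 - u 0 * v 2 = - (2 * z 1)"
    "u 3 * v 0 - u 0 * v 3 = - (3 * (z 2 + z 5))" "u 2 * v 1 - u 1 * v 2 = - (z 2 - z 5)"
    "u 3 * v 1 - u 1 * v 3 = - (2 * z 3)" "u 3 * v 2 - u 2 * v 3 = - (z 4)"
    using p unfolding plucker_coords_def by (simp_all add: algebra_simps)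
  \<comment> \<open>The two cubics below are the minors in the columns 0, 1, 2 and 0, 1, 3 as
    functions of \<open>P\<close>; the coefficient 0 belongs to the column left out. The cofactor of
    the Pluecker relation certifies the identity. The other five cases repeat this with another
    nonzero coordinate.\<close>
  have case1: ?thesis if nz: "z 0 \<noteq> 0"
  proof -
    have "bezout (0 * 0 - (z 0) * (z 0)) (0 * (- (3 * (z 2 + z 5))) - (- (2 * z 1)) * (z 0)) (0 *
        (2 * z 3) - (z 2 - z 5) * (z 0)) ((z 0) * (- (3 * (z 2 + z 5))) - (- (2 * z 1)) * 0) ((z
        0) * (2 * z 3) - (z 2 - z 5) * 0) ((- (2 * z 1)) * (2 * z 3) - (z 2 - z 5) * (- (3 * (z 2
        + z 5)))) =
        -4 * (z 0) ^ 3 * (z 5 ^ 3 + quartic_J z) + (z 0 * z 4 - 4 * z 1 * z 3 + 3 * z 2 ^ 2 - 3 *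
            z 5 ^ 2) *
        ( - 4 * z 0 ^ 2 * z 1 ^ 2 + 4 * z 0 ^ 3 * z 2)"
      unfolding bezout_def quartic_J_eq by Groebner_Basis.algebra
    also have "\<dots> = 0" unfolding rel J by simp
    finally obtain P where P: "P \<in> P1"
      "ev (cubic4 0 (z 0) (- (2 * z 1)) (z 2 - z 5)) P = 0"
      "ev (cubic4 (z 0) 0 (- (3 * (z 2 + z 5))) (2 * z 3)) P = 0"
      by (rule bezout_zero_imp_common_zero)
    show ?thesis
    proof (rule cramer[of u 0 v 1 "cube_coords P" 2 3])
      show "u 0 * v 1 - u 1 * v 0 \<noteq> 0" unfolding pl by (rule nz)
      show "(u 0 * v 1 - u 1 * v 0) * cube_coords P 2 - (u 0 * v 2 - u 2 * v 0) * cube_coords P 1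
          + (u 1 * v 2 - u 2 * v 1) * cube_coords P 0 = 0" unfolding pl cube_coords_simps using
          P(2) unfolding form_eval_cubic4 by (simp add: algebra_simps)
      show "(u 0 * v 1 - u 1 * v 0) * cube_coords P 3 - (u 0 * v 3 - u 3 * v 0) * cube_coords P 1
          + (u 1 * v 3 - u 3 * v 1) * cube_coords P 0 = 0" unfolding pl cube_coords_simps using
          P(3) unfolding form_eval_cubic4 by (simp add: algebra_simps)
    qed (rule found[OF P(1)], use lt4 in blast)
  qed
  have case2: ?thesis if nz: "2 * z 1 \<noteq> 0"
  proof -
    have "bezout (0 * (- (3 * (z 2 + z 5))) - (- (z 0)) * (2 * z 1)) (0 * 0 - (2 * z 1) * (2 * z
        1)) (0 * (z 4) - (- (z 2 - z 5)) * (2 * z 1)) ((- (z 0)) * 0 - (2 * z 1) * (- (3 * (z 2 +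
        z 5)))) ((- (z 0)) * (z 4) - (- (z 2 - z 5)) * (- (3 * (z 2 + z 5)))) ((2 * z 1) * (z 4) -
        (- (z 2 - z 5)) * 0) =
        4 * (2 * z 1) ^ 3 * (z 5 ^ 3 + quartic_J z) + (z 0 * z 4 - 4 * z 1 * z 3 + 3 * z 2 ^ 2 - 3
            * z 5 ^ 2) *
        ( - 6 * z 0 * z 1 * z 2 ^ 2 + 6 * z 0 * z 1 * z 5 ^ 2 - 8 * z 0 * z 1 ^ 2 * z 3 - 2 * z 0
            ^ 2 * z 1 * z 4 + 16 * z 1 ^ 3 * z 2)"
      unfolding bezout_def quartic_J_eq by Groebner_Basis.algebra
    also have "\<dots> = 0" unfolding rel J by simp
    finally obtain P where P: "P \<in> P1"
      "ev (cubic4 0 (- (z 0)) (2 * z 1) (- (z 2 - z 5))) P = 0"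
      "ev (cubic4 (2 * z 1) (- (3 * (z 2 + z 5))) 0 (z 4)) P = 0"
      by (rule bezout_zero_imp_common_zero)
    show ?thesis
    proof (rule cramer[of u 0 v 2 "cube_coords P" 1 3])
      show "u 0 * v 2 - u 2 * v 0 \<noteq> 0" unfolding pl by (rule nz)
      show "(u 0 * v 2 - u 2 * v 0) * cube_coords P 1 - (u 0 * v 1 - u 1 * v 0) * cube_coords P 2
          + (u 2 * v 1 - u 1 * v 2) * cube_coords P 0 = 0" unfolding pl cube_coords_simps using
          P(2) unfolding form_eval_cubic4 by (simp add: algebra_simps)
      show "(u 0 * v 2 - u 2 * v 0) * cube_coords P 3 - (u 0 * v 3 - u 3 * v 0) * cube_coords P 2
          + (u 2 * v 3 - u 3 * v 2) * cube_coords P 0 = 0" unfolding pl cube_coords_simps using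
          P(3) unfolding form_eval_cubic4 by (simp add: algebra_simps)
    qed (rule found[OF P(1)], use lt4 in blast)
  qed
  have case3: ?thesis if nz: "3 * (z 2 + z 5) \<noteq> 0"
  proof -
    have "bezout ((- (z 0)) * (3 * (z 2 + z 5)) - 0 * (- (2 * z 1))) ((- (z 0)) * 0 - (3 * (z 2 +
        z 5)) * (- (2 * z 1))) ((- (z 0)) * (- (z 4)) - (- (2 * z 3)) * (- (2 * z 1))) (0 * 0 - (3
        * (z 2 + z 5)) * (3 * (z 2 + z 5))) (0 * (- (z 4)) - (- (2 * z 3)) * (3 * (z 2 + z 5)))
        ((3 * (z 2 + z 5)) * (- (z 4)) - (- (2 * z 3)) * 0) =
        -4 * (3 * (z 2 + z 5)) ^ 3 * (z 5 ^ 3 + quartic_J z) + (z 0 * z 4 - 4 * z 1 * z 3 + 3 * z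
            2 ^ 2 - 3 * z 5 ^ 2) *
        (8 * z 0 * z 1 * z 3 * z 4 + 36 * z 0 * z 2 * z 4 * z 5 + 21 * z 0 * z 2 ^ 2 * z 4 + 15 *
            z 0 * z 4 * z 5 ^ 2 - z 0 ^ 2 * z 4 ^ 2 + 72 * z 1 * z 2 * z 3 * z 5 + 24 * z 1 * z 2
            ^ 2 * z 3 + 48 * z 1 * z 3 * z 5 ^ 2 - 16 * z 1 ^ 2 * z 3 ^ 2 - 108 * z 2 * z 5 ^ 3 -
            144 * z 2 ^ 2 * z 5 ^ 2 - 108 * z 2 ^ 3 * z 5 - 36 * z 2 ^ 4 - 36 * z 5 ^ 4)"
      unfolding bezout_def quartic_J_eq by Groebner_Basis.algebra
    also have "\<dots> = 0" unfolding rel J by simp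
    finally obtain P where P: "P \<in> P1"
      "ev (cubic4 (- (z 0)) 0 (3 * (z 2 + z 5)) (- (2 * z 3))) P = 0"
      "ev (cubic4 (- (2 * z 1)) (3 * (z 2 + z 5)) 0 (- (z 4))) P = 0"
      by (rule bezout_zero_imp_common_zero)
    show ?thesis
    proof (rule cramer[of u 0 v 3 "cube_coords P" 1 2])
      show "u 0 * v 3 - u 3 * v 0 \<noteq> 0" unfolding pl by (rule nz)
      show "(u 0 * v 3 - u 3 * v 0) * cube_coords P 1 - (u 0 * v 1 - u 1 * v 0) * cube_coords P 3
          + (u 3 * v 1 - u 1 * v 3) * cube_coords P 0 = 0" unfolding pl cube_coords_simps using
          P(2) unfolding form_eval_cubic4 by (simp add: algebra_simps)
      show "(u 0 * v 3 - u 3 * v 0) * cube_coords P 2 - (u 0 * v 2 - u 2 * v 0) * cube_coords P 3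
          + (u 3 * v 2 - u 2 * v 3) * cube_coords P 0 = 0" unfolding pl cube_coords_simps using
          P(3) unfolding form_eval_cubic4 by (simp add: algebra_simps)
    qed (rule found[OF P(1)], use lt4 in blast)
  qed
  have case4: ?thesis if nz: "z 2 - z 5 \<noteq> 0"
  proof -
    have "bezout (0 * (- (2 * z 3)) - (- (- (z 0))) * (z 2 - z 5)) (0 * (z 4) - (- (2 * z 1)) * (z
        2 - z 5)) (0 * 0 - (z 2 - z 5) * (z 2 - z 5)) ((- (- (z 0))) * (z 4) - (- (2 * z 1)) * (-
        (2 * z 3))) ((- (- (z 0))) * 0 - (z 2 - z 5) * (- (2 * z 3))) ((- (2 * z 1)) * 0 - (z 2 -
        z 5) * (z 4)) =
        -4 * (z 2 - z 5) ^ 3 * (z 5 ^ 3 + quartic_J z) + (z 0 * z 4 - 4 * z 1 * z 3 + 3 * z 2 ^ 2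
            - 3 * z 5 ^ 2) *
        ( - 2 * z 0 * z 2 * z 4 * z 5 + z 0 * z 2 ^ 2 * z 4 + z 0 * z 4 * z 5 ^ 2 - 2 * z 2 * z 5
            ^ 3 + 2 * z 2 ^ 3 * z 5 - z 2 ^ 4 + z 5 ^ 4)"
      unfolding bezout_def quartic_J_eq by Groebner_Basis.algebra
    also have "\<dots> = 0" unfolding rel J by simp
    finally obtain P where P: "P \<in> P1"
      "ev (cubic4 0 (- (- (z 0))) (- (2 * z 1)) (z 2 - z 5)) P = 0"
      "ev (cubic4 (z 2 - z 5) (- (2 * z 3)) (z 4) 0) P = 0"
      by (rule bezout_zero_imp_common_zero)
    show ?thesis
    proof (rule cramer[of u 1 v 2 "cube_coords P" 0 3])
      show "u 1 * v 2 - u 2 * v 1 \<noteq> 0" unfolding pl by (rule nz)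
      show "(u 1 * v 2 - u 2 * v 1) * cube_coords P 0 - (u 1 * v 0 - u 0 * v 1) * cube_coords P 2
          + (u 2 * v 0 - u 0 * v 2) * cube_coords P 1 = 0" unfolding pl cube_coords_simps using
          P(2) unfolding form_eval_cubic4 by (simp add: algebra_simps)
      show "(u 1 * v 2 - u 2 * v 1) * cube_coords P 3 - (u 1 * v 3 - u 3 * v 1) * cube_coords P 2
          + (u 2 * v 3 - u 3 * v 2) * cube_coords P 1 = 0" unfolding pl cube_coords_simps using
          P(3) unfolding form_eval_cubic4 by (simp add: algebra_simps)
    qed (rule found[OF P(1)], use lt4 in blast)
  qed
  have case5: ?thesis if nz: "2 * z 3 \<noteq> 0"
  proof -
    have "bezout ((- (- (z 0))) * (2 * z 3) - 0 * (- (z 2 - z 5))) ((- (- (z 0))) * (- (z 4)) - (-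
        (3 * (z 2 + z 5))) * (- (z 2 - z 5))) ((- (- (z 0))) * 0 - (2 * z 3) * (- (z 2 - z 5))) (0
        * (- (z 4)) - (- (3 * (z 2 + z 5))) * (2 * z 3)) (0 * 0 - (2 * z 3) * (2 * z 3)) ((- (3 *
        (z 2 + z 5))) * 0 - (2 * z 3) * (- (z 4))) =
        4 * (2 * z 3) ^ 3 * (z 5 ^ 3 + quartic_J z) + (z 0 * z 4 - 4 * z 1 * z 3 + 3 * z 2 ^ 2 - 3
            * z 5 ^ 2) *
        ( - 2 * z 0 * z 3 * z 4 ^ 2 - 8 * z 1 * z 3 ^ 2 * z 4 + 16 * z 2 * z 3 ^ 3 - 6 * z 2 ^ 2 *
            z 3 * z 4 + 6 * z 3 * z 4 * z 5 ^ 2)"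
      unfolding bezout_def quartic_J_eq by Groebner_Basis.algebra
    also have "\<dots> = 0" unfolding rel J by simp
    finally obtain P where P: "P \<in> P1"
      "ev (cubic4 (- (- (z 0))) 0 (- (3 * (z 2 + z 5))) (2 * z 3)) P = 0"
      "ev (cubic4 (- (z 2 - z 5)) (2 * z 3) (- (z 4)) 0) P = 0"
      by (rule bezout_zero_imp_common_zero)
    show ?thesis
    proof (rule cramer[of u 1 v 3 "cube_coords P" 0 2])
      show "u 1 * v 3 - u 3 * v 1 \<noteq> 0" unfolding pl by (rule nz)
      show "(u 1 * v 3 - u 3 * v 1) * cube_coords P 0 - (u 1 * v 0 - u 0 * v 1) * cube_coords P 3
          + (u 3 * v 0 - u 0 * v 3) * cube_coords P 1 = 0" unfolding pl cube_coords_simps using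
          P(2) unfolding form_eval_cubic4 by (simp add: algebra_simps)
      show "(u 1 * v 3 - u 3 * v 1) * cube_coords P 2 - (u 1 * v 2 - u 2 * v 1) * cube_coords P 3
          + (u 3 * v 2 - u 2 * v 3) * cube_coords P 1 = 0" unfolding pl cube_coords_simps using
          P(3) unfolding form_eval_cubic4 by (simp add: algebra_simps)
    qed (rule found[OF P(1)], use lt4 in blast)
  qed
  have case6: ?thesis if nz: "z 4 \<noteq> 0"
  proof -
    have "bezout ((- (- (2 * z 1))) * (- (2 * z 3)) - (- (3 * (z 2 + z 5))) * (- (- (z 2 - z 5))))
        ((- (- (2 * z 1))) * (z 4) - 0 * (- (- (z 2 - z 5)))) ((- (- (2 * z 1))) * 0 - (z 4) * (-
        (- (z 2 - z 5)))) ((- (3 * (z 2 + z 5))) * (z 4) - 0 * (- (2 * z 3))) ((- (3 * (z 2 + z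
        5))) * 0 - (z 4) * (- (2 * z 3))) (0 * 0 - (z 4) * (z 4)) =
        -4 * (z 4) ^ 3 * (z 5 ^ 3 + quartic_J z) + (z 0 * z 4 - 4 * z 1 * z 3 + 3 * z 2 ^ 2 - 3 *
            z 5 ^ 2) *
        (4 * z 2 * z 4 ^ 3 - 4 * z 3 ^ 2 * z 4 ^ 2)"
      unfolding bezout_def quartic_J_eq by Groebner_Basis.algebra
    also have "\<dots> = 0" unfolding rel J by simp
    finally obtain P where P: "P \<in> P1"
      "ev (cubic4 (- (- (2 * z 1))) (- (3 * (z 2 + z 5))) 0 (z 4)) P = 0"
      "ev (cubic4 (- (- (z 2 - z 5))) (- (2 * z 3)) (z 4) 0) P = 0"
      by (rule bezout_zero_imp_common_zero)
    show ?thesis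
    proof (rule cramer[of u 2 v 3 "cube_coords P" 0 1])
      show "u 2 * v 3 - u 3 * v 2 \<noteq> 0" unfolding pl by (rule nz)
      show "(u 2 * v 3 - u 3 * v 2) * cube_coords P 0 - (u 2 * v 0 - u 0 * v 2) * cube_coords P 3
          + (u 3 * v 0 - u 0 * v 3) * cube_coords P 2 = 0" unfolding pl cube_coords_simps using
          P(2) unfolding form_eval_cubic4 by (simp add: algebra_simps)
      show "(u 2 * v 3 - u 3 * v 2) * cube_coords P 1 - (u 2 * v 1 - u 1 * v 2) * cube_coords P 3
          + (u 3 * v 1 - u 1 * v 3) * cube_coords P 2 = 0" unfolding pl cube_coords_simps using
          P(3) unfolding form_eval_cubic4 by (simp add: algebra_simps)
    qed (rule found[OF P(1)], use lt4 in blast)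
  qed
  \<comment> \<open>If all six Pluecker coordinates vanished, so would \<open>z 2\<close> and
    \<open>z 5\<close>, being recovered from their sum and difference.\<close>
  have "z 0 \<noteq> 0 \<or> 2 * z 1 \<noteq> 0 \<or> 3 * (z 2 + z 5) \<noteq> 0 \<or> z 2 - z 5 \<noteq> 0 \<or> 2 * z 3 \<noteq> 0 \<or> z 4 \<noteq> 0"
  proof (rule ccontr)
    assume *: "\<not> ?thesis"
    then have "3 * (z 2 + z 5) = 0" and z25: "z 2 - z 5 = 0" by blast+
    then have "z 2 + z 5 = 0" using 3 by (simp only: mult_eq_0_iff) simp
    with z25 have "2 * z 2 = 0" "2 * z 5 = 0" by Groebner_Basis.algebra+
    then have "z 2 = 0" "z 5 = 0" using 2 by (simp_all only: mult_eq_0_iff) simp_all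
    then have "z 0 = 0 \<and> z 1 = 0 \<and> z 2 = 0 \<and> z 3 = 0 \<and> z 4 = 0 \<and> z 5 = 0" using * 2 by auto
    then show False using nz by (auto simp: numeral_eq_Suc le_Suc_eq)
  qed
  then show ?thesis using case1 case2 case3 case4 case5 case6 by blast
qed

section \<open>Pencils and extension of scalars\<close>

lemma cubic_form_forms [simp]: "cubic_form u \<in> forms 3"
  by (simp add: cubic_form_eq)

lemma form_scale_cubic4 [simp]: "form_scale e (cubic4 c0 c1 c2 c3) = cubic4 (e * c0) (e * c1) (e *
    c2) (e * c3)"
  by (simp add: cubic4_def form_scale_def)

lemma cubic4_add: "cubic4 c0 c1 c2 c3 + cubic4 d0 d1 d2 d3 = cubic4 (c0 + d0) (c1 + d1) (c2 + d2)
    (c3 + d3)"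
  by (simp add: cubic4_def)

lemma cubic_form_combination:
  "form_scale a (cubic_form u) + form_scale b (cubic_form v) = cubic_form (\<lambda>i. a * u i + b * v i)"
  by (simp add: cubic_form_eq cubic4_add algebra_simps)

lemma span_pair: "form.span {f, g} = {form_scale a f + form_scale b g | a b. True}"
proof -
  have "x \<in> form.span {f, g} \<longleftrightarrow> (\<exists>a b. x = form_scale a f + form_scale b g)" for x
    unfolding form.span_insert form.span_singleton by (auto simp: algebra_simps image_iff)
  then show ?thesis by blast
qed

lemma map_cubic_form: "map_poly (map_poly to_ac) (cubic_form u) = cubic_form (\<lambda>i. to_ac (u i))"
  by (simp add: cubic_form_eq cubic4_def map_poly_pCons)

lemma extend_scalars_pencil:
  "extend_scalars (form.span {cubic_form u, cubic_form v}) =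
    form.span {cubic_form (\<lambda>i. to_ac (u i)), cubic_form (\<lambda>i. to_ac (v i))}" (is "?L = ?R")
proof
  show "?L \<subseteq> ?R"
    unfolding extend_scalars_def
  proof (rule form.span_minimal, safe)
    fix f assume "f \<in> form.span {cubic_form u, cubic_form v}"
    then obtain a b where "f = cubic_form (\<lambda>i. a * u i + b * v i)"
      by (auto simp: span_pair cubic_form_combination)
    then have "map_poly (map_poly to_ac) f =
      form_scale (to_ac a) (cubic_form (\<lambda>i. to_ac (u i))) + form_scale (to_ac b) (cubic_form (\<lambda>i.
          to_ac (v i)))"
      by (simp add: map_cubic_form cubic_form_combination)
    then show "map_poly (map_poly to_ac) f \<in> ?R" unfolding span_pair by blast
  qed
  show "?R \<subseteq> ?L"
    unfolding extend_scalars_def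
    by (rule form.span_mono) (auto simp: map_cubic_form[symmetric] intro!: imageI form.span_base)
qed

lemma cubic_form_cube_coords: "cubic_form (cube_coords P) = form_scale (- 1) (lin P ^ 3)"
  unfolding cubic_form_cube[symmetric] by (simp add: cubic_form_eq cube_coords_def eval_nat_numeral)

lemma cube_in_twisted_cubic:
  assumes "P \<in> P1"
  shows "pg_point (lin P ^ 3) \<in> twisted_cubic"
proof -
  have "(fst P, snd P) \<noteq> (0, 0)" using P1_nonzero[OF assms] by simp
  then show ?thesis unfolding twisted_cubic_def by blast
qed

section \<open>What genericity excludes, over the closure and over the ground field\<close>

context
  fixes u v :: "nat \<Rightarrow> 'a::field"
  assumes gen: "generic_line (form.span {cubic_form u, cubic_form v})"
begin

lemma generic_no_common_zero_closure:
  assumes "P \<in> P1" "ev (cubic_form (\<lambda>i. to_ac (u i))) P = 0" "ev (cubic_form (\<lambda>i. to_ac (v i))) P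
      = 0"
  shows False
proof -
  let ?U = "cubic_form (\<lambda>i. to_ac (u i))" and ?V = "cubic_form (\<lambda>i. to_ac (v i))"
  have nz: "(fst P, snd P) \<noteq> (0, 0)" using P1_nonzero[OF assms(1)] by simp
  have "lin P dvd ?U" "lin P dvd ?V"
    by (rule lin_form_dvd[OF cubic_form_forms assms(2) nz], rule lin_form_dvd[OF cubic_form_forms
        assms(3) nz])
  moreover have "f \<in> forms 3" if "f = form_scale a ?U + form_scale b ?V" for f a b
    unfolding that by (intro forms_add forms_scale cubic_form_forms)
  ultimately have "extend_scalars (form.span {cubic_form u, cubic_form v}) \<subseteq> osculating_plane (fst
      P) (snd P)"
    unfolding extend_scalars_pencil unfolding span_pair osculating_plane_def
    by (auto simp: form_scale_def intro!: dvd_add dvd_smult)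
  then show False using gen nz unfolding generic_line_def by blast
qed

lemma generic_no_cube_closure:
  assumes P: "P \<in> P1" and "\<And>n. n < 4 \<Longrightarrow> cube_coords P n = \<alpha> * to_ac (u n) + \<beta> * to_ac (v n)"
  shows False
proof -
  let ?L = "form.span {cubic_form (\<lambda>i. to_ac (u i)), cubic_form (\<lambda>i. to_ac (v i))}"
  have "cubic_form (cube_coords P) = cubic_form (\<lambda>i. \<alpha> * to_ac (u i) + \<beta> * to_ac (v i))"
    using assms(2) by (simp add: cubic_form_eq)
  then have "form_scale (- 1) (lin P ^ 3) \<in> ?L"
    unfolding cubic_form_cube_coords span_pair cubic_form_combination[symmetric] by blast
  then have "form_scale (- 1) (form_scale (- 1) (lin P ^ 3)) \<in> ?L" by (rule form.span_scale)
  then have "lin P ^ 3 \<in> ?L - {0}" using lin_nonzero[OF P] by (simp del: lin_form_eq_0_iff)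
  then have "pg_point (lin P ^ 3) \<in> PG (extend_scalars (form.span {cubic_form u, cubic_form v}))"
    unfolding PG_def extend_scalars_pencil by blast
  moreover have "pg_point (lin P ^ 3) \<in> twisted_cubic"
    by (rule cube_in_twisted_cubic[OF P])
  ultimately show False using gen unfolding generic_line_def by blast
qed

lemma to_ac_P1: "P \<in> P1 \<Longrightarrow> (to_ac (fst P), to_ac (snd P)) \<in> P1"
  by (auto simp: P1_def)

lemma generic_no_common_zero:
  assumes "P \<in> P1" "ev (cubic_form u) P = 0" "ev (cubic_form v) P = 0"
  shows False
proof -
  have "form_eval (cubic_form (\<lambda>i. to_ac (w i))) (to_ac a) (to_ac b) = to_ac (form_eval
      (cubic_form w) a b)"
    for w :: "nat \<Rightarrow> 'a" and a b
    by (simp add: cubic_form_eq)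
  then show False using generic_no_common_zero_closure[OF to_ac_P1[OF assms(1)]] assms(2,3) by simp
qed

text \<open>A cube in the rational pencil stays a cube after extension of scalars, where it is a
  point of the twisted cubic.\<close>

lemma generic_no_cube:
  assumes P: "P \<in> P1" and c: "c \<noteq> 0" and mem: "form_scale c (lin P ^ 3) \<in> form.span {cubic_form u,
      cubic_form v}"
  shows False
proof -
  have "form_scale (- 1 / c) (form_scale c (lin P ^ 3)) \<in> form.span {cubic_form u, cubic_form v}"
    using mem by (rule form.span_scale)
  then have "cubic_form (cube_coords P) \<in> form.span {cubic_form u, cubic_form v}"
    using c by (simp add: cubic_form_cube_coords)
  then have "map_poly (map_poly to_ac) (cubic_form (cube_coords P)) \<in>
      extend_scalars (form.span {cubic_form u, cubic_form v})"
    unfolding extend_scalars_def by - (rule form.span_base, rule imageI)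
  then obtain \<alpha> \<beta> where "cubic_form (\<lambda>i. to_ac (cube_coords P i)) =
      cubic_form (\<lambda>i. \<alpha> * to_ac (u i) + \<beta> * to_ac (v i))"
    unfolding extend_scalars_pencil unfolding span_pair map_cubic_form cubic_form_combination by
        blast
  moreover have "to_ac (cube_coords P i) = cube_coords (to_ac (fst P), to_ac (snd P)) i" for i
    by (simp add: cube_coords_def)
  ultimately have "form_scale (-1) (lin (to_ac (fst P), to_ac (snd P)) ^ 3) \<in>
      form.span {cubic_form (\<lambda>i. to_ac (u i)), cubic_form (\<lambda>i. to_ac (v i))}"
    unfolding span_pair cubic_form_combination[symmetric] cubic_form_cube_coords[symmetric] by auto
  then have *: "form_scale (-1) (form_scale (-1) (lin (to_ac (fst P), to_ac (snd P)) ^ 3)) \<in>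
      form.span {cubic_form (\<lambda>i. to_ac (u i)), cubic_form (\<lambda>i. to_ac (v i))}"
    by (rule form.span_scale)
  have "lin (to_ac (fst P), to_ac (snd P)) \<noteq> 0" by (rule lin_nonzero[OF to_ac_P1[OF P]])
  then have "pg_point (lin (to_ac (fst P), to_ac (snd P)) ^ 3) \<in> PG (extend_scalars (form.span
      {cubic_form u, cubic_form v}))"
    using * unfolding PG_def extend_scalars_pencil by (simp del: lin_form_eq_0_iff)
  moreover have "pg_point (lin (to_ac (fst P), to_ac (snd P)) ^ 3) \<in> twisted_cubic"
    by (rule cube_in_twisted_cubic[OF to_ac_P1[OF P]])
  ultimately show False using gen unfolding generic_line_def by blast
qed

lemma generic_J:
  assumes p: "plucker_coords u v z" and 2: "(2::'a) \<noteq> 0" and 3: "(3::'a) \<noteq> 0"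
  shows "quartic_J z \<noteq> z 5 ^ 3" "quartic_J z \<noteq> - (z 5 ^ 3)"
proof -
  let ?z = "\<lambda>i. to_ac (z i)"
  have p': "plucker_coords (\<lambda>i. to_ac (u i)) (\<lambda>i. to_ac (v i)) ?z"
    using p unfolding plucker_coords_def
    by (simp flip: to_ac_mult to_ac_diff to_ac_add to_ac_numeral)
  have J: "quartic_J ?z = to_ac (quartic_J z)" by (simp add: quartic_J_eq)
  show *: "quartic_J z \<noteq> z 5 ^ 3"
  proof
    assume "quartic_J z = z 5 ^ 3"
    then have "quartic_J ?z = ?z 5 ^ 3" unfolding J by simp
    then show False by (rule common_zero_of_J[OF p']) (rule generic_no_common_zero_closure)
  qed
  show "quartic_J z \<noteq> - (z 5 ^ 3)"
  proof
    assume J': "quartic_J z = - (z 5 ^ 3)"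
    then have Jz: "quartic_J ?z = - (?z 5 ^ 3)" unfolding J by simp
    \<comment> \<open>The zero tuple would satisfy J = z5^3, which has just been excluded.\<close>
    have "\<exists>i\<le>5. ?z i \<noteq> 0"
    proof (rule ccontr)
      assume "\<not> ?thesis"
      then have "z 0 = 0 \<and> z 1 = 0 \<and> z 2 = 0 \<and> z 3 = 0 \<and> z 4 = 0 \<and> z 5 = 0" by simp
      then show False using * by (simp add: quartic_J_eq)
    qed
    moreover have "to_ac (2::'a) \<noteq> 0" "to_ac (3::'a) \<noteq> 0" using 2 3 by (simp_all del: to_ac_numeral)
    then have "(2::'a alg_closure) \<noteq> 0" "(3::'a alg_closure) \<noteq> 0" by simp_all
    ultimately show False
      using cube_of_J[OF p' Jz] generic_no_cube_closure by metis
  qed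
qed

end

section \<open>Quadratic and quartic forms\<close>

definition quad :: "'k::field \<Rightarrow> 'k \<Rightarrow> 'k \<Rightarrow> 'k poly poly" where
  "quad k0 k1 k2 = [:[:0, 0, k2:], [:0, k1:], [:k0:]:]"

lemma quad_forms [simp]: "quad k0 k1 k2 \<in> forms 2"
  unfolding quad_def forms_def by (auto simp: coeff_pCons split: nat.splits)

lemma quad_eq_iff [simp]: "quad k0 k1 k2 = quad l0 l1 l2 \<longleftrightarrow> k0 = l0 \<and> k1 = l1 \<and> k2 = l2"
  by (auto simp: quad_def)

lemma form_eval_quad [simp]: "form_eval (quad k0 k1 k2) a b = k0 * b ^ 2 + k1 * a * b + k2 * a ^ 2"
  by (simp add: quad_def form_eval_def algebra_simps power2_eq_square)

lemma form_scale_quad: "form_scale c (quad k0 k1 k2) = quad (c * k0) (c * k1) (c * k2)"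
  by (simp add: quad_def form_scale_def)

lemma lin_form_mult_lin_form:
  "lin_form s t * lin_form s' t' = quad (s * s') (- (s * t' + t * s')) (t * t')"
  by (simp add: quad_def lin_form_pCons algebra_simps)

lemma lin_form_mult_quad:
  "lin_form s t * quad k0 k1 k2 = cubic4 (- s * k0) (t * k0 - s * k1) (t * k1 - s * k2) (t * k2)"
  by (simp add: quad_def cubic4_def lin_form_pCons)

lemma forms_2_eq_quad:
  assumes "f \<in> forms 2"
  obtains k0 k1 k2 where "f = quad k0 k1 k2"
proof -
  have "f = quad (coeff (coeff f 2) 0) (coeff (coeff f 1) 1) (coeff (coeff f 0) 2)"
    by (rule poly_eqI, subst coeff_form[OF assms])
      (auto simp: quad_def coeff_pCons monom_0 monom_Suc numeral_2_eq_2 le_Suc_eq split: nat.splits)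
  then show ?thesis by (rule that)
qed

lemma quad_no_zeros:
  fixes k0 k1 k2 :: "'k::field"
  assumes 2: "(2::'k) \<noteq> 0" and no: "zeros (quad k0 k1 k2) = {}"
  shows "qchar (k1 ^ 2 - 4 * k0 * k2) = -1"
proof -
  have ev: "ev (quad k0 k1 k2) P \<noteq> 0" if "P \<in> P1" for P using no that by (auto simp: zeros_def)
  have k2: "k2 \<noteq> 0" using ev[of "(1, 0)"] by (auto simp: P1_def)
  have "\<not> (\<exists>d. k1 ^ 2 - 4 * k0 * k2 = d ^ 2)"
  proof
    assume "\<exists>d. k1 ^ 2 - 4 * k0 * k2 = d ^ 2"
    then obtain d where d: "k1 ^ 2 - 4 * k0 * k2 = d ^ 2" by blast
    define x where "x = (d - k1) / (2 * k2)"
    have x: "2 * k2 * x + k1 = d" using 2 k2 by (simp add: x_def)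
    have "4 * k2 * (k0 + k1 * x + k2 * x ^ 2) = (2 * k2 * x + k1) ^ 2 - (k1 ^ 2 - 4 * k0 * k2)"
      by Groebner_Basis.algebra
    also have "\<dots> = 0" unfolding x d by simp
    finally have "4 * k2 * (k0 + k1 * x + k2 * x ^ 2) = 0" .
    moreover have "(4::'k) \<noteq> 0" using 2 by (metis mult_2 mult_eq_0_iff numeral_Bit0)
    ultimately have "k0 + k1 * x + k2 * x ^ 2 = 0" using k2 by simp
    then show False using ev[of "(x, 1)"] by (auto simp: P1_def)
  qed
  moreover have "k1 ^ 2 - 4 * k0 * k2 \<noteq> 0" using calculation by (metis zero_power2)
  ultimately show ?thesis by (simp add: qchar_def)
qed

section \<open>Invariants of quartic forms with a repeated factor\<close>

lemma form_eval_quartic_form [simp]: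
  "form_eval (quartic_form z) a b =
     z 0 * b ^ 4 - 4 * z 1 * b ^ 3 * a + 6 * z 2 * b ^ 2 * a ^ 2 - 4 * z 3 * b * a ^ 3 + z 4 * a ^
         4"
  by (simp add: quartic_form_def)

lemma quartic_form_pCons:
  "quartic_form z = [:[:0, 0, 0, 0, z 4:], [:0, 0, 0, - 4 * z 3:], [:0, 0, 6 * z 2:], [:0, - 4 * z
      1:], [:z 0:]:]"
  by (simp add: quartic_form_def form_scale_def var_X_def var_Y_def eval_nat_numeral)

lemma quartic_form_forms: "quartic_form z \<in> forms 4"
  unfolding quartic_form_pCons forms_def by (auto simp: coeff_pCons split: nat.splits)

text \<open>For the plain coefficients of the quartic, without binomial factors, the invariants are
  36 I and 432 J. In the presence of a repeated factor they equal d^2 and - 2 d^3 for some d;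
  eliminating d gives I^3 = J^2, as 4 * 36^3 = 432^2.\<close>

lemma square_factor_invariants:
  fixes z :: "nat \<Rightarrow> 'k::field"
  assumes 2: "(2::'k) \<noteq> 0" and 3: "(3::'k) \<noteq> 0"
    and I: "12 * z 0 * z 4 - 48 * z 1 * z 3 + 36 * z 2 ^ 2 = d ^ 2"
    and J: "432 * quartic_J z = - 2 * d ^ 3"
  shows "quartic_I z ^ 3 = quartic_J z ^ 2"
proof -
  have I3: "3 * quartic_I z = z 0 * z 4 - 4 * z 1 * z 3 + 3 * z 2 ^ 2"
    using 3 by (simp add: quartic_I_def)
  have "36 * quartic_I z = 12 * (3 * quartic_I z)" by simp
  also have "\<dots> = d ^ 2" unfolding I3 I[symmetric] by Groebner_Basis.algebra
  finally have "36 * quartic_I z = d ^ 2" .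
  then have "(36 * quartic_I z) ^ 3 * 4 = (432 * quartic_J z) ^ 2"
    unfolding J by Groebner_Basis.algebra
  then have "2 ^ 8 * (3 ^ 6 * (quartic_I z ^ 3 - quartic_J z ^ 2)) = 0"
    by Groebner_Basis.algebra
  then show ?thesis using 2 3 by (simp only: mult_eq_0_iff power_eq_0_iff) simp
qed

lemma quartic_form_not_square_factor:
  fixes z :: "nat \<Rightarrow> 'k::field"
  assumes 2: "(2::'k) \<noteq> 0" and 3: "(3::'k) \<noteq> 0" and ne: "quartic_I z ^ 3 \<noteq> quartic_J z ^ 2"
    and h: "h \<in> forms 2"
  shows "quartic_form z \<noteq> lin P * lin P * h"
proof
  assume eq: "quartic_form z = lin P * lin P * h"
  obtain k0 k1 k2 where k: "h = quad k0 k1 k2" using forms_2_eq_quad[OF h] .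
  obtain s t where st: "P = (s, t)" by (cases P)
  have z: "z 0 = s ^ 2 * k0" "- 4 * z 1 = s ^ 2 * k1 - 2 * s * t * k0"
    "6 * z 2 = s ^ 2 * k2 - 2 * s * t * k1 + t ^ 2 * k0" "- 4 * z 3 = t ^ 2 * k1 - 2 * s * t * k2"
    "z 4 = t ^ 2 * k2"
    using eq unfolding k st fst_conv snd_conv lin_form_mult_lin_form quartic_form_pCons
    by (simp_all add: quad_def algebra_simps power2_eq_square)
  \<comment> \<open>The value of the cofactor \<open>h\<close> at the double zero.\<close>
  let ?d = "k0 * t ^ 2 + k1 * s * t + k2 * s ^ 2"
  have "12 * z 0 * z 4 - 48 * z 1 * z 3 + 36 * z 2 ^ 2 = 12 * z 0 * z 4 - 3 * (- 4 * z 1) * (- 4 *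
      z 3) + (6 * z 2) ^ 2"
    by Groebner_Basis.algebra
  also have "\<dots> = ?d ^ 2" unfolding z by Groebner_Basis.algebra
  finally have I: "12 * z 0 * z 4 - 48 * z 1 * z 3 + 36 * z 2 ^ 2 = ?d ^ 2" .
  have "432 * quartic_J z = 72 * z 0 * (6 * z 2) * z 4 + 9 * (- 4 * z 1) * (6 * z 2) * (- 4 * z 3)
      - 2 * (6 * z 2) ^ 3
    - 27 * z 0 * (- 4 * z 3) ^ 2 - 27 * (- 4 * z 1) ^ 2 * z 4"
    unfolding quartic_J_eq by Groebner_Basis.algebra
  also have "\<dots> = - 2 * ?d ^ 3" unfolding z by Groebner_Basis.algebra
  finally show False using square_factor_invariants[OF 2 3 I] ne by blast
qed

lemma quartic_form_not_square:
  fixes z :: "nat \<Rightarrow> 'k::field"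
  assumes 2: "(2::'k) \<noteq> 0" and 3: "(3::'k) \<noteq> 0" and ne: "quartic_I z ^ 3 \<noteq> quartic_J z ^ 2"
    and h: "h \<in> forms 2"
  shows "quartic_form z \<noteq> form_scale c (h * h)"
proof
  assume eq: "quartic_form z = form_scale c (h * h)"
  obtain k0 k1 k2 where k: "h = quad k0 k1 k2" using forms_2_eq_quad[OF h] .
  have z: "z 0 = c * k0 ^ 2" "- 4 * z 1 = c * (2 * k0 * k1)"
    "6 * z 2 = c * (k1 ^ 2 + 2 * k0 * k2)" "- 4 * z 3 = c * (2 * k1 * k2)" "z 4 = c * k2 ^ 2"
    using eq unfolding k quartic_form_pCons
    by (simp_all add: quad_def form_scale_def algebra_simps power2_eq_square)
  \<comment> \<open>Here d is \<open>c\<close> times the discriminant of \<open>h\<close>.\<close>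
  let ?d = "c * (k1 ^ 2 - 4 * k0 * k2)"
  have "12 * z 0 * z 4 - 48 * z 1 * z 3 + 36 * z 2 ^ 2 = 12 * z 0 * z 4 - 3 * (- 4 * z 1) * (- 4 *
      z 3) + (6 * z 2) ^ 2"
    by Groebner_Basis.algebra
  also have "\<dots> = ?d ^ 2" unfolding z by Groebner_Basis.algebra
  finally have I: "12 * z 0 * z 4 - 48 * z 1 * z 3 + 36 * z 2 ^ 2 = ?d ^ 2" .
  have "432 * quartic_J z = 72 * z 0 * (6 * z 2) * z 4 + 9 * (- 4 * z 1) * (6 * z 2) * (- 4 * z 3)
      - 2 * (6 * z 2) ^ 3
    - 27 * z 0 * (- 4 * z 3) ^ 2 - 27 * (- 4 * z 1) ^ 2 * z 4"
    unfolding quartic_J_eq by Groebner_Basis.algebra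
  also have "\<dots> = - 2 * ?d ^ 3" unfolding z by Groebner_Basis.algebra
  finally show False using square_factor_invariants[OF 2 3 I] ne by blast
qed

lemma neq_0_of_CHAR:
  assumes "CHAR('a::{field,finite}) \<noteq> p" "prime p"
  shows "of_nat p \<noteq> (0::'a)"
proof
  assume "of_nat p = (0::'a)"
  then have "CHAR('a) dvd p" by (simp add: of_nat_eq_0_iff_char_dvd)
  moreover have "CHAR('a) \<noteq> 1" by simp
  ultimately show False using assms prime_nat_iff by blast
qed

section \<open>Counting on a generic pencil\<close>

locale generic_pencil =
  fixes u v z :: "nat \<Rightarrow> 'a::{field,finite}"
  assumes two: "(2::'a) \<noteq> 0" and three: "(3::'a) \<noteq> 0"
    and plucker: "plucker_coords u v z"
    and generic: "generic_line (form.span {cubic_form u, cubic_form v})"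
begin

abbreviation "U \<equiv> cubic_form u"
abbreviation "V \<equiv> cubic_form v"
abbreviation "L \<equiv> form.span {U, V}"
abbreviation "\<phi> \<equiv> quartic_form z"

lemma four: "(4::'a) \<noteq> 0"
  using two by (metis mult_2 mult_eq_0_iff numeral_Bit0)

lemma rel: "z 0 * z 4 - 4 * z 1 * z 3 + 3 * z 2 ^ 2 - 3 * z 5 ^ 2 = 0"
  by (rule plucker_relation[OF plucker])

lemmas J_ne = generic_J[OF generic plucker two three]

lemma I_eq: "quartic_I z = z 5 ^ 2"
proof -
  have "quartic_I z - z 5 ^ 2 = (z 0 * z 4 - 4 * z 1 * z 3 + 3 * z 2 ^ 2 - 3 * z 5 ^ 2) / 3"
    using three by (simp add: quartic_I_def diff_divide_distrib)
  then show ?thesis unfolding rel by simp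
qed

lemma disc_ne: "quartic_I z ^ 3 \<noteq> quartic_J z ^ 2"
proof
  assume "quartic_I z ^ 3 = quartic_J z ^ 2"
  then have "(quartic_J z) ^ 2 = (z 5 ^ 3) ^ 2" unfolding I_eq by (simp flip: power_mult)
  then show False using J_ne unfolding power2_eq_iff by blast
qed

text \<open>A linear relation would annihilate all minors, so \<open>z\<close> would vanish,
  contradicting \<open>J_ne\<close>.\<close>

lemma independent:
  assumes "form_scale a U + form_scale b V = 0"
  shows "a = 0 \<and> b = 0"
proof (rule ccontr)
  assume ab: "\<not> ?thesis"
  have uv: "a * u i + b * v i = 0" if "i < 4" for i
  proof -
    have "i = 0 \<or> i = 1 \<or> i = 2 \<or> i = 3" using that by arith
    moreover have "w 0 = 0 \<and> 3 * w 1 = 0 \<and> 3 * w 2 = 0 \<and> w 3 = 0" if "cubic_form w = 0" for w ::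
        "nat \<Rightarrow> 'a"
      using that by (auto simp: cubic_form_eq cubic4_def)
    from this[OF assms[unfolded cubic_form_combination]]
    have "a * u 0 + b * v 0 = 0" "a * u 1 + b * v 1 = 0" "a * u 2 + b * v 2 = 0" "a * u 3 + b * v
        3 = 0"
      using three by (simp_all only: mult_eq_0_iff simp_thms)
    ultimately show ?thesis by blast
  qed
  have p: "u i * v j - u j * v i = 0" if "i < 4" "j < 4" for i j
  proof -
    have "a * (u i * v j - u j * v i) = (a * u i + b * v i) * v j - (a * u j + b * v j) * v i"
      "b * (u i * v j - u j * v i) = u i * (a * u j + b * v j) - u j * (a * u i + b * v i)"
      by (simp_all add: algebra_simps)
    then show ?thesis using ab uv[OF that(1)] uv[OF that(2)] by auto
  qed
  have zz: "z 0 = 0" "2 * z 1 = 0" "3 * (z 2 + z 5) = 0" "z 2 - z 5 = 0" "2 * z 3 = 0" "z 4 = 0"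
    using plucker p[of 0 1] p[of 0 2] p[of 0 3] p[of 1 2] p[of 1 3] p[of 2 3]
    unfolding plucker_coords_def by simp_all
  then have "z 2 + z 5 = 0" using three by (simp only: mult_eq_0_iff) simp
  then have "2 * z 5 = 0" "2 * z 2 = 0" using zz(4) by Groebner_Basis.algebra+
  then have "z 0 = 0 \<and> z 1 = 0 \<and> z 2 = 0 \<and> z 3 = 0 \<and> z 4 = 0 \<and> z 5 = 0"
    using two zz by (simp only: mult_eq_0_iff) simp
  then show False using J_ne by (simp add: quartic_J_eq)
qed

lemma \<phi>_ne: "\<phi> \<noteq> 0"
proof
  assume "\<phi> = 0"
  then have "z 0 = 0" "4 * z 1 = 0" "6 * z 2 = 0" "4 * z 3 = 0" "z 4 = 0"
    by (auto simp: quartic_form_pCons)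
  moreover have "(6::'a) = 2 * 3" by simp
  ultimately have "z 0 = 0 \<and> z 1 = 0 \<and> z 2 = 0 \<and> z 3 = 0 \<and> z 4 = 0"
    using two three four by (simp only: mult_eq_0_iff) simp
  then show False using disc_ne by (simp add: quartic_I_def quartic_J_eq)
qed

lemma eta_\<phi>: "eta \<phi> = card (zeros \<phi>)"
  using quartic_form_forms \<phi>_ne quartic_form_not_square_factor[OF two three disc_ne]
    quartic_form_not_square[OF two three disc_ne]
  by (intro eta_eq_card_zeros)

lemma L_forms: "f \<in> L \<Longrightarrow> f \<in> forms 3"
  unfolding span_pair by (auto intro!: forms_add forms_scale)

section \<open>The form of the pencil with a prescribed zero, and its cofactor\<close>

definition member :: "'a \<times> 'a \<Rightarrow> 'a poly poly" where
  "member P = form_scale (ev V P) U + form_scale (- ev U P) V"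

lemma member_L: "member P \<in> L"
  unfolding member_def span_pair by blast

lemma member_ne: "P \<in> P1 \<Longrightarrow> member P \<noteq> 0"
  using independent[of "ev V P" "- ev U P"] generic_no_common_zero[OF generic, of P]
  unfolding member_def by auto

lemma ev_member: "ev (member P) P = 0"
  unfolding member_def by simp

text \<open>Vanishing at \<open>P\<close> is one linear condition on the two coefficients. It is
  nontrivial because the pencil has no common zero, so its solutions are proportional.\<close>

lemma eq_member:
  assumes P: "P \<in> P1" and f: "f \<in> L" "f \<noteq> 0" "ev f P = 0"
  obtains k where "k \<noteq> 0" "f = form_scale k (member P)"
proof -
  obtain a b where ab: "f = form_scale a U + form_scale b V"
    using f(1) unfolding span_pair by blast
  have e: "a * ev U P + b * ev V P = 0" using f(3) unfolding ab by simp
  have "\<exists>k. a = k * ev V P \<and> b = k * - ev U P"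
  proof (cases "ev V P = 0")
    case True
    then have U: "ev U P \<noteq> 0" using generic_no_common_zero[OF generic P] by blast
    then have "a = 0" using e True by simp
    then show ?thesis using True U by (intro exI[of _ "- b / ev U P"]) simp
  next
    case False
    have "b * ev V P = - (a * ev U P)" using e by (simp add: eq_neg_iff_add_eq_0 add.commute)
    then have "b = - (a * ev U P) / ev V P" by (rule eq_divide_imp[OF False])
    then show ?thesis using False by (intro exI[of _ "a / ev V P"]) simp
  qed
  then obtain k where k: "a = k * ev V P" "b = k * - ev U P" by blast
  have "f = form_scale k (member P)"
    unfolding ab k member_def form.scale_right_distrib form_scale_scale ..
  then show ?thesis using that f(2) by (cases "k = 0") auto
qed

text \<open>The coefficients of \<open>\<Delta>\<close> are chosen so that \<open>9 \<Delta>\<close> is the discriminant of the quotient of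
  \<open>member P\<close> by \<open>lin P\<close>, with fractions removed by means of \<open>z\<^sub>5\<^sup>2 = I\<close>.\<close>

definition Q0 where "Q0 = 4 * (z 3 ^ 2 - z 2 * z 4 - z 4 * z 5)"
definition Q1 where "Q1 = 2 * (z 1 * z 4 - z 2 * z 3) + 4 * z 3 * z 5"
definition Q2 where "Q2 = - 4 * z 1 * z 3 + 4 * z 2 ^ 2 - 4 * z 2 * z 5 - 2 * z 5 ^ 2"
definition Q3 where "Q3 = 2 * (z 0 * z 3 - z 1 * z 2) + 4 * z 1 * z 5"
definition Q4 where "Q4 = 4 * (z 1 ^ 2 - z 0 * z 2 - z 0 * z 5)"

lemmas Q_defs = Q0_def Q1_def Q2_def Q3_def Q4_def

definition \<Delta> :: "'a \<times> 'a \<Rightarrow> 'a" where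
  "\<Delta> P = biquartic Q0 Q1 Q2 Q3 Q4 (fst P) (snd P)"

lemma pl: 
  "u 0 * v 1 - u 1 * v 0 = z 0" "u 0 * v 2 - u 2 * v 0 = 2 * z 1"
  "u 0 * v 3 - u 3 * v 0 = 3 * (z 2 + z 5)" "u 1 * v 2 - u 2 * v 1 = z 2 - z 5"
  "u 1 * v 3 - u 3 * v 1 = 2 * z 3" "u 2 * v 3 - u 3 * v 2 = z 4"
  using plucker unfolding plucker_coords_def by simp_all

lemma member_factor:
  assumes "P \<in> P1"
  obtains k0 k1 k2 where "member P = lin P * quad k0 k1 k2"
    "k1 ^ 2 - 4 * k0 * k2 = 3 ^ 2 * \<Delta> P" "ev (quad k0 k1 k2) P = 3 * ev \<phi> P"
proof -
  have cases: "P = (1, 0) \<or> (\<exists>x. P = (x, 1))" using assms by (simp add: P1_cases)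
  have m: "member P = cubic4 (ev V P * u 0 - ev U P * v 0) (- 3 * (ev V P * u 1 - ev U P * v 1))
      (3 * (ev V P * u 2 - ev U P * v 2)) (- (ev V P * u 3 - ev U P * v 3))"
  proof -
    have "form_scale a U + form_scale (- b) V = cubic4 (a * u 0 - b * v 0) (- 3 * (a * u 1 - b * v
        1))
        (3 * (a * u 2 - b * v 2)) (- (a * u 3 - b * v 3))" for a b
      by (simp add: cubic_form_eq cubic4_add algebra_simps)
    then show ?thesis unfolding member_def .
  qed
  show ?thesis
  proof (cases "P = (1, 0)")
    case True
    have e: "ev V P = - v 3" "ev U P = - u 3" by (simp_all add: True cubic_form_eq)
    have c: "- v 3 * u 0 - - u 3 * v 0 = - (3 * (z 2 + z 5))"
      "- 3 * (- v 3 * u 1 - - u 3 * v 1) = 6 * z 3"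
      "3 * (- v 3 * u 2 - - u 3 * v 2) = - 3 * z 4" "- (- v 3 * u 3 - - u 3 * v 3) = 0"
    proof -
      have "- v 3 * u 0 - - u 3 * v 0 = - (u 0 * v 3 - u 3 * v 0)"
        "- 3 * (- v 3 * u 1 - - u 3 * v 1) = 3 * (u 1 * v 3 - u 3 * v 1)"
        "3 * (- v 3 * u 2 - - u 3 * v 2) = - 3 * (u 2 * v 3 - u 3 * v 2)" by Groebner_Basis.algebra+
      then show "- v 3 * u 0 - - u 3 * v 0 = - (3 * (z 2 + z 5))"
        "- 3 * (- v 3 * u 1 - - u 3 * v 1) = 6 * z 3"
        "3 * (- v 3 * u 2 - - u 3 * v 2) = - 3 * z 4" unfolding pl by simp_all
    qed simp
    have "member P = cubic4 (- (3 * (z 2 + z 5))) (6 * z 3) (- 3 * z 4) 0"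
      unfolding m e by (simp only: c)
    also have "\<dots> = lin P * quad (3 * (z 2 + z 5)) (- 6 * z 3) (3 * z 4)"
      by (simp add: True lin_form_mult_quad)
    finally have "member P = lin P * quad (3 * (z 2 + z 5)) (- 6 * z 3) (3 * z 4)" .
    moreover have "(- 6 * z 3) ^ 2 - 4 * (3 * (z 2 + z 5)) * (3 * z 4) = 3 ^ 2 * \<Delta> P"
      unfolding \<Delta>_def True biquartic_def Q_defs by (simp add: algebra_simps power2_eq_square)
    moreover have "ev (quad (3 * (z 2 + z 5)) (- 6 * z 3) (3 * z 4)) P = 3 * ev \<phi> P"
      by (simp add: True)
    ultimately show ?thesis by (rule that)
  next
    case False
    then obtain x where P: "P = (x, 1)" using cases by blast
    have e: "ev V P = v 0 - 3 * v 1 * x + 3 * v 2 * x ^ 2 - v 3 * x ^ 3"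
      "ev U P = u 0 - 3 * u 1 * x + 3 * u 2 * x ^ 2 - u 3 * x ^ 3" by (simp_all add: P
          cubic_form_eq)
    define c0 c1 c2 c3 where c_def: "c0 = ev V P * u 0 - ev U P * v 0" "c1 = - 3 * (ev V P * u 1 -
        ev U P * v 1)"
      "c2 = 3 * (ev V P * u 2 - ev U P * v 2)" "c3 = - (ev V P * u 3 - ev U P * v 3)"
    have "c1 = 3 * (u 0 * v 1 - u 1 * v 0) - 9 * (u 1 * v 2 - u 2 * v 1) * x ^ 2 + 3 * (u 1 * v 3
        - u 3 * v 1) * x ^ 3"
      unfolding c_def e by Groebner_Basis.algebra
    then have c1: "c1 = 3 * z 0 - 9 * (z 2 - z 5) * x ^ 2 + 3 * (2 * z 3) * x ^ 3" unfolding pl .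
    have "c2 = - 3 * (u 0 * v 2 - u 2 * v 0) + 9 * (u 1 * v 2 - u 2 * v 1) * x - 3 * (u 2 * v 3 -
        u 3 * v 2) * x ^ 3"
      unfolding c_def e by Groebner_Basis.algebra
    then have c2: "c2 = - 3 * (2 * z 1) + 9 * (z 2 - z 5) * x - 3 * z 4 * x ^ 3" unfolding pl .
    have "c3 = (u 0 * v 3 - u 3 * v 0) - 3 * (u 1 * v 3 - u 3 * v 1) * x + 3 * (u 2 * v 3 - u 3 *
        v 2) * x ^ 2"
      unfolding c_def e by Groebner_Basis.algebra
    then have c3: "c3 = 3 * (z 2 + z 5) - 3 * (2 * z 3) * x + 3 * z 4 * x ^ 2" unfolding pl .
    \<comment> \<open>The vanishing at x determines the last coefficient, so Horner's scheme for the
      division by X - x Y has remainder 0 and the quotient \<open>?k0\<close>, \<open>?k1\<close>,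
      \<open>?k2\<close>.\<close>
    have c0: "c0 = - x * (c1 + c2 * x + c3 * x ^ 2)"
      unfolding c_def e by Groebner_Basis.algebra
    let ?k0 = "c1 + c2 * x + c3 * x ^ 2" and ?k1 = "c2 + c3 * x" and ?k2 = "c3"
    have "member P = cubic4 c0 c1 c2 c3" unfolding m c_def ..
    also have "\<dots> = lin P * quad ?k0 ?k1 ?k2"
      unfolding P fst_conv snd_conv lin_form_mult_quad cubic4_eq_iff c0
      by (intro conjI) (simp_all add: algebra_simps power2_eq_square)
    finally have "member P = lin P * quad ?k0 ?k1 ?k2" .
    moreover have "?k1 ^ 2 - 4 * ?k0 * ?k2 = 3 ^ 2 * \<Delta> P"
    proof -
      \<comment> \<open>The discriminant agrees with 9 \<Delta> only modulo the Pluecker relation,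
        through the coefficient \<open>Q2\<close>.\<close>
      have "?k1 ^ 2 - 4 * ?k0 * ?k2 = 3 ^ 2 * \<Delta> P
        - 36 * x ^ 2 * (z 0 * z 4 - 4 * z 1 * z 3 + 3 * z 2 ^ 2 - 3 * z 5 ^ 2)"
        unfolding \<Delta>_def P fst_conv snd_conv biquartic_1 Q_defs c1 c2 c3 by Groebner_Basis.algebra
      then show ?thesis unfolding rel by simp
    qed
    moreover have "ev (quad ?k0 ?k1 ?k2) P = 3 * ev \<phi> P"
    proof -
      have "ev (quad ?k0 ?k1 ?k2) P = ?k0 + ?k1 * x + ?k2 * x ^ 2" by (simp add: P)
      also have "\<dots> = 3 * (z 0 - 4 * z 1 * x + 6 * z 2 * x ^ 2 - 4 * z 3 * x ^ 3 + z 4 * x ^ 4)"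
        unfolding c1 c2 c3 by Groebner_Basis.algebra
      also have "\<dots> = 3 * ev \<phi> P" by (simp add: P)
      finally show ?thesis .
    qed
    ultimately show ?thesis by (rule that)
  qed
qed

text \<open>\<open>f\<close> is a multiple of \<open>member P\<close>, so its cofactor has the
  discriminant of that of \<open>member P\<close> up to a nonzero square, and the same value at
  \<open>P\<close> up to a nonzero factor.\<close>

lemma cofactor_eq:
  assumes P: "P \<in> P1" and f: "f \<in> L" "f \<noteq> 0" "f = lin P * h"
  obtains k k0 k1 k2 where "k \<noteq> 0" "h = form_scale k (quad k0 k1 k2)"
    "k1 ^ 2 - 4 * k0 * k2 = 3 ^ 2 * \<Delta> P" "ev (quad k0 k1 k2) P = 3 * ev \<phi> P"
proof -
  have "ev f P = 0" unfolding f(3) by simp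
  then obtain k where k: "k \<noteq> 0" "f = form_scale k (member P)" using eq_member[OF P f(1,2)] by blast
  obtain k0 k1 k2 where m: "member P = lin P * quad k0 k1 k2"
    "k1 ^ 2 - 4 * k0 * k2 = 3 ^ 2 * \<Delta> P" "ev (quad k0 k1 k2) P = 3 * ev \<phi> P"
    using member_factor[OF P] by blast
  have "lin P * h = lin P * form_scale k (quad k0 k1 k2)"
    using k(2) unfolding f(3) m(1) by (simp add: form_scale_mult_right)
  then have "h = form_scale k (quad k0 k1 k2)" using lin_nonzero[OF P] by (simp del:
      lin_form_eq_0_iff)
  then show ?thesis using that k(1) m by blast
qed

lemma cofactor_no_zeros:
  assumes P: "P \<in> P1" and f: "f \<in> L" "f \<noteq> 0" "f = lin P * h" and no: "zeros h = {}"
  shows "qchar (\<Delta> P) = -1" "ev \<phi> P \<noteq> 0"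
proof -
  obtain k k0 k1 k2 where k: "k \<noteq> 0" "h = form_scale k (quad k0 k1 k2)"
    "k1 ^ 2 - 4 * k0 * k2 = 3 ^ 2 * \<Delta> P" "ev (quad k0 k1 k2) P = 3 * ev \<phi> P"
    using cofactor_eq[OF P f] .
  have z: "zeros (quad k0 k1 k2) = {}" using no k by simp
  then show "qchar (\<Delta> P) = -1"
    using quad_no_zeros[OF two z] unfolding k(3) by (simp only: qchar_mult_square[OF three])
  show "ev \<phi> P \<noteq> 0" using z P k(4) by (auto simp: zeros_def simp del: form_eval_quad
      form_eval_quartic_form)
qed

text \<open>The discriminant of a product of two linear forms is the square of the value of one at
  the zero of the other, hence zero exactly when the zeros agree. The cofactor vanishes at
  \<open>P\<close> exactly when \<open>P\<close> is a multiple zero of \<open>f\<close>.\<close>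

lemma cofactor_split:
  assumes P: "P \<in> P1" and f: "f \<in> L" "f \<noteq> 0" "f = form_scale e (lin P * lin A * lin B)"
    and AB: "A \<in> P1" "B \<in> P1"
  shows "qchar (\<Delta> P) = (if A = B then 0 else 1)" "ev \<phi> P = 0 \<longleftrightarrow> P = A \<or> P = B"
proof -
  have e: "e \<noteq> 0" using f(2,3) by auto
  have "f = lin P * form_scale e (lin A * lin B)" using f(3) by (simp add: form_scale_mult_right
      mult.assoc)
  from cofactor_eq[OF P f(1,2) this]
  obtain k k0 k1 k2 where k: "k \<noteq> 0" "form_scale e (lin A * lin B) = form_scale k (quad k0 k1 k2)"
    "k1 ^ 2 - 4 * k0 * k2 = 3 ^ 2 * \<Delta> P" "ev (quad k0 k1 k2) P = 3 * ev \<phi> P" .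
  obtain s t s' t' where st: "A = (s, t)" "B = (s', t')" by (metis surj_pair)
  have kk: "e * (s * s') = k * k0" "e * - (s * t' + t * s') = k * k1" "e * (t * t') = k * k2"
    using k(2) unfolding st fst_conv snd_conv lin_form_mult_lin_form form_scale_quad quad_eq_iff
        by blast+
  have "(k * 3) ^ 2 * \<Delta> P = (k * k1) ^ 2 - 4 * (k * k0) * (k * k2)"
    unfolding power_mult_distrib mult.assoc k(3)[symmetric] by Groebner_Basis.algebra
  also have "\<dots> = (e * ev (lin A) B) ^ 2" 
    unfolding kk[symmetric] st form_eval_simps fst_conv snd_conv by Groebner_Basis.algebra
  finally have sq: "(k * 3) ^ 2 * \<Delta> P = (e * ev (lin A) B) ^ 2" .
  have k3: "k * 3 \<noteq> 0" using k(1) three by simp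
  have "qchar (\<Delta> P) = qchar ((e * ev (lin A) B) ^ 2)"
    using qchar_mult_square[OF k3, of "\<Delta> P"] unfolding sq by simp
  also have "\<dots> = (if A = B then 0 else 1)"
  proof (cases "A = B")
    case True
    have "ev (lin A) A = 0" by simp
    then show ?thesis using True by simp
  next
    case False
    then have "ev (lin A) B \<noteq> 0" using ev_lin_eq_0_iff[OF AB] by auto
    then have nz: "e * ev (lin A) B \<noteq> 0" using e by (simp only: mult_eq_0_iff simp_thms)
    show ?thesis unfolding qchar_square[OF nz] using False by simp
  qed
  finally show "qchar (\<Delta> P) = (if A = B then 0 else 1)" .
  have "k * (3 * ev \<phi> P) = ev (form_scale k (quad k0 k1 k2)) P"
    unfolding k(4)[symmetric] by (simp only: form_eval_simps)
  also have "\<dots> = e * (ev (lin A) P * ev (lin B) P)" unfolding k(2)[symmetric] by (simp only: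
      form_eval_simps)
  finally have "k * (3 * ev \<phi> P) = e * (ev (lin A) P * ev (lin B) P)" .
  then show "ev \<phi> P = 0 \<longleftrightarrow> P = A \<or> P = B"
    using k(1) three e ev_lin_eq_0_iff[OF AB(1) P] ev_lin_eq_0_iff[OF AB(2) P] by (metis
        mult_eq_0_iff)
qed

text \<open>Genericity removes cubes from the possible factorisations. In type P P Q the cofactor is
  \<open>lin P * lin Q\<close> at P, with square discriminant, and the square of
  \<open>lin P\<close> at Q, with discriminant 0.\<close>

lemma member_cases:
  assumes f: "f \<in> L" "f \<noteq> 0"
  obtains "zeros f = {}"
  | P g where "P \<in> P1" "g \<in> forms 2" "g \<noteq> 0" "zeros g = {}" "f = lin P * g"
      "qchar (\<Delta> P) = -1" "ev \<phi> P \<noteq> 0"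
  | e P Q where "e \<noteq> 0" "P \<noteq> Q" "P \<in> P1" "Q \<in> P1" "f = form_scale e (lin P * lin P * lin Q)"
      "qchar (\<Delta> P) = 1" "ev \<phi> P = 0" "qchar (\<Delta> Q) = 0" "ev \<phi> Q \<noteq> 0"
  | e P Q R where "e \<noteq> 0" "P \<noteq> Q" "R \<noteq> P" "R \<noteq> Q" "P \<in> P1" "Q \<in> P1" "R \<in> P1"
      "f = form_scale e (lin P * lin Q * lin R)"
      "qchar (\<Delta> P) = 1" "ev \<phi> P \<noteq> 0" "qchar (\<Delta> Q) = 1" "ev \<phi> Q \<noteq> 0"
      "qchar (\<Delta> R) = 1" "ev \<phi> R \<noteq> 0"
proof -
  note cs = that
  have no_cube: "f \<noteq> form_scale e (lin P * lin P * lin P)" if "P \<in> P1" "e \<noteq> 0" for e P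
    using generic_no_cube[OF generic that] f(1) by (auto simp: power3_eq_cube)
  have double: thesis if e: "e \<noteq> 0" "P \<in> P1" "Q \<in> P1" and f': "f = form_scale e (lin P * lin P *
      lin Q)" for e P Q
  proof -
    have PQ: "P \<noteq> Q" using no_cube[OF e(2,1)] f' by auto
    have fP: "f = form_scale e (lin P * lin P * lin Q)" "f = form_scale e (lin Q * lin P * lin P)"
      using f' by (simp_all add: mult_ac)
    show thesis
      using cs(3)[OF e(1) PQ e(2,3) f'] PQ cofactor_split[OF e(2) f fP(1) e(2,3)]
        cofactor_split[OF e(3) f fP(2) e(2,2)]
      by (simp del: form_eval_quartic_form)
  qed
  from L_forms[OF f(1)] f(2) show thesis
  proof (cases rule: cubic_form_cases)
    case 1
    then show ?thesis by (rule cs(1))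
  next
    case (2 P g)
    show ?thesis using cs(2)[OF 2] cofactor_no_zeros[OF 2(1) f 2(5,4)] by blast
  next
    case (3 e P Q R)
    note F = 3
    consider "P = Q" | "P = R" | "Q = R" | "P \<noteq> Q" "R \<noteq> P" "R \<noteq> Q" by blast
    then show ?thesis
    proof cases
      case 1
      then show ?thesis using double[of e P R] F by simp
    next
      case 2
      then show ?thesis using double[of e P Q] F by (simp add: mult_ac)
    next
      case 3
      then show ?thesis using double[of e Q P] F by (simp add: mult_ac)
    next
      case 4
      have fP: "f = form_scale e (lin P * lin Q * lin R)" "f = form_scale e (lin Q * lin P * lin R)"
        "f = form_scale e (lin R * lin P * lin Q)"
        using F(5) by (simp_all add: mult_ac)
      show ?thesis
        using cs(4)[OF F(1) 4 F(2,3,4,5)] 4 cofactor_split[OF F(2) f fP(1) F(3,4)]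
          cofactor_split[OF F(3) f fP(2) F(2,4)] cofactor_split[OF F(4) f fP(3) F(2,3)]
        by (auto simp del: form_eval_quartic_form)
    qed
  qed
qed

lemma orbits_disjoint_O1:
  assumes f: "f \<in> L" "f \<noteq> 0"
  shows "pg_point f \<notin> O1"
  using O1_zeros[OF _ f(2)] generic_no_cube[OF generic] f(1) by metis

text \<open>With cubes excluded, the number of rational zeros separates the remaining four
  orbits.\<close>

lemma orbits_zeros:
  assumes f: "f \<in> L" "f \<noteq> 0" and ns: "\<not> (\<exists>x. \<epsilon> = x ^ 2)"
  shows "pg_point f \<in> O2 \<longleftrightarrow> card (zeros f) = 2" "pg_point f \<in> O3 \<longleftrightarrow> card (zeros f) = 3"
    "pg_point f \<in> O4 \<epsilon> \<longleftrightarrow> card (zeros f) = 1" "pg_point f \<in> O5 \<longleftrightarrow> card (zeros f) = 0"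
proof -
  have "card (zeros f) = 0 \<and> pg_point f \<in> O5 \<or> card (zeros f) = 1 \<and> pg_point f \<in> O4 \<epsilon> \<or>
      card (zeros f) = 2 \<and> pg_point f \<in> O2 \<or> card (zeros f) = 3 \<and> pg_point f \<in> O3"
    using f
  proof (cases rule: member_cases)
    case 1
    then show ?thesis using O5_intro[OF L_forms[OF f(1)] f(2)] by simp
  next
    case (2 P g)
    then show ?thesis using O4_intro[OF two ns 2(1-4)] by simp
  next
    case (3 e P Q)
    then show ?thesis using O2_intro[of e P Q] by simp
  next
    case (4 e P Q R)
    then show ?thesis using O3_intro[of e P Q R] by simp
  qed
  then show "pg_point f \<in> O2 \<longleftrightarrow> card (zeros f) = 2" "pg_point f \<in> O3 \<longleftrightarrow> card (zeros f) = 3"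
    "pg_point f \<in> O4 \<epsilon> \<longleftrightarrow> card (zeros f) = 1" "pg_point f \<in> O5 \<longleftrightarrow> card (zeros f) = 0"
    using O2_zeros[OF _ f(2)] O3_zeros[OF _ f(2)] O4_zeros[OF _ f(2) ns] O5_zeros[OF _ f(2)]
    by auto
qed

lemma zeros_sums:
  assumes f: "f \<in> L" "f \<noteq> 0"
  shows "card (zeros f) \<le> 3"
    "(\<Sum>P\<in>zeros f. 1 + qchar (\<Delta> P)) = 3 * of_bool (card (zeros f) = 2) + 6 * of_bool (card (zeros
        f) = 3)"
    "(\<Sum>P\<in>zeros f. of_bool (ev \<phi> P = 0)) = (of_bool (card (zeros f) = 2) :: int)"
proof -
  have "card (zeros f) \<le> 3 \<and>
    (\<Sum>P\<in>zeros f. 1 + qchar (\<Delta> P)) = 3 * of_bool (card (zeros f) = 2) + 6 * of_bool (card (zeros f)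
        = 3) \<and>
    (\<Sum>P\<in>zeros f. of_bool (ev \<phi> P = 0)) = (of_bool (card (zeros f) = 2) :: int)"
    using f by (cases rule: member_cases) (auto simp del: form_eval_quartic_form)
  then show "card (zeros f) \<le> 3"
    "(\<Sum>P\<in>zeros f. 1 + qchar (\<Delta> P)) = 3 * of_bool (card (zeros f) = 2) + 6 * of_bool (card (zeros
        f) = 3)"
    "(\<Sum>P\<in>zeros f. of_bool (ev \<phi> P = 0)) = (of_bool (card (zeros f) = 2) :: int)"
    by blast+
qed

section \<open>Double counting along the map from the projective line to the pencil\<close>

definition fibre :: "'a poly poly set \<Rightarrow> ('a \<times> 'a) set" where
  "fibre s = {P \<in> P1. pg_point (member P) = s}"

lemma fibre_pg_point:
  assumes f: "f \<in> L" "f \<noteq> 0"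
  shows "fibre (pg_point f) = zeros f"
proof (intro equalityI subsetI)
  fix P assume "P \<in> fibre (pg_point f)"
  then have P: "P \<in> P1" "pg_point (member P) = pg_point f" by (auto simp: fibre_def)
  have "P \<in> zeros (member P)" using P ev_member by (simp add: zeros_def)
  then show "P \<in> zeros f" using zeros_eq_of_pg_point[OF P(2) member_ne[OF P(1)]] by simp
next
  fix P assume "P \<in> zeros f"
  then have P: "P \<in> P1" "ev f P = 0" by (auto simp: zeros_def)
  obtain k where "k \<noteq> 0" "f = form_scale k (member P)" using eq_member[OF P(1) f P(2)] .
  then show "P \<in> fibre (pg_point f)" using P by (simp add: fibre_def pg_point_scale)
qed

lemma PG_L_E:
  assumes "s \<in> PG L"
  obtains f where "f \<in> L" "f \<noteq> 0" "s = pg_point f" "fibre s = zeros f"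
  using assms fibre_pg_point unfolding PG_def by auto

lemma bij_PG: "bij_betw (\<lambda>(a, b). pg_point (form_scale a U + form_scale b V)) P1 (PG L)"
  unfolding bij_betw_def
proof
  show "inj_on (\<lambda>(a, b). pg_point (form_scale a U + form_scale b V)) P1"
  proof (rule inj_onI, clarify)
    fix a b a' b'
    assume *: "(a, b) \<in> P1" "(a', b') \<in> P1"
      "pg_point (form_scale a U + form_scale b V) = pg_point (form_scale a' U + form_scale b' V)"
    have "form_scale a U + form_scale b V \<noteq> 0" using independent[of a b] P1_nonzero[OF *(1)] by auto
    then obtain c where c: "form_scale a U + form_scale b V = form_scale c (form_scale a' U +
        form_scale b' V)"
      using pg_point_eqD[OF *(3)] by blast
    have "form_scale (a - c * a') U + form_scale (b - c * b') V =
        (form_scale a U + form_scale b V) - form_scale c (form_scale a' U + form_scale b' V)"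
      by (simp add: form.scale_left_diff_distrib form.scale_right_distrib)
    then have "a = c * a'" "b = c * b'" using independent[of "a - c * a'" "b - c * b'"] c by
        simp_all
    then show "a = a' \<and> b = b'" using *(1,2) by (auto simp: P1_def)
  qed
  show "(\<lambda>(a, b). pg_point (form_scale a U + form_scale b V)) ` P1 = PG L"
  proof (intro equalityI subsetI)
    fix s assume "s \<in> (\<lambda>(a, b). pg_point (form_scale a U + form_scale b V)) ` P1"
    then obtain a b where ab: "(a, b) \<in> P1" "s = pg_point (form_scale a U + form_scale b V)" by auto
    then have "form_scale a U + form_scale b V \<noteq> 0" using independent[of a b] P1_nonzero[OF ab(1)]
        by auto
    moreover have "form_scale a U + form_scale b V \<in> L" unfolding span_pair by blast
    ultimately show "s \<in> PG L" unfolding PG_def ab(2) by blast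
  next
    fix s assume "s \<in> PG L"
    then obtain f where f: "f \<in> L" "f \<noteq> 0" "s = pg_point f" unfolding PG_def by blast
    then obtain a b where ab: "f = form_scale a U + form_scale b V" unfolding span_pair by blast
    then have "(a, b) \<noteq> (0, 0)" using f(2) by auto
    then obtain c P where c: "c \<noteq> 0" "P \<in> P1" "a = c * fst P" "b = c * snd P" by (rule P1_normalise)
    have "f = form_scale c (form_scale (fst P) U + form_scale (snd P) V)"
      unfolding ab c(3,4) by (simp add: form.scale_right_distrib)
    then have "s = pg_point (form_scale (fst P) U + form_scale (snd P) V)"
      using pg_point_scale[OF c(1)] f(3) by simp
    then show "s \<in> (\<lambda>(a, b). pg_point (form_scale a U + form_scale b V)) ` P1"
      using c(2) by (intro image_eqI[of _ _ P]) (auto simp: case_prod_beta)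
  qed
qed

lemma card_PG: "card (PG L) = CARD('a) + 1"
  using bij_betw_same_card[OF bij_PG] card_P1[where 'k = 'a] by simp

lemma finite_PG: "finite (PG L)"
  using bij_betw_finite[OF bij_PG] by simp

lemma sum_fibres: "(\<Sum>s\<in>PG L. sum h (fibre s)) = (sum h P1 :: int)"
  unfolding fibre_def using member_L member_ne
  by (intro sum.group finite_PG) (auto simp: PG_def)

abbreviation "num n \<equiv> int (card {s \<in> PG L. card (fibre s) = n})"

lemma sum_of_bool_fibre: "(\<Sum>s\<in>PG L. of_bool (card (fibre s) = n)) = num n"
  using finite_PG by (simp add: Collect_conj_eq Int_commute)

text \<open>The points of the pencil are counted with weight 1, then with the weights from
  \<open>zeros_sums\<close>; in the latter case \<open>sum_fibres\<close> turns the sum over the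
  pencil into a sum over \<open>P1\<close>.\<close>

lemma count_equations:
  "num 0 + num 1 + num 2 + num 3 = int CARD('a) + 1"
  "num 1 + 2 * num 2 + 3 * num 3 = int CARD('a) + 1"
  "3 * num 2 + 6 * num 3 = (\<Sum>P\<in>P1. 1 + qchar (\<Delta> P))"
  "num 2 = int (card (zeros \<phi>))"
proof -
  let ?b = "\<lambda>n s. of_bool (card (fibre s) = n) :: int"
  have le: "card (fibre s) = 0 \<or> card (fibre s) = 1 \<or> card (fibre s) = 2 \<or> card (fibre s) = 3"
    if "s \<in> PG L" for s
  proof -
    obtain f where "f \<in> L" "f \<noteq> 0" "fibre s = zeros f" using PG_L_E[OF \<open>s \<in> PG L\<close>] by metis
    then have "card (fibre s) \<le> 3" using zeros_sums(1) by simp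
    then show ?thesis by arith
  qed
  have "(\<Sum>s\<in>PG L. ?b 0 s + ?b 1 s + ?b 2 s + ?b 3 s) = (\<Sum>s\<in>PG L. 1)"
    by (rule sum.cong[OF refl]) (use le in force)
  then show "num 0 + num 1 + num 2 + num 3 = int CARD('a) + 1"
    by (simp only: sum.distrib sum_of_bool_fibre) (simp add: card_PG)
  have "(\<Sum>s\<in>PG L. ?b 1 s + 2 * ?b 2 s + 3 * ?b 3 s) = (\<Sum>s\<in>PG L. \<Sum>P\<in>fibre s. 1)"
    by (rule sum.cong[OF refl]) (use le in force)
  then show "num 1 + 2 * num 2 + 3 * num 3 = int CARD('a) + 1"
    unfolding sum_fibres by (simp only: sum.distrib sum_distrib_left[symmetric] sum_of_bool_fibre)
        (simp add: card_P1)
  have "(\<Sum>s\<in>PG L. 3 * ?b 2 s + 6 * ?b 3 s) = (\<Sum>s\<in>PG L. \<Sum>P\<in>fibre s. 1 + qchar (\<Delta> P))"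
  proof (rule sum.cong[OF refl])
    fix s assume "s \<in> PG L"
    then obtain f where "f \<in> L" "f \<noteq> 0" "fibre s = zeros f" using PG_L_E by metis
    then show "3 * ?b 2 s + 6 * ?b 3 s = (\<Sum>P\<in>fibre s. 1 + qchar (\<Delta> P))" using zeros_sums(2) by simp
  qed
  then show "3 * num 2 + 6 * num 3 = (\<Sum>P\<in>P1. 1 + qchar (\<Delta> P))"
    unfolding sum_fibres by (simp only: sum.distrib sum_distrib_left[symmetric] sum_of_bool_fibre)
  have "(\<Sum>s\<in>PG L. ?b 2 s) = (\<Sum>s\<in>PG L. \<Sum>P\<in>fibre s. of_bool (ev \<phi> P = 0))"
  proof (rule sum.cong[OF refl])
    fix s assume "s \<in> PG L"
    then obtain f where "f \<in> L" "f \<noteq> 0" "fibre s = zeros f" using PG_L_E by metis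
    then show "?b 2 s = (\<Sum>P\<in>fibre s. of_bool (ev \<phi> P = 0))" using zeros_sums(3) by simp
  qed
  then show "num 2 = int (card (zeros \<phi>))"
    unfolding sum_fibres sum_of_bool_fibre zeros_def
    by (simp add: Collect_conj_eq Int_commute del: form_eval_quartic_form)
qed

lemma PG_orbits:
  assumes ns: "\<not> (\<exists>x. \<epsilon> = x ^ 2)"
  shows "PG L \<inter> O1 = {}" "PG L \<inter> O2 = {s \<in> PG L. card (fibre s) = 2}"
    "PG L \<inter> O3 = {s \<in> PG L. card (fibre s) = 3}" "PG L \<inter> O4 \<epsilon> = {s \<in> PG L. card (fibre s) = 1}"
    "PG L \<inter> O5 = {s \<in> PG L. card (fibre s) = 0}"
proof -
  have "s \<notin> O1 \<and> (s \<in> O2 \<longleftrightarrow> card (fibre s) = 2) \<and> (s \<in> O3 \<longleftrightarrow> card (fibre s) = 3) \<and>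
      (s \<in> O4 \<epsilon> \<longleftrightarrow> card (fibre s) = 1) \<and> (s \<in> O5 \<longleftrightarrow> card (fibre s) = 0)" if s: "s \<in> PG L" for s
  proof -
    obtain f where f: "f \<in> L" "f \<noteq> 0" "s = pg_point f" "fibre s = zeros f" using PG_L_E[OF s] .
    show ?thesis unfolding f(4) unfolding f(3)
      using orbits_disjoint_O1[OF f(1,2)] orbits_zeros[OF f(1,2) ns] by blast
  qed
  then show "PG L \<inter> O1 = {}" "PG L \<inter> O2 = {s \<in> PG L. card (fibre s) = 2}"
    "PG L \<inter> O3 = {s \<in> PG L. card (fibre s) = 3}" "PG L \<inter> O4 \<epsilon> = {s \<in> PG L. card (fibre s) = 1}"
    "PG L \<inter> O5 = {s \<in> PG L. card (fibre s) = 0}"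
    by blast+
qed

section \<open>The invariants of \<Delta> and the elliptic curve\<close>

definition g2 where "g2 = 3 * z 5 * quartic_J z + 15 / 4 * quartic_I z ^ 2"

definition g3 where
  "g3 = - (1 / 8) * (11 * quartic_I z ^ 3 + 2 * quartic_J z ^ 2 + 14 * z 5 ^ 3 * quartic_J z)"

lemma g2_eq: "4 * g2 = 12 * z 5 * quartic_J z + 15 * z 5 ^ 4"
proof -
  have "4 * g2 = 4 * (3 * z 5 * quartic_J z) + 15 * (z 5 ^ 2) ^ 2"
    using four by (simp add: g2_def I_eq distrib_left)
  then show ?thesis by Groebner_Basis.algebra
qed

lemma g3_eq: "8 * g3 = - (11 * z 5 ^ 6 + 2 * quartic_J z ^ 2 + 14 * z 5 ^ 3 * quartic_J z)"
proof -
  have "(8::'a) = 2 ^ 3" by simp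
  then have "(8::'a) \<noteq> 0" using two by (simp only: power_eq_0_iff) simp
  then have "8 * (- (1 / 8) * x) = - x" for x :: 'a by simp
  then have "8 * g3 = - (11 * (z 5 ^ 2) ^ 3 + 2 * quartic_J z ^ 2 + 14 * z 5 ^ 3 * quartic_J z)"
    unfolding g3_def I_eq .
  then show ?thesis by Groebner_Basis.algebra
qed

text \<open>Neither factor on the right vanishes by \<open>J_ne\<close>, and 108 = 2^2 * 3^3, so
  this identity yields smoothness.\<close>

lemma discriminant: "64 * (g2 ^ 3 - 27 * g3 ^ 2) = 108 * (z 5 ^ 3 - quartic_J z) ^ 3 * (z 5 ^ 3 +
    quartic_J z)"
proof -
  have "64 * (g2 ^ 3 - 27 * g3 ^ 2) = (4 * g2) ^ 3 - 27 * (8 * g3) ^ 2" by Groebner_Basis.algebra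
  also have "\<dots> = 108 * (z 5 ^ 3 - quartic_J z) ^ 3 * (z 5 ^ 3 + quartic_J z)"
    unfolding g2_eq g3_eq by Groebner_Basis.algebra
  finally show ?thesis .
qed

lemma elliptic_g2_g3: "elliptic g2 g3"
  unfolding elliptic_def
proof
  assume "g2 ^ 3 - 27 * g3 ^ 2 = 0"
  then have "2 ^ 2 * (3 ^ 3 * ((z 5 ^ 3 - quartic_J z) ^ 3 * (z 5 ^ 3 + quartic_J z))) = 0"
    using discriminant by simp
  then have "z 5 ^ 3 - quartic_J z = 0 \<or> z 5 ^ 3 + quartic_J z = 0"
    using two three by (simp only: mult_eq_0_iff power_eq_0_iff) simp
  then show False using J_ne by (auto simp: eq_neg_iff_add_eq_0 add.commute)
qed

text \<open>Valid modulo the Pluecker relation, whose cofactor is displayed. The factor 16 = 4^2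
  here and 64 = 4^3 in \<open>inv_j_Q\<close> reflect a rescaling of the variable by 4.\<close>

lemma inv_i_Q: "inv_i Q0 Q1 Q2 Q3 Q4 = 16 * g2"
proof -
  have "inv_i Q0 Q1 Q2 Q3 Q4 = 4 * (12 * z 5 * quartic_J z + 15 * z 5 ^ 4) +
    (z 0 * z 4 - 4 * z 1 * z 3 + 3 * z 2 ^ 2 - 3 * z 5 ^ 2) *
    (- 16 * z 1 * z 3 - 16 * z 2 * z 5 + 16 * z 2 ^ 2 + 16 * z 5 ^ 2)"
    unfolding inv_i_def Q_defs quartic_J_eq by Groebner_Basis.algebra
  then show ?thesis unfolding rel g2_eq[symmetric] by simp
qed

lemma inv_j_Q: "inv_j Q0 Q1 Q2 Q3 Q4 = 64 * g3"
proof -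
  have "inv_j Q0 Q1 Q2 Q3 Q4 = 8 * (- (11 * z 5 ^ 6 + 2 * quartic_J z ^ 2 + 14 * z 5 ^ 3 *
      quartic_J z)) +
    (z 0 * z 4 - 4 * z 1 * z 3 + 3 * z 2 ^ 2 - 3 * z 5 ^ 2) *
    (- 16 * z 0 * z 2 * z 3 ^ 2 + 16 * z 0 * z 2 ^ 2 * z 4 + 16 * z 0 * z 3 ^ 2 * z 5
      - 96 * z 1 * z 2 * z 3 * z 5 + 32 * z 1 * z 2 ^ 2 * z 3 + 48 * z 1 * z 3 * z 5 ^ 2
      - 16 * z 1 ^ 2 * z 2 * z 4 + 16 * z 1 ^ 2 * z 4 * z 5 - 16 * z 2 * z 5 ^ 3
      - 48 * z 2 ^ 2 * z 5 ^ 2 + 64 * z 2 ^ 3 * z 5 - 16 * z 2 ^ 4 - 32 * z 5 ^ 4)"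
    unfolding inv_j_def Q_defs quartic_J_eq by Groebner_Basis.algebra
  then show ?thesis unfolding rel g3_eq[symmetric] by simp
qed

text \<open>At (1, 0) the value of \<Delta> is \<open>Q0\<close>, so the sum over \<open>P1\<close>
  produces exactly the left side of \<open>quartic_sum\<close>.\<close>

lemma sum_\<Delta>: "(\<Sum>P\<in>P1. 1 + qchar (\<Delta> P)) = int (card (curve_points g2 g3))"
proof -
  have "inv_i Q0 Q1 Q2 Q3 Q4 ^ 3 - 27 * inv_j Q0 Q1 Q2 Q3 Q4 ^ 2 = 2 ^ 12 * (g2 ^ 3 - 27 * g3 ^ 2)"
    unfolding inv_i_Q inv_j_Q by Groebner_Basis.algebra
  moreover have "2 ^ 12 * (g2 ^ 3 - 27 * g3 ^ 2) \<noteq> 0"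
    using elliptic_g2_g3 two unfolding elliptic_def by (simp only: mult_eq_0_iff power_eq_0_iff)
        simp
  ultimately have disc: "inv_i Q0 Q1 Q2 Q3 Q4 ^ 3 \<noteq> 27 * inv_j Q0 Q1 Q2 Q3 Q4 ^ 2"
    by (metis right_minus_eq)
  have "(\<Sum>P\<in>P1. 1 + qchar (\<Delta> P)) =
      int CARD('a) + 1 + ((\<Sum>x\<in>UNIV. qchar (biquartic Q0 Q1 Q2 Q3 Q4 x 1)) + qchar Q0)"
    by (simp add: sum.distrib card_P1) (simp add: sum_P1 \<Delta>_def biquartic_def)
  also have "\<dots> = int CARD('a) + 1 + (\<Sum>x\<in>UNIV. qchar (4 * x ^ 3 - 16 * g2 * x - 64 * g3))"
    unfolding quartic_sum[OF two disc] inv_i_Q inv_j_Q ..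
  \<comment> \<open>Replacing x by 4 x extracts the common factor 64, which is a square.\<close>
  also have "(\<Sum>x\<in>UNIV. qchar (4 * x ^ 3 - 16 * g2 * x - 64 * g3)) =
      (\<Sum>x\<in>UNIV. qchar (4 * (4 * x + 0) ^ 3 - 16 * g2 * (4 * x + 0) - 64 * g3))"
    by (rule sum_shift[OF four, symmetric])
  also have "\<dots> = (\<Sum>x\<in>UNIV. qchar (4 * x ^ 3 - g2 * x - g3))"
  proof (rule sum.cong[OF refl])
    fix x
    have nz: "(2 ^ 3 :: 'a) \<noteq> 0" using two by (simp only: power_eq_0_iff) simp
    have eq: "4 * (4 * x + 0) ^ 3 - 16 * g2 * (4 * x + 0) - 64 * g3 = (2 ^ 3) ^ 2 * (4 * x ^ 3 -
        g2 * x - g3)"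
      by Groebner_Basis.algebra
    show "qchar (4 * (4 * x + 0) ^ 3 - 16 * g2 * (4 * x + 0) - 64 * g3) = qchar (4 * x ^ 3 - g2 *
        x - g3)"
      unfolding eq by (rule qchar_mult_square[OF nz])
  qed
  finally show ?thesis unfolding card_curve_points[OF two] .
qed

end

text \<open>Comparing the first two equations gives n0 = n2 + 2 n3, which is a third of the last
  left side.\<close>

lemma solve_counts:
  fixes n0 n1 n2 n3 q e :: nat
  assumes "n0 + n1 + n2 + n3 = q + 1" "n1 + 2 * n2 + 3 * n3 = q + 1" "3 * n2 + 6 * n3 = e"
  shows "real n3 = (real e - 3 * real n2) / 6" "real n1 = real q + 1 - (real e + real n2) / 2"
    "real n0 = real e / 3"
proof -
  have n1: "n1 = q + 1 - 2 * n2 - 3 * n3" "2 * n2 + 3 * n3 \<le> q + 1" using assms(2) by linarith+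
  have n0: "n0 = n2 + 2 * n3" using assms(1,2) by linarith
  show "real n3 = (real e - 3 * real n2) / 6" "real n0 = real e / 3"
    unfolding n0 assms(3)[symmetric] by (simp_all add: field_simps)
  show "real n1 = real q + 1 - (real e + real n2) / 2"
    using n1(2) unfolding n1(1) assms(3)[symmetric] by (simp add: field_simps of_nat_diff)
qed

theorem theorem1p3:
  fixes L :: "'a::{field,finite} poly poly set"
    and z :: "nat \<Rightarrow> 'a"
    and \<epsilon> :: 'a
  assumes "CHAR('a) \<noteq> 2" and "CHAR('a) \<noteq> 3" and "CARD('a) > 4"
    and "\<not> (\<exists>x. \<epsilon> = x ^ 2)"
    and "pg_line L" and "generic_line L" and "line_coords L z"
  shows "let q = real CARD('a);
             \<S> = PG L;
             sqrtI = z 5;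
             I = quartic_I z;
             J = quartic_J z;
             g2 = 3 * sqrtI * J + 15 / 4 * I ^ 2;
             g3 = - (1 / 8) * (11 * I ^ 3 + 2 * J ^ 2 + 14 * sqrtI ^ 3 * J);
             E = real (card (curve_points g2 g3));
             \<eta> = eta (quartic_form z)
         in elliptic g2 g3 \<and>
            card (\<S> \<inter> O1) = 0 \<and>
            card (\<S> \<inter> O2) = \<eta> \<and>
            real (card (\<S> \<inter> O3)) = (E - 3 * real \<eta>) / 6 \<and>
            real (card (\<S> \<inter> O4 \<epsilon>)) = q + 1 - (E + real \<eta>) / 2 \<and>
            real (card (\<S> \<inter> O5)) = E / 3"
proof -
  obtain u v where L: "L = form.span {cubic_form u, cubic_form v}" and p: "plucker_coords u v z"
    using assms(7) unfolding line_coords_def Let_def plucker_coords_def by blast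
  have "of_nat 2 \<noteq> (0::'a)" "of_nat 3 \<noteq> (0::'a)"
    using neq_0_of_CHAR[OF assms(1)] neq_0_of_CHAR[OF assms(2)] by simp_all
  then interpret generic_pencil u v z
    using p assms(6) unfolding L by unfold_locales simp_all
  let ?S = "PG (form.span {cubic_form u, cubic_form v})"
  let ?E = "card (curve_points g2 g3)" and ?n = "\<lambda>n. card {s \<in> ?S. card (fibre s) = n}"
  have n: "?n 0 + ?n 1 + ?n 2 + ?n 3 = CARD('a) + 1" "?n 1 + 2 * ?n 2 + 3 * ?n 3 = CARD('a) + 1"
    "3 * ?n 2 + 6 * ?n 3 = ?E" "?n 2 = eta (quartic_form z)"
    using count_equations unfolding sum_\<Delta> eta_\<phi>[symmetric] by linarith+
  note counts = solve_counts[OF n(1-3), unfolded n(4)]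
  from counts n(4) show ?thesis
    using elliptic_g2_g3
    unfolding Let_def L g2_def[symmetric] g3_def[symmetric] PG_orbits[OF assms(4)] by simp
qed

end
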